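(* Let $T$ be a complete (discrete or continuous) theory with monster model $\mathbb{M}$. For any set $A$ of hyperimaginaries and any real tuples $b$ and $c$, there is a real tuple $b'$ with $b' \equiv_A b$ such that $b' \perp^{\mathrm{bu}}_A c$.
   Context: $\mathbb{M}$ is a monster model (sufficiently saturated and strongly homogeneous); "small" means of cardinality less than its saturation, and a class is "bounded" if it is small. An invariant equivalence relation is an equivalence relation $E$ on $\mathbb{M}^x$ (for some tuple of variables $x$) such that $ab \equiv cd$ implies ($aEb \iff cEd$). An ultraimaginary is an $E$-class $a_E$ of a tuple $a$ for such an $E$. Real tuples, hyperimaginaries (classes of tuples modulo type-definable equivalence relations), sets of these, and finite or infinite collections of ultraimaginaries (e.g. $A b_F$) are all regarded as ultraimaginaries (using product equivalence relations). For an ultraimaginary $a_E$, $\operatorname{Aut}(\mathbb{M}/a_E) = \{\sigma \in \operatorname{Aut}(\mathbb{M}) : a \mathrel{E} \sigma(a)\}$. An ultraimaginary $b_F$ is bounded over $a_E$ if its orbit under $\operatorname{Aut}(\mathbb{M}/a_E)$ is small; $\operatorname{bdd}^u(a_E)$ denotes the class of ultraimaginaries bounded over $a_E$. $b \equiv_A b'$ means some automorphism fixing every element of $A$ maps $b$ to $b'$. Bounded ultraimaginary independence: $b \perp^{\mathrm{bu}}_A c$ iff $\operatorname{bdd}^u(Ab) \cap \operatorname{bdd}^u(Ac) = \operatorname{bdd}^u(A)$. *)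

theory Defs
  imports "HOL-Analysis.Analysis"
begin

unbundle cardinal_syntax

section \<open>First-order logic\<close>

text \<open>A structure has a type as its universe. Interpretations are only meaningful on symbols
  of the language, applied to lists whose length is the arity.\<close>

record ('f, 'p) lang =
  fsyms :: "'f set"
  psyms :: "'p set"
  farity :: "'f \<Rightarrow> nat"
  parity :: "'p \<Rightarrow> nat"

datatype 'f tm = Var nat | App 'f "'f tm list"

primrec fv_tm :: "'f tm \<Rightarrow> nat set" where
  "fv_tm (Var n) = {n}"
| "fv_tm (App f ts) = \<Union> (set (map fv_tm ts))"

primrec wf_tm :: "('f, 'p, 'z) lang_scheme \<Rightarrow> 'f tm \<Rightarrow> bool" where
  "wf_tm L (Var n) \<longleftrightarrow> True"
| "wf_tm L (App f ts) \<longleftrightarrow> f \<in> fsyms L \<and> length ts = farity L f \<and> list_all (wf_tm L) ts"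

primrec tm_val :: "('f \<Rightarrow> 'a list \<Rightarrow> 'a) \<Rightarrow> (nat \<Rightarrow> 'a) \<Rightarrow> 'f tm \<Rightarrow> 'a" where
  "tm_val F e (Var n) = e n"
| "tm_val F e (App f ts) = F f (map (tm_val F e) ts)"

datatype ('f, 'p) fm =
    Eq "'f tm" "'f tm"
  | Rel 'p "'f tm list"
  | Neg "('f, 'p) fm"
  | Conj "('f, 'p) fm" "('f, 'p) fm"
  | Exists nat "('f, 'p) fm"

primrec fv_fm :: "('f, 'p) fm \<Rightarrow> nat set" where
  "fv_fm (Eq s t) = fv_tm s \<union> fv_tm t"
| "fv_fm (Rel p ts) = (\<Union>t\<in>set ts. fv_tm t)"
| "fv_fm (Neg \<phi>) = fv_fm \<phi>"
| "fv_fm (Conj \<phi> \<psi>) = fv_fm \<phi> \<union> fv_fm \<psi>"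
| "fv_fm (Exists n \<phi>) = fv_fm \<phi> - {n}"

primrec wf_fm :: "('f, 'p, 'z) lang_scheme \<Rightarrow> ('f, 'p) fm \<Rightarrow> bool" where
  "wf_fm L (Eq s t) \<longleftrightarrow> wf_tm L s \<and> wf_tm L t"
| "wf_fm L (Rel p ts) \<longleftrightarrow> p \<in> psyms L \<and> length ts = parity L p \<and> list_all (wf_tm L) ts"
| "wf_fm L (Neg \<phi>) \<longleftrightarrow> wf_fm L \<phi>"
| "wf_fm L (Conj \<phi> \<psi>) \<longleftrightarrow> wf_fm L \<phi> \<and> wf_fm L \<psi>"
| "wf_fm L (Exists n \<phi>) \<longleftrightarrow> wf_fm L \<phi>"

record ('f, 'p, 'a) struct =
  fint :: "'f \<Rightarrow> 'a list \<Rightarrow> 'a"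
  pint :: "'p \<Rightarrow> 'a list \<Rightarrow> bool"

primrec sat :: "('f, 'p, 'a) struct \<Rightarrow> (nat \<Rightarrow> 'a) \<Rightarrow> ('f, 'p) fm \<Rightarrow> bool" where
  "sat M e (Eq s t) \<longleftrightarrow> tm_val (fint M) e s = tm_val (fint M) e t"
| "sat M e (Rel p ts) \<longleftrightarrow> pint M p (map (tm_val (fint M) e) ts)"
| "sat M e (Neg \<phi>) \<longleftrightarrow> \<not> sat M e \<phi>"
| "sat M e (Conj \<phi> \<psi>) \<longleftrightarrow> sat M e \<phi> \<and> sat M e \<psi>"
| "sat M e (Exists n \<phi>) \<longleftrightarrow> (\<exists>x. sat M (e(n := x)) \<phi>)"

definition sentences :: "('f, 'p) lang \<Rightarrow> ('f, 'p) fm set" where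
  "sentences L = {\<phi>. wf_fm L \<phi> \<and> fv_fm \<phi> = {}}"

text \<open>Consistency is not part of the following definition: it is only used together with a model.\<close>

definition complete_theory :: "('f, 'p) lang \<Rightarrow> ('f, 'p) fm set \<Rightarrow> bool" where
  "complete_theory L T \<longleftrightarrow> T \<subseteq> sentences L \<and> (\<forall>\<phi>\<in>sentences L. \<phi> \<in> T \<or> Neg \<phi> \<in> T)"

definition is_model :: "('f, 'p, 'a) struct \<Rightarrow> ('f, 'p) fm set \<Rightarrow> bool" where
  "is_model M T \<longleftrightarrow> (\<forall>\<phi>\<in>T. \<forall>e. sat M e \<phi>)"

definition automorphisms :: "('f, 'p) lang \<Rightarrow> ('f, 'p, 'a) struct \<Rightarrow> ('a \<Rightarrow> 'a) set" where
  "automorphisms L M = {\<sigma>. bij \<sigma> \<and>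
     (\<forall>f\<in>fsyms L. \<forall>xs. length xs = farity L f \<longrightarrow> \<sigma> (fint M f xs) = fint M f (map \<sigma> xs)) \<and>
     (\<forall>p\<in>psyms L. \<forall>xs. length xs = parity L p \<longrightarrow> pint M p (map \<sigma> xs) = pint M p xs)}"


section \<open>Continuous first-order logic\<close>

text \<open>Metric structures of diameter at most 1 with [0,1]-valued predicates; a modulus of uniform
  continuity for each symbol is part of the language. The connectives are the constants, halving
  and truncated subtraction; the functions they generate are uniformly dense in the continuous
  functions from [0,1]^n to [0,1].\<close>

record ('f, 'p) clang = "('f, 'p) lang" +
  fmod :: "'f \<Rightarrow> real \<Rightarrow> real"
  pmod :: "'p \<Rightarrow> real \<Rightarrow> real"

definition wf_clang :: "('f, 'p) clang \<Rightarrow> bool" where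
  "wf_clang L \<longleftrightarrow> (\<forall>\<epsilon>\<in>{0<..1}. (\<forall>f\<in>fsyms L. fmod L f \<epsilon> > 0) \<and> (\<forall>p\<in>psyms L. pmod L p \<epsilon> > 0))"

datatype ('f, 'p) cfm =
    CDist "'f tm" "'f tm"
  | CRel 'p "'f tm list"
  | CConst real
  | CHalf "('f, 'p) cfm"
  | CMonus "('f, 'p) cfm" "('f, 'p) cfm"
  | CSup nat "('f, 'p) cfm"
  | CInf nat "('f, 'p) cfm"

primrec fv_cfm :: "('f, 'p) cfm \<Rightarrow> nat set" where
  "fv_cfm (CDist s t) = fv_tm s \<union> fv_tm t"
| "fv_cfm (CRel p ts) = (\<Union>t\<in>set ts. fv_tm t)"
| "fv_cfm (CConst r) = {}"
| "fv_cfm (CHalf \<phi>) = fv_cfm \<phi>"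
| "fv_cfm (CMonus \<phi> \<psi>) = fv_cfm \<phi> \<union> fv_cfm \<psi>"
| "fv_cfm (CSup n \<phi>) = fv_cfm \<phi> - {n}"
| "fv_cfm (CInf n \<phi>) = fv_cfm \<phi> - {n}"

primrec wf_cfm :: "('f, 'p, 'z) lang_scheme \<Rightarrow> ('f, 'p) cfm \<Rightarrow> bool" where
  "wf_cfm L (CDist s t) \<longleftrightarrow> wf_tm L s \<and> wf_tm L t"
| "wf_cfm L (CRel p ts) \<longleftrightarrow> p \<in> psyms L \<and> length ts = parity L p \<and> list_all (wf_tm L) ts"
| "wf_cfm L (CConst r) \<longleftrightarrow> r \<in> {0..1}"
| "wf_cfm L (CHalf \<phi>) \<longleftrightarrow> wf_cfm L \<phi>"
| "wf_cfm L (CMonus \<phi> \<psi>) \<longleftrightarrow> wf_cfm L \<phi> \<and> wf_cfm L \<psi>"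
| "wf_cfm L (CSup n \<phi>) \<longleftrightarrow> wf_cfm L \<phi>"
| "wf_cfm L (CInf n \<phi>) \<longleftrightarrow> wf_cfm L \<phi>"

record ('f, 'p, 'a) cstruct =
  cdist :: "'a \<Rightarrow> 'a \<Rightarrow> real"
  cfint :: "'f \<Rightarrow> 'a list \<Rightarrow> 'a"
  cpint :: "'p \<Rightarrow> 'a list \<Rightarrow> real"

definition metric_structure :: "('f, 'p) clang \<Rightarrow> ('f, 'p, 'a) cstruct \<Rightarrow> bool" where
  "metric_structure L M \<longleftrightarrow>
     Metric_space UNIV (cdist M) \<and> Metric_space.mcomplete UNIV (cdist M) \<and>
     (\<forall>x y. cdist M x y \<le> 1) \<and>
     (\<forall>p\<in>psyms L. \<forall>xs. length xs = parity L p \<longrightarrow> cpint M p xs \<in> {0..1}) \<and>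
     (\<forall>f\<in>fsyms L. \<forall>\<epsilon>\<in>{0<..1}. \<forall>xs ys. length xs = farity L f \<and>
        list_all2 (\<lambda>x y. cdist M x y < fmod L f \<epsilon>) xs ys \<longrightarrow>
        cdist M (cfint M f xs) (cfint M f ys) \<le> \<epsilon>) \<and>
     (\<forall>p\<in>psyms L. \<forall>\<epsilon>\<in>{0<..1}. \<forall>xs ys. length xs = parity L p \<and>
        list_all2 (\<lambda>x y. cdist M x y < pmod L p \<epsilon>) xs ys \<longrightarrow>
        \<bar>cpint M p xs - cpint M p ys\<bar> \<le> \<epsilon>)"

primrec cval :: "('f, 'p, 'a) cstruct \<Rightarrow> (nat \<Rightarrow> 'a) \<Rightarrow> ('f, 'p) cfm \<Rightarrow> real" where
  "cval M e (CDist s t) = cdist M (tm_val (cfint M) e s) (tm_val (cfint M) e t)"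
| "cval M e (CRel p ts) = cpint M p (map (tm_val (cfint M) e) ts)"
| "cval M e (CConst r) = r"
| "cval M e (CHalf \<phi>) = cval M e \<phi> / 2"
| "cval M e (CMonus \<phi> \<psi>) = max 0 (cval M e \<phi> - cval M e \<psi>)"
| "cval M e (CSup n \<phi>) = (SUP x. cval M (e(n := x)) \<phi>)"
| "cval M e (CInf n \<phi>) = (INF x. cval M (e(n := x)) \<phi>)"

definition csentences :: "('f, 'p) clang \<Rightarrow> ('f, 'p) cfm set" where
  "csentences L = {\<phi>. wf_cfm L \<phi> \<and> fv_cfm \<phi> = {}}"

text \<open>A theory is a set of closed conditions of the form \<phi> = 0, given by the sentences \<phi>. It is
  complete if it prescribes the value of every sentence; \<phi> = r is expressed by the two conditions
  below.\<close>

definition complete_ctheory :: "('f, 'p) clang \<Rightarrow> ('f, 'p) cfm set \<Rightarrow> bool" where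
  "complete_ctheory L T \<longleftrightarrow> T \<subseteq> csentences L \<and>
     (\<forall>\<phi>\<in>csentences L. \<exists>r\<in>{0..1}. CMonus \<phi> (CConst r) \<in> T \<and> CMonus (CConst r) \<phi> \<in> T)"

definition is_cmodel :: "('f, 'p, 'a) cstruct \<Rightarrow> ('f, 'p) cfm set \<Rightarrow> bool" where
  "is_cmodel M T \<longleftrightarrow> (\<forall>\<phi>\<in>T. \<forall>e. cval M e \<phi> = 0)"

definition cautomorphisms :: "('f, 'p) clang \<Rightarrow> ('f, 'p, 'a) cstruct \<Rightarrow> ('a \<Rightarrow> 'a) set" where
  "cautomorphisms L M = {\<sigma>. bij \<sigma> \<and>
     (\<forall>x y. cdist M (\<sigma> x) (\<sigma> y) = cdist M x y) \<and>
     (\<forall>f\<in>fsyms L. \<forall>xs. length xs = farity L f \<longrightarrow> \<sigma> (cfint M f xs) = cfint M f (map \<sigma> xs)) \<and>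
     (\<forall>p\<in>psyms L. \<forall>xs. length xs = parity L p \<longrightarrow> cpint M p (map \<sigma> xs) = cpint M p xs)}"


section \<open>Notions common to both logics\<close>

text \<open>What the two logics share: the automorphisms of a structure and its conditions, which are
  the formulas in the discrete case and the conditions \<phi> = 0 in the continuous case.\<close>

record ('a, 'c) frame =
  auts :: "('a \<Rightarrow> 'a) set"
  conds :: "'c set"
  cond_fv :: "'c \<Rightarrow> nat set"
  cond_holds :: "(nat \<Rightarrow> 'a) \<Rightarrow> 'c \<Rightarrow> bool"

definition discrete_frame ::
    "('f, 'p) lang \<Rightarrow> ('f, 'p, 'a) struct \<Rightarrow> ('a, ('f, 'p) fm) frame" where
  "discrete_frame L M =
     \<lparr>auts = automorphisms L M, conds = {\<phi>. wf_fm L \<phi>}, cond_fv = fv_fm, cond_holds = sat M\<rparr>"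

definition continuous_frame ::
    "('f, 'p) clang \<Rightarrow> ('f, 'p, 'a) cstruct \<Rightarrow> ('a, ('f, 'p) cfm) frame" where
  "continuous_frame L M =
     \<lparr>auts = cautomorphisms L M, conds = {\<phi>. wf_cfm L \<phi>}, cond_fv = fv_cfm,
      cond_holds = (\<lambda>e \<phi>. cval M e \<phi> = 0)\<rparr>"

text \<open>The cardinal \<kappa> is given as a cardinal order on a type \<open>'i\<close>, which also provides the indices
  of tuples: a tuple is a partial function whose domain is its index set, so an \<open>I\<close>-tuple is
  an \<open>a\<close> with \<open>dom a = I\<close>. Every small index set has a copy inside the field of \<kappa>.\<close>

definition small :: "'i rel \<Rightarrow> 'b set \<Rightarrow> bool" where
  "small \<kappa> X \<longleftrightarrow> |X| <o \<kappa>"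

definition uncountable_strong_limit :: "'i rel \<Rightarrow> bool" where
  "uncountable_strong_limit \<kappa> \<longleftrightarrow>
     Card_order \<kappa> \<and> natLeq <o \<kappa> \<and> (\<forall>X :: 'i set. small \<kappa> X \<longrightarrow> small \<kappa> (Pow X))"

type_synonym ('i, 'a) tuple = "'i \<Rightarrow> 'a option"

definition act :: "('a \<Rightarrow> 'a) \<Rightarrow> ('i, 'a) tuple \<Rightarrow> ('i, 'a) tuple" where
  "act \<sigma> a = map_option \<sigma> \<circ> a"

definition real_tuple :: "'i rel \<Rightarrow> ('i, 'a) tuple \<Rightarrow> bool" where
  "real_tuple \<kappa> a \<longleftrightarrow> small \<kappa> (dom a)"

text \<open>The map \<open>s\<close> says which coordinates are substituted for the free variables of a condition.\<close>

definition same_type :: "('a, 'c) frame \<Rightarrow> ('i, 'a) tuple \<Rightarrow> ('i, 'a) tuple \<Rightarrow> bool" where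
  "same_type S a b \<longleftrightarrow> dom a = dom b \<and>
     (\<forall>\<phi>\<in>conds S. \<forall>s. s ` cond_fv S \<phi> \<subseteq> dom a \<longrightarrow>
        (cond_holds S (the \<circ> a \<circ> s) \<phi> \<longleftrightarrow> cond_holds S (the \<circ> b \<circ> s) \<phi>))"

text \<open>A pair \<open>(\<phi>, e)\<close> is a condition with parameters: the variable 0 is the variable of the type,
  and \<open>e\<close> gives the parameters for the other free variables.\<close>

definition saturated :: "'i rel \<Rightarrow> ('a, 'c) frame \<Rightarrow> bool" where
  "saturated \<kappa> S \<longleftrightarrow>
     (\<forall>B \<pi>. small \<kappa> B \<and> \<pi> \<subseteq> {(\<phi>, e). \<phi> \<in> conds S \<and> e ` (cond_fv S \<phi> - {0}) \<subseteq> B} \<and>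
        (\<forall>\<pi>'\<subseteq>\<pi>. finite \<pi>' \<longrightarrow> (\<exists>x. \<forall>(\<phi>, e)\<in>\<pi>'. cond_holds S (e(0 := x)) \<phi>)) \<longrightarrow>
        (\<exists>x. \<forall>(\<phi>, e)\<in>\<pi>. cond_holds S (e(0 := x)) \<phi>))"

definition strongly_homogeneous :: "'i rel \<Rightarrow> ('a, 'c) frame \<Rightarrow> bool" where
  "strongly_homogeneous \<kappa> S \<longleftrightarrow>
     (\<forall>a b :: ('i, 'a) tuple. real_tuple \<kappa> a \<and> real_tuple \<kappa> b \<and> same_type S a b \<longrightarrow>
        (\<exists>\<sigma>\<in>auts S. act \<sigma> a = b))"

definition monster :: "'i rel \<Rightarrow> ('f, 'p, 'z) lang_scheme \<Rightarrow> ('a, 'c) frame \<Rightarrow> bool" where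
  "monster \<kappa> L S \<longleftrightarrow> uncountable_strong_limit \<kappa> \<and> small \<kappa> (fsyms L) \<and> small \<kappa> (psyms L) \<and>
     saturated \<kappa> S \<and> strongly_homogeneous \<kappa> S"

definition discrete_monster_model ::
    "'i rel \<Rightarrow> ('f, 'p) lang \<Rightarrow> ('f, 'p) fm set \<Rightarrow> ('f, 'p, 'a) struct \<Rightarrow> bool" where
  "discrete_monster_model \<kappa> L T M \<longleftrightarrow> is_model M T \<and> monster \<kappa> L (discrete_frame L M)"

definition continuous_monster_model ::
    "'i rel \<Rightarrow> ('f, 'p) clang \<Rightarrow> ('f, 'p) cfm set \<Rightarrow> ('f, 'p, 'a) cstruct \<Rightarrow> bool" where
  "continuous_monster_model \<kappa> L T M \<longleftrightarrow> wf_clang L \<and> metric_structure L M \<and> is_cmodel M T \<and>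
     monster \<kappa> L (continuous_frame L M)"


section \<open>Ultraimaginaries\<close>

definition invariant_equiv ::
    "('a, 'c) frame \<Rightarrow> 'i set \<Rightarrow> (('i, 'a) tuple \<times> ('i, 'a) tuple) set \<Rightarrow> bool" where
  "invariant_equiv S I E \<longleftrightarrow> equiv {a. dom a = I} E \<and>
     (\<forall>a b c d. dom a = I \<and> dom b = I \<and> (\<exists>\<sigma>\<in>auts S. act \<sigma> a = c \<and> act \<sigma> b = d) \<longrightarrow>
        ((a, b) \<in> E \<longleftrightarrow> (c, d) \<in> E))"

definition type_definable ::
    "('a, 'c) frame \<Rightarrow> 'i set \<Rightarrow> (('i, 'a) tuple \<times> ('i, 'a) tuple) set \<Rightarrow> bool" where
  "type_definable S I E \<longleftrightarrow>
     (\<exists>\<pi> \<subseteq> {(\<phi>, s). \<phi> \<in> conds S \<and> s ` cond_fv S \<phi> \<subseteq> I <+> I}.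
        E = {(a, b). dom a = I \<and> dom b = I \<and>
               (\<forall>(\<phi>, s)\<in>\<pi>. cond_holds S (case_sum (the \<circ> a) (the \<circ> b) \<circ> s) \<phi>)})"

definition ultraimaginary :: "'i rel \<Rightarrow> ('a, 'c) frame \<Rightarrow> ('i, 'a) tuple set \<Rightarrow> bool" where
  "ultraimaginary \<kappa> S X \<longleftrightarrow>
     (\<exists>I E a. small \<kappa> I \<and> invariant_equiv S I E \<and> dom a = I \<and> X = E `` {a})"

definition hyperimaginary :: "'i rel \<Rightarrow> ('a, 'c) frame \<Rightarrow> ('i, 'a) tuple set \<Rightarrow> bool" where
  "hyperimaginary \<kappa> S X \<longleftrightarrow>
     (\<exists>I E a. small \<kappa> I \<and> equiv {a. dom a = I} E \<and> type_definable S I E \<and>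
        dom a = I \<and> X = E `` {a})"

text \<open>A real tuple is identified with its class modulo equality.\<close>

abbreviation as_class :: "('i, 'a) tuple \<Rightarrow> ('i, 'a) tuple set" where
  "as_class a \<equiv> {a}"

text \<open>Smallness of a set \<open>A\<close> of hyperimaginaries includes that of the disjoint union of the index
  sets of its members, so that \<open>A\<close> is a class of a small tuple modulo a product equivalence
  relation. This is automatic when \<kappa> is regular.\<close>

definition hyperimaginary_set ::
    "'i rel \<Rightarrow> ('a, 'c) frame \<Rightarrow> ('i, 'a) tuple set set \<Rightarrow> bool" where
  "hyperimaginary_set \<kappa> S A \<longleftrightarrow> (\<forall>X\<in>A. hyperimaginary \<kappa> S X) \<and>
     small \<kappa> A \<and> small \<kappa> (SIGMA X:A. \<Union>a\<in>X. dom a)"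

text \<open>If \<open>X\<close> is the class of \<open>a\<close> modulo an invariant equivalence relation \<open>E\<close>, then an
  automorphism \<open>\<sigma>\<close> maps \<open>X\<close> to the class of \<open>act \<sigma> a\<close>; it fixes \<open>X\<close> iff \<open>(a, act \<sigma> a) \<in> E\<close>. For a
  collection of ultraimaginaries this amounts to fixing each member.\<close>

definition auts_over :: "('a, 'c) frame \<Rightarrow> ('i, 'a) tuple set set \<Rightarrow> ('a \<Rightarrow> 'a) set" where
  "auts_over S A = {\<sigma> \<in> auts S. \<forall>X\<in>A. act \<sigma> ` X = X}"

definition conjugate_over ::
    "('a, 'c) frame \<Rightarrow> ('i, 'a) tuple set set \<Rightarrow> ('i, 'a) tuple \<Rightarrow> ('i, 'a) tuple \<Rightarrow> bool" where
  "conjugate_over S A b b' \<longleftrightarrow> (\<exists>\<sigma>\<in>auts_over S A. act \<sigma> b = b')"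

definition bddu ::
    "'i rel \<Rightarrow> ('a, 'c) frame \<Rightarrow> ('i, 'a) tuple set set \<Rightarrow> ('i, 'a) tuple set set" where
  "bddu \<kappa> S A = {X. ultraimaginary \<kappa> S X \<and> small \<kappa> ((\<lambda>\<sigma>. act \<sigma> ` X) ` auts_over S A)}"

definition bu_indep ::
    "'i rel \<Rightarrow> ('a, 'c) frame \<Rightarrow> ('i, 'a) tuple set set \<Rightarrow> ('i, 'a) tuple \<Rightarrow> ('i, 'a) tuple \<Rightarrow> bool"
  where
  "bu_indep \<kappa> S A b c \<longleftrightarrow>
     bddu \<kappa> S (insert (as_class b) A) \<inter> bddu \<kappa> S (insert (as_class c) A) = bddu \<kappa> S A"

end

theory Submission
  imports Defs
begin

text \<open>Let \<open>G\<close> be the group of automorphisms over \<open>A\<close> and let \<open>N\<close> be a small elementary set that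
  contains \<open>b\<close> and representatives of \<open>A\<close>. By a coheir argument the pointwise stabiliser of \<open>N\<close>
  fixes every ultraimaginary bounded over \<open>Ab\<close>; likewise for a small elementary set \<open>C\<close> that
  contains \<open>c\<close>. It therefore suffices to find \<open>f\<close> in \<open>G\<close> such that the stabilisers of \<open>f N\<close> and
  of \<open>C\<close> generate a subgroup of small index in \<open>G\<close>; then \<open>b' = f b\<close> works.

  The double cosets of the stabiliser of \<open>N\<close> in \<open>G\<close> are types of pairs of conjugates of \<open>N\<close>.
  Call a set \<open>Q\<close> of them good if for every small \<open>B\<close> some conjugate of the stabiliser of \<open>B\<close>
  meets all members of \<open>Q\<close>. By compactness goodness has finite character, so there is a maximal
  good \<open>Q\<close>, and by a covering argument it generates, together with the stabiliser of \<open>N\<close>, a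
  subgroup of small index. Apply this with \<open>B = C\<close>.\<close>

section \<open>Small sets\<close>

text \<open>Small index cannot be asked for by compactness: it is a statement about all words in the
  generators and about all cosets. Goodness can, since it only says that certain tuples have equal
  types over a small set. It gives what is wanted because, for \<open>f\<close> good over
  \<open>C\<close>, each member of \<open>Q\<close> is a product of two elements of the stabiliser
  of \<open>N\<close> and, between them, some \<open>inv f \<circ> \<beta> \<circ> f\<close> with
  \<open>\<beta>\<close> fixing \<open>C\<close>. So conjugation by \<open>f\<close> carries the
  group generated by \<open>Q\<close> and the stabiliser of \<open>N\<close> into the one generated
  by the stabilisers of \<open>f N\<close> and of \<open>C\<close>. \<open>Q\<close> and the bound
  on the index are fixed before \<open>C\<close> enters. Two obstacles shape the details. The
  cardinal \<open>\<kappa>\<close> may be singular, and then a union of few small sets can be large.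
  Finite character helps: obstructions to goodness are finite sets, and a union of few finite sets
  is small. And conditions of continuous logic are closed under neither negation nor equivalence, so
  both logics are treated through the weaker closure properties that they share.\<close>

primrec stage :: "'o set \<Rightarrow> ('o \<Rightarrow> 'x list \<Rightarrow> 'x) \<Rightarrow> nat \<Rightarrow> 'x set" where
  "stage Ops op 0 = {}"
| "stage Ops op (Suc n) = stage Ops op n \<union> (\<lambda>(k, xs). op k xs) ` (Ops \<times> lists (stage Ops op n))"

text \<open>Arities are not tracked: every operation is applied to all lists, so constants arise
  from the empty list and the closure can start from nothing. It serves both for Skolem hulls and
  for counting terms and formulas.\<close>

definition generated :: "'o set \<Rightarrow> ('o \<Rightarrow> 'x list \<Rightarrow> 'x) \<Rightarrow> 'x set" where
  "generated Ops op = (\<Union>n. stage Ops op n)"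

lemma stage_mono: "m \<le> n \<Longrightarrow> stage Ops op m \<subseteq> stage Ops op n"
  by (rule lift_Suc_mono_le[of "stage Ops op"]) auto

lemma generated_closed:
  assumes "k \<in> Ops" "set xs \<subseteq> generated Ops op"
  shows "op k xs \<in> generated Ops op"
proof -
  have "\<exists>n. set xs \<subseteq> stage Ops op n"
    using assms(2)
  proof (induction xs)
    case (Cons x xs)
    then obtain n m where "x \<in> stage Ops op n" "set xs \<subseteq> stage Ops op m"
      by (auto simp: generated_def)
    then show ?case
      using stage_mono[of n "max n m" Ops op] stage_mono[of m "max n m" Ops op] by auto
  qed simp
  then obtain n where "xs \<in> lists (stage Ops op n)" by auto
  then have "op k xs \<in> stage Ops op (Suc n)"
    using assms(1) by (auto intro!: image_eqI[of _ _ "(k, xs)"])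
  then show ?thesis unfolding generated_def by blast
qed

lemma card_of_lists_le:
  assumes "infinite Z" "|X| \<le>o |Z|"
  shows "|lists X| \<le>o |Z|"
proof -
  have "|{xs \<in> lists X. length xs = n}| \<le>o |Z|" for n
  proof (induction n)
    case 0
    have "{xs \<in> lists X. length xs = 0} = {[]}" by auto
    then show ?case using assms(1) card_of_singl_ordLeq[of Z] by (metis finite.emptyI)
  next
    case (Suc n)
    let ?L = "{xs \<in> lists X. length xs = n}"
    have "{xs \<in> lists X. length xs = Suc n} \<subseteq> (\<lambda>(x, xs). x # xs) ` (X \<times> ?L)"
      by (auto simp: length_Suc_conv image_iff)
    then have "|{xs \<in> lists X. length xs = Suc n}| \<le>o |X \<times> ?L|"
      by (rule surj_imp_ordLeq)
    moreover have "|X \<times> ?L| \<le>o |Z|"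
      using assms Suc by (intro card_of_Sigma_ordLeq_infinite) auto
    ultimately show ?case using ordLeq_transitive by blast
  qed
  moreover have "|UNIV :: nat set| \<le>o |Z|" using assms(1) infinite_iff_card_of_nat[of Z] by simp
  ultimately have "|\<Union>n. {xs \<in> lists X. length xs = n}| \<le>o |Z|"
    by (intro card_of_UNION_ordLeq_infinite[OF assms(1)] ballI)
  moreover have "(\<Union>n. {xs \<in> lists X. length xs = n}) = lists X" by auto
  ultimately show ?thesis by simp
qed

lemma card_of_generated_le:
  assumes "infinite Z" "|Ops| \<le>o |Z|"
  shows "|generated Ops op| \<le>o |Z|"
proof -
  have "|stage Ops op n| \<le>o |Z|" for n
  proof (induction n)
    case (Suc n)
    have "|Ops \<times> lists (stage Ops op n)| \<le>o |Z|"
      using assms card_of_lists_le[OF assms(1) Suc] by (intro card_of_Sigma_ordLeq_infinite) auto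
    then have "|(\<lambda>(k, xs). op k xs) ` (Ops \<times> lists (stage Ops op n))| \<le>o |Z|"
      using card_of_image ordLeq_transitive by blast
    then show ?case
      using Suc assms(1) card_of_Un_ordLeq_infinite_Field[of "|Z|"]
      by (simp add: Field_card_of card_of_card_order_on)
  qed (simp add: card_of_empty)
  moreover have "|UNIV :: nat set| \<le>o |Z|" using assms(1) infinite_iff_card_of_nat[of Z] by simp
  ultimately show ?thesis
    unfolding generated_def by (intro card_of_UNION_ordLeq_infinite[OF assms(1)] ballI)
qed

section \<open>Cardinal arithmetic below a strong limit that may be singular\<close>

locale strong_limit =
  fixes \<kappa> :: "'i rel"
  assumes strong_limit: "uncountable_strong_limit \<kappa>"
begin

lemma Card_order: "Card_order \<kappa>" and uncountable: "natLeq <o \<kappa>"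
  using strong_limit unfolding uncountable_strong_limit_def by auto

lemma infinite_Field: "infinite (Field \<kappa>)"
proof -
  have "natLeq \<le>o |Field \<kappa>|"
    by (rule ordLeq_ordIso_trans[OF ordLess_imp_ordLeq[OF uncountable]
          ordIso_symmetric[OF card_of_Field_ordIso[OF Card_order]]])
  then show ?thesis using infinite_iff_natLeq_ordLeq[of "Field \<kappa>"] by blast
qed

lemma small_le: "|X| \<le>o |Y| \<Longrightarrow> small \<kappa> Y \<Longrightarrow> small \<kappa> X"
  unfolding small_def by (rule ordLeq_ordLess_trans)

lemma small_subset: "X \<subseteq> Y \<Longrightarrow> small \<kappa> Y \<Longrightarrow> small \<kappa> X"
  by (rule small_le[OF card_of_mono1])

lemma small_image: "small \<kappa> X \<Longrightarrow> small \<kappa> (f ` X)"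
  by (rule small_le[OF card_of_image])

lemma small_nat: "small \<kappa> (UNIV :: nat set)"
  unfolding small_def by (rule ordIso_ordLess_trans[OF card_of_nat uncountable])

lemma small_finite: "finite X \<Longrightarrow> small \<kappa> X"
  unfolding small_def by (simp add: finite_iff_ordLess_natLeq ordLess_transitive[OF _ uncountable])

lemma small_Plus: "small \<kappa> X \<Longrightarrow> small \<kappa> Y \<Longrightarrow> small \<kappa> (X <+> Y)"
  unfolding small_def by (rule card_of_Plus_ordLess_infinite_Field[OF infinite_Field Card_order])

lemma small_Un: "small \<kappa> X \<Longrightarrow> small \<kappa> Y \<Longrightarrow> small \<kappa> (X \<union> Y)"
  unfolding small_def by (rule card_of_Un_ordLess_infinite_Field[OF infinite_Field Card_order])

lemma small_insert: "small \<kappa> X \<Longrightarrow> small \<kappa> (insert x X)"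
  using small_Un[OF small_finite[of "{x}"]] by simp

text \<open>A common bound \<open>Y\<close> is demanded because \<open>\<kappa>\<close> may be
  singular; smallness of each single \<open>A i\<close> would not do.\<close>

lemma small_UN:
  assumes "small \<kappa> I" "small \<kappa> Y" "\<And>i. i \<in> I \<Longrightarrow> |A i| \<le>o |Y|"
  shows "small \<kappa> (\<Union>i\<in>I. A i)"
proof -
  let ?Z = "(UNIV :: nat set) <+> (I <+> Y)"
  have "infinite ?Z" by simp
  moreover have "|I| \<le>o |?Z|" "|Y| \<le>o |?Z|"
    by (rule ordLeq_transitive[OF card_of_Plus1 card_of_Plus2])
      (rule ordLeq_transitive[OF card_of_Plus2 card_of_Plus2])
  ultimately have "|\<Union>i\<in>I. A i| \<le>o |?Z|"
    using ordLeq_transitive[OF assms(3)] by (intro card_of_UNION_ordLeq_infinite) auto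
  then show ?thesis
    by (rule small_le) (intro small_Plus small_nat assms(1,2))
qed

lemma small_Times:
  assumes "small \<kappa> X" "small \<kappa> Y"
  shows "small \<kappa> (X \<times> Y)"
proof -
  have "small \<kappa> (\<Union>x\<in>X. Pair x ` Y)" by (rule small_UN[OF assms card_of_image])
  moreover have "(\<Union>x\<in>X. Pair x ` Y) = X \<times> Y" by auto
  ultimately show ?thesis by simp
qed

text \<open>Finite sets share the bound \<aleph>0, so here no bound has to be supplied.\<close>

lemma small_UN_finite:
  assumes "small \<kappa> I" "\<And>i. i \<in> I \<Longrightarrow> finite (A i)"
  shows "small \<kappa> (\<Union>i\<in>I. A i)"
proof (rule small_UN[OF assms(1) small_nat])
  fix i assume "i \<in> I"
  then obtain f :: "_ \<Rightarrow> nat" where "inj_on f (A i)"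
    using finite_imp_inj_to_nat_seg[OF assms(2)] by metis
  then show "|A i| \<le>o |UNIV :: nat set|" using card_of_ordLeqI[of f "A i" UNIV] by simp
qed

text \<open>Copies any small set into \<open>'i\<close>, the only index type of tuples for which
  strong homogeneity and the strong limit property are stated.\<close>

lemma small_inj:
  assumes "small \<kappa> X"
  obtains g :: "_ \<Rightarrow> 'i" where "inj_on g X"
proof -
  have "|X| \<le>o |Field \<kappa>|"
    using assms ordLeq_ordIso_trans[OF ordLess_imp_ordLeq
        ordIso_symmetric[OF card_of_Field_ordIso[OF Card_order]]]
    unfolding small_def by blast
  then show thesis using that card_of_ordLeq[of X "Field \<kappa>"] by blast
qed

lemma small_Pow:
  assumes "small \<kappa> X"
  shows "small \<kappa> (Pow X)"
proof -
  obtain g :: "_ \<Rightarrow> 'i" where g: "inj_on g X" using small_inj[OF assms] .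
  have "small \<kappa> (Pow (g ` X))"
    using strong_limit small_image[OF assms] unfolding uncountable_strong_limit_def by blast
  moreover have "Pow X \<subseteq> (\<lambda>Y. X \<inter> g -` Y) ` Pow (g ` X)"
  proof
    fix Y assume "Y \<in> Pow X"
    then have "Y = X \<inter> g -` (g ` Y)" "g ` Y \<in> Pow (g ` X)"
      using g by (auto simp: inj_on_def)
    then show "Y \<in> (\<lambda>Y. X \<inter> g -` Y) ` Pow (g ` X)" by blast
  qed
  ultimately show ?thesis by (rule small_subset[OF _ small_image, rotated])
qed

text \<open>A sequence can be recovered from its graph, a subset of a small product. This bounds the
  number of ways to assign unknowns to the variables of a condition.\<close>

lemma small_seqs:
  assumes "small \<kappa> J"
  shows "small \<kappa> {s :: nat \<Rightarrow> _. range s \<subseteq> J}"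
proof -
  have "{s :: nat \<Rightarrow> _. range s \<subseteq> J} \<subseteq> (\<lambda>R n. SOME x. (n, x) \<in> R) ` Pow (UNIV \<times> J)"
  proof
    fix s :: "nat \<Rightarrow> _" assume s: "s \<in> {s. range s \<subseteq> J}"
    have "s = (\<lambda>n. SOME x. (n, x) \<in> range (\<lambda>n. (n, s n)))"
      by (simp add: fun_eq_iff image_iff)
    then show "s \<in> (\<lambda>R n. SOME x. (n, x) \<in> R) ` Pow (UNIV \<times> J)"
      using s by (auto intro!: image_eqI[of _ _ "range (\<lambda>n. (n, s n))"])
  qed
  then show ?thesis
    by (rule small_subset) (intro small_image small_Pow small_Times small_nat assms)
qed

lemma small_generated:
  assumes "small \<kappa> Ops"
  shows "small \<kappa> (generated Ops op)"
proof -
  have "|generated Ops op| \<le>o |(UNIV :: nat set) <+> Ops|"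
    by (rule card_of_generated_le) (simp_all add: card_of_Plus2)
  then show ?thesis by (rule small_le) (intro small_Plus small_nat assms)
qed

lemma small_lists:
  assumes "small \<kappa> X"
  shows "small \<kappa> (lists X)"
proof -
  have "|lists X| \<le>o |(UNIV :: nat set) <+> X|"
    by (rule card_of_lists_le) (simp_all add: card_of_Plus2)
  then show ?thesis by (rule small_le) (intro small_Plus small_nat assms)
qed

text \<open>Continuous logic has a constant for every real in the unit interval, so counting its
  formulas requires the continuum to be small. A real is determined by the rationals below
  it.\<close>

lemma small_real: "small \<kappa> (UNIV :: real set)"
proof -
  have "small \<kappa> (UNIV :: rat set)"
    using small_image[OF small_nat, of "from_nat_into (UNIV :: rat set)"]
    by (simp add: range_from_nat_into uncountable_def)
  then have "small \<kappa> (Pow (UNIV :: rat set))" by (rule small_Pow)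
  moreover have "inj (\<lambda>x :: real. {q. of_rat q < x})"
  proof (rule injI)
    fix x y :: real assume eq: "{q. of_rat q < x} = {q. of_rat q < y}"
    show "x = y"
    proof (rule ccontr)
      assume "x \<noteq> y"
      then have "x < y \<or> y < x" by linarith
      then show False using eq of_rat_dense[of x y] of_rat_dense[of y x] by force
    qed
  qed
  then have "|UNIV :: real set| \<le>o |Pow (UNIV :: rat set)|"
    by (intro card_of_ordLeqI[of "\<lambda>x :: real. {q. of_rat q < x}"]) auto
  ultimately show ?thesis by (rule small_le[rotated])
qed

end

section \<open>Frames with quantifiers\<close>

text \<open>The closure properties of conditions that both logics share. Negation is replaced by
  \<open>refuting_cond\<close>, which yields a condition that holds at the given point and excludes
  \<open>\<phi>\<close>; the biconditional is replaced by \<open>iff_cond\<close>. In continuous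
  logic \<open>ex_cond\<close> is itself a consequence of saturation, which makes infima
  attained.\<close>

locale monster_frame = strong_limit \<kappa> for \<kappa> :: "'i rel" +
  fixes S :: "('a, 'c) frame"
  assumes conds_small: "small \<kappa> (conds S)"
    and finite_fv: "\<phi> \<in> conds S \<Longrightarrow> finite (cond_fv S \<phi>)"
    and holds_cong: "\<phi> \<in> conds S \<Longrightarrow> (\<And>n. n \<in> cond_fv S \<phi> \<Longrightarrow> e n = e' n) \<Longrightarrow>
      cond_holds S e \<phi> \<longleftrightarrow> cond_holds S e' \<phi>"
    and true_cond: "\<exists>\<xi>\<in>conds S. cond_fv S \<xi> = {} \<and> (\<forall>e. cond_holds S e \<xi>)"
    and conj_cond: "\<phi> \<in> conds S \<Longrightarrow> \<psi> \<in> conds S \<Longrightarrow>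
      \<exists>\<xi>\<in>conds S. cond_fv S \<xi> \<subseteq> cond_fv S \<phi> \<union> cond_fv S \<psi> \<and>
        (\<forall>e. cond_holds S e \<xi> \<longleftrightarrow> cond_holds S e \<phi> \<and> cond_holds S e \<psi>)"
    and ex_cond: "\<phi> \<in> conds S \<Longrightarrow>
      \<exists>\<xi>\<in>conds S. cond_fv S \<xi> \<subseteq> cond_fv S \<phi> - {n} \<and>
        (\<forall>e. cond_holds S e \<xi> \<longleftrightarrow> (\<exists>x. cond_holds S (e(n := x)) \<phi>))"
    and rename_cond: "\<phi> \<in> conds S \<Longrightarrow>
      \<exists>\<xi>\<in>conds S. cond_fv S \<xi> \<subseteq> s ` cond_fv S \<phi> \<and>
        (\<forall>e. cond_holds S e \<xi> \<longleftrightarrow> cond_holds S (e \<circ> s) \<phi>)"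
    and refuting_cond: "\<phi> \<in> conds S \<Longrightarrow> \<not> cond_holds S e \<phi> \<Longrightarrow>
      \<exists>\<xi>\<in>conds S. cond_fv S \<xi> \<subseteq> cond_fv S \<phi> \<and> cond_holds S e \<xi> \<and>
        (\<forall>e'. cond_holds S e' \<xi> \<longrightarrow> \<not> cond_holds S e' \<phi>)"
    and iff_cond: "\<phi> \<in> conds S \<Longrightarrow>
      \<exists>\<xi>\<in>conds S. cond_fv S \<xi> \<subseteq> s ` cond_fv S \<phi> \<union> t ` cond_fv S \<phi> \<and>
        (\<forall>e. cond_holds S e \<xi> \<longrightarrow> (cond_holds S (e \<circ> s) \<phi> \<longleftrightarrow> cond_holds S (e \<circ> t) \<phi>)) \<and>
        (\<forall>e. \<forall>\<sigma>\<in>auts S. (\<forall>n\<in>cond_fv S \<phi>. e (t n) = \<sigma> (e (s n))) \<longrightarrow> cond_holds S e \<xi>)"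
    and id_aut: "id \<in> auts S"
    and comp_aut: "\<sigma> \<in> auts S \<Longrightarrow> \<tau> \<in> auts S \<Longrightarrow> \<sigma> \<circ> \<tau> \<in> auts S"
    and inv_aut: "\<sigma> \<in> auts S \<Longrightarrow> inv \<sigma> \<in> auts S"
    and bij_aut: "\<sigma> \<in> auts S \<Longrightarrow> bij \<sigma>"
    and holds_aut: "\<sigma> \<in> auts S \<Longrightarrow> \<phi> \<in> conds S \<Longrightarrow>
      cond_holds S (\<sigma> \<circ> e) \<phi> \<longleftrightarrow> cond_holds S e \<phi>"
    and saturated: "saturated \<kappa> S"
    and homogeneous: "strongly_homogeneous \<kappa> S"
begin

lemma inv_aut_apply [simp]:
  assumes "\<sigma> \<in> auts S"
  shows "inv \<sigma> (\<sigma> x) = x" "\<sigma> (inv \<sigma> x) = x" "inv \<sigma> \<circ> \<sigma> = id" "\<sigma> \<circ> inv \<sigma> = id"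
  using bij_aut[OF assms] by (auto simp: bij_def surj_f_inv_f fun_eq_iff)

lemma ex_finite_cond:
  assumes "finite F" "\<phi> \<in> conds S"
  shows "\<exists>\<xi>\<in>conds S. cond_fv S \<xi> \<subseteq> cond_fv S \<phi> - F \<and>
    (\<forall>e. cond_holds S e \<xi> \<longleftrightarrow> (\<exists>e'. (\<forall>n. n \<notin> F \<longrightarrow> e' n = e n) \<and> cond_holds S e' \<phi>))"
  using assms
proof (induction F rule: finite_induct)
  case empty
  have "(\<forall>n. n \<notin> {} \<longrightarrow> e' n = e n) \<longleftrightarrow> e' = e" for e e' :: "nat \<Rightarrow> 'a"
    by (auto simp: fun_eq_iff)
  then show ?case using empty by (intro bexI[of _ \<phi>]) auto
next
  case (insert m F)
  then obtain \<xi> where \<xi>: "\<xi> \<in> conds S" "cond_fv S \<xi> \<subseteq> cond_fv S \<phi> - F"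
    "\<And>e. cond_holds S e \<xi> \<longleftrightarrow> (\<exists>e'. (\<forall>n. n \<notin> F \<longrightarrow> e' n = e n) \<and> cond_holds S e' \<phi>)"
    by blast
  obtain \<theta> where \<theta>: "\<theta> \<in> conds S" "cond_fv S \<theta> \<subseteq> cond_fv S \<xi> - {m}"
    "\<And>e. cond_holds S e \<theta> \<longleftrightarrow> (\<exists>x. cond_holds S (e(m := x)) \<xi>)"
    using ex_cond[OF \<xi>(1)] by blast
  have "cond_holds S e \<theta> \<longleftrightarrow>
      (\<exists>e'. (\<forall>n. n \<notin> insert m F \<longrightarrow> e' n = e n) \<and> cond_holds S e' \<phi>)" (is "_ \<longleftrightarrow> ?R") for e
  proof
    assume "cond_holds S e \<theta>"
    then show ?R using \<theta>(3) \<xi>(3) by (metis fun_upd_apply insert_iff)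
  next
    assume ?R
    then obtain e' where e': "\<And>n. n \<notin> insert m F \<Longrightarrow> e' n = e n" "cond_holds S e' \<phi>" by blast
    then have "\<forall>n. n \<notin> F \<longrightarrow> e' n = (e(m := e' m)) n" by auto
    then show "cond_holds S e \<theta>" using \<theta>(3) \<xi>(3) e'(2) by blast
  qed
  then show ?case using \<theta> \<xi>(2) by (intro bexI[of _ \<theta>]) auto
qed

lemma conj_finite_cond:
  assumes "finite \<Sigma>" "\<And>\<phi> s. (\<phi>, s) \<in> \<Sigma> \<Longrightarrow> \<phi> \<in> conds S"
  shows "\<exists>\<xi>\<in>conds S. cond_fv S \<xi> \<subseteq> (\<Union>(\<phi>, s)\<in>\<Sigma>. s ` cond_fv S \<phi>) \<and>
    (\<forall>e. cond_holds S e \<xi> \<longleftrightarrow> (\<forall>(\<phi>, s)\<in>\<Sigma>. cond_holds S (e \<circ> s) \<phi>))"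
  using assms
proof (induction \<Sigma> rule: finite_induct)
  case empty
  then show ?case using true_cond by auto
next
  case (insert p \<Sigma>)
  obtain \<phi> s where p: "p = (\<phi>, s)" by (cases p)
  obtain \<xi> where \<xi>: "\<xi> \<in> conds S" "cond_fv S \<xi> \<subseteq> (\<Union>(\<phi>, s)\<in>\<Sigma>. s ` cond_fv S \<phi>)"
    "\<And>e. cond_holds S e \<xi> \<longleftrightarrow> (\<forall>(\<phi>, s)\<in>\<Sigma>. cond_holds S (e \<circ> s) \<phi>)"
    using insert by (metis insertI2)
  obtain \<psi> where \<psi>: "\<psi> \<in> conds S" "cond_fv S \<psi> \<subseteq> s ` cond_fv S \<phi>"
    "\<And>e. cond_holds S e \<psi> \<longleftrightarrow> cond_holds S (e \<circ> s) \<phi>"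
    using rename_cond[of \<phi> s] insert.prems[of \<phi> s] p by auto
  obtain \<theta> where \<theta>: "\<theta> \<in> conds S" "cond_fv S \<theta> \<subseteq> cond_fv S \<psi> \<union> cond_fv S \<xi>"
    "\<And>e. cond_holds S e \<theta> \<longleftrightarrow> cond_holds S e \<psi> \<and> cond_holds S e \<xi>"
    using conj_cond[OF \<psi>(1) \<xi>(1)] by blast
  have "cond_holds S e \<theta> \<longleftrightarrow> (\<forall>(\<phi>, s)\<in>insert p \<Sigma>. cond_holds S (e \<circ> s) \<phi>)" for e
    unfolding \<theta>(3) \<psi>(3) \<xi>(3) p by blast
  moreover have "cond_fv S \<theta> \<subseteq> (\<Union>(\<phi>, s)\<in>insert p \<Sigma>. s ` cond_fv S \<phi>)"
    using \<theta>(2) \<psi>(2) \<xi>(2) unfolding p by auto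
  ultimately show ?case using \<theta>(1) by blast
qed

section \<open>Systems of conditions in unknowns of any index type\<close>

definition vars :: "('c \<times> (nat \<Rightarrow> 'j)) set \<Rightarrow> 'j set" where
  "vars \<Sigma> = (\<Union>(\<phi>, s)\<in>\<Sigma>. s ` cond_fv S \<phi>)"

text \<open>The map \<open>s\<close> in a pair \<open>(\<phi>, s)\<close> sends the numbered
  variables of \<open>\<phi>\<close> to unknowns, so that a system can have infinitely many unknowns
  of any type. Where elements of the model are needed as parameters, they are unknowns of the form
  \<open>Inl x\<close> whose value is prescribed.\<close>

definition satisfies :: "('j \<Rightarrow> 'a) \<Rightarrow> ('c \<times> (nat \<Rightarrow> 'j)) set \<Rightarrow> bool" where
  "satisfies h \<Sigma> \<longleftrightarrow> (\<forall>(\<phi>, s)\<in>\<Sigma>. cond_holds S (h \<circ> s) \<phi>)"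

lemma satisfies_cong:
  assumes "fst ` \<Sigma> \<subseteq> conds S" "\<And>j. j \<in> vars \<Sigma> \<Longrightarrow> h j = h' j"
  shows "satisfies h \<Sigma> \<longleftrightarrow> satisfies h' \<Sigma>"
proof -
  have "cond_holds S (h \<circ> s) \<phi> \<longleftrightarrow> cond_holds S (h' \<circ> s) \<phi>" if "(\<phi>, s) \<in> \<Sigma>" for \<phi> s
    using that assms by (intro holds_cong) (force simp: vars_def)+
  then show ?thesis unfolding satisfies_def by blast
qed

lemma satisfies_mono: "satisfies h \<Sigma> \<Longrightarrow> \<Sigma>' \<subseteq> \<Sigma> \<Longrightarrow> satisfies h \<Sigma>'"
  unfolding satisfies_def by blast

lemma finite_vars: "finite \<Sigma> \<Longrightarrow> fst ` \<Sigma> \<subseteq> conds S \<Longrightarrow> finite (vars \<Sigma>)"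
  using finite_fv by (force simp: vars_def)

subsection \<open>Compactness\<close>

lemma saturated_at:
  assumes "small \<kappa> B" "\<And>\<phi> e. (\<phi>, e) \<in> \<pi> \<Longrightarrow> \<phi> \<in> conds S \<and> e ` (cond_fv S \<phi> - {0}) \<subseteq> B"
    and "\<And>\<pi>'. \<pi>' \<subseteq> \<pi> \<Longrightarrow> finite \<pi>' \<Longrightarrow> \<exists>x. \<forall>(\<phi>, e)\<in>\<pi>'. cond_holds S (e(0 := x)) \<phi>"
  shows "\<exists>x. \<forall>(\<phi>, e)\<in>\<pi>. cond_holds S (e(0 := x)) \<phi>"
proof -
  have "\<pi> \<subseteq> {(\<phi>, e). \<phi> \<in> conds S \<and> e ` (cond_fv S \<phi> - {0}) \<subseteq> B}" using assms(2) by blast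
  then show ?thesis using saturated assms(1,3) unfolding saturated_def by blast
qed

text \<open>\<open>R\<close> is a partial assignment, kept as a relation so that a union of a chain
  is again a candidate. Each solution of a finite part has to extend the whole of
  \<open>R\<close>.\<close>

definition fin_sat :: "('c \<times> (nat \<Rightarrow> 'j)) set \<Rightarrow> ('j \<times> 'a) set \<Rightarrow> bool" where
  "fin_sat \<Sigma> R \<longleftrightarrow> (\<forall>\<Sigma>'\<subseteq>\<Sigma>. finite \<Sigma>' \<longrightarrow> (\<exists>h. (\<forall>(j, x)\<in>R. h j = x) \<and> satisfies h \<Sigma>'))"

lemma fin_satD:
  assumes "fin_sat \<Sigma> R" "\<Sigma>' \<subseteq> \<Sigma>" "finite \<Sigma>'"
  obtains h where "\<forall>(j, x)\<in>R. h j = x" "satisfies h \<Sigma>'"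
  using assms unfolding fin_sat_def by blast

lemma fin_sat_fun:
  assumes "fin_sat \<Sigma> R"
  obtains r where "\<forall>(j, x)\<in>R. r j = x"
  using assms unfolding fin_sat_def by blast

text \<open>Quantifying out all unassigned unknowns except \<open>i\<close> turns a finite system
  into one condition on the value of \<open>i\<close> with parameters from \<open>R\<close>. Thus
  saturation for a single variable is enough to extend \<open>R\<close> by one value.\<close>

lemma fin_sat_cond:
  assumes r: "\<forall>(j, x)\<in>R. r j = x"
    and i: "i \<notin> Domain R" and \<Sigma>: "finite \<Sigma>" "fst ` \<Sigma> \<subseteq> conds S"
  shows "\<exists>\<psi> e. \<psi> \<in> conds S \<and> e ` (cond_fv S \<psi> - {0}) \<subseteq> R `` vars \<Sigma> \<and>
    (\<forall>x. cond_holds S (e(0 := x)) \<psi> \<longleftrightarrow>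
      (\<exists>h. (\<forall>(j, y)\<in>insert (i, x) R. h j = y) \<and> satisfies h \<Sigma>))"
proof -
  have R: "r j = x" if "(j, x) \<in> R" for j x using r that by auto
  have finV: "finite (vars \<Sigma>)" using finite_vars \<Sigma> by blast
  obtain num0 :: "_ \<Rightarrow> nat" where num0: "inj_on num0 (vars \<Sigma>)"
    using finV finite_imp_inj_to_nat_seg by blast
  \<comment> \<open>Saturation solves for the variable 0, which is therefore reserved for
    \<open>i\<close>.\<close>
  define num where "num j = (if j = i then 0 else Suc (num0 j))" for j
  have num: "inj_on num (insert i (vars \<Sigma>))" using num0 by (auto simp: inj_on_def num_def)
  have num_i: "num i = 0" and num_pos: "\<And>j. j \<noteq> i \<Longrightarrow> num j \<noteq> 0" by (auto simp: num_def)
  obtain \<xi> where \<xi>: "\<xi> \<in> conds S"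
      "cond_fv S \<xi> \<subseteq> (\<Union>(\<phi>, s)\<in>(\<lambda>(\<phi>, s). (\<phi>, num \<circ> s)) ` \<Sigma>. s ` cond_fv S \<phi>)"
      "\<And>e. cond_holds S e \<xi> \<longleftrightarrow>
        (\<forall>(\<phi>, s)\<in>(\<lambda>(\<phi>, s). (\<phi>, num \<circ> s)) ` \<Sigma>. cond_holds S (e \<circ> s) \<phi>)"
    using conj_finite_cond[of "(\<lambda>(\<phi>, s). (\<phi>, num \<circ> s)) ` \<Sigma>"] \<Sigma> by force
  have \<xi>_fv: "cond_fv S \<xi> \<subseteq> num ` vars \<Sigma>" using \<xi>(2) by (force simp: vars_def)
  have \<xi>_holds: "cond_holds S e \<xi> \<longleftrightarrow> satisfies (e \<circ> num) \<Sigma>" for e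
    unfolding \<xi>(3) satisfies_def by (auto simp: comp_assoc split: prod.splits)
  \<comment> \<open>The numbers of the unknowns to be quantified out.\<close>
  define F where "F = num ` (vars \<Sigma> - Domain R - {i})"
  have "finite F" using finV by (simp add: F_def)
  then obtain \<psi> where \<psi>: "\<psi> \<in> conds S" "cond_fv S \<psi> \<subseteq> cond_fv S \<xi> - F"
      "\<And>e. cond_holds S e \<psi> \<longleftrightarrow> (\<exists>e'. (\<forall>n. n \<notin> F \<longrightarrow> e' n = e n) \<and> cond_holds S e' \<xi>)"
    using ex_finite_cond[OF _ \<xi>(1)] by blast
  define e where "e n = r (inv_into (insert i (vars \<Sigma>)) num n)" for n
  have e_num: "e (num j) = r j" if "j \<in> vars \<Sigma>" for j
    using that num by (simp add: e_def)
  have fv_e: "e n \<in> R `` vars \<Sigma>" if "n \<in> cond_fv S \<psi> - {0}" for n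
  proof -
    have "n \<in> num ` vars \<Sigma>" using that \<psi>(2) \<xi>_fv by blast
    then obtain j where j: "j \<in> vars \<Sigma>" "n = num j" by blast
    have "num j \<notin> F" "j \<noteq> i" using that j \<psi>(2) num_i by auto
    then obtain x where x: "(j, x) \<in> R" using j unfolding F_def by blast
    have "e n = x" using j(2) e_num[OF j(1)] R[OF x] by simp
    then show ?thesis using x j(1) by blast
  qed
  have holds_e: "cond_holds S (e(0 := x)) \<psi> \<longleftrightarrow>
      (\<exists>h. (\<forall>(j, y)\<in>insert (i, x) R. h j = y) \<and> satisfies h \<Sigma>)" (is "_ \<longleftrightarrow> ?R") for x
  proof
    assume "cond_holds S (e(0 := x)) \<psi>"
    then obtain e' where e': "\<And>n. n \<notin> F \<Longrightarrow> e' n = (e(0 := x)) n" "cond_holds S e' \<xi>"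
      using \<psi>(3) by blast
    define h where "h j = (if j = i then x else if j \<in> Domain R then r j else e' (num j))" for j
    have "h j = y" if "(j, y) \<in> R" for j y
    proof -
      have "j \<noteq> i" "j \<in> Domain R" using that i by blast+
      then show ?thesis using R[OF that] by (simp add: h_def)
    qed
    then have "\<forall>(j, y)\<in>insert (i, x) R. h j = y" by (auto simp: h_def)
    moreover have "satisfies h \<Sigma>"
    proof -
      have "(e' \<circ> num) j = h j" if j: "j \<in> vars \<Sigma>" for j
      proof (cases "num j \<in> F")
        case True
        then have "j \<notin> Domain R" "j \<noteq> i" using j num by (auto simp: F_def inj_on_def)
        then show ?thesis by (simp add: h_def)
      next
        case False
        then have "j \<in> Domain R \<or> j = i" using j by (auto simp: F_def)
        then show ?thesis
        proof
          assume jR: "j \<in> Domain R"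
          then have "j \<noteq> i" using i by blast
          then have "e' (num j) = e (num j)" using e'(1)[OF False] num_pos by simp
          then show ?thesis using jR \<open>j \<noteq> i\<close> e_num[OF j] by (simp add: h_def)
        next
          assume "j = i"
          then show ?thesis using e'(1)[OF False] num_i by (simp add: h_def)
        qed
      qed
      then show ?thesis using e'(2) \<xi>_holds satisfies_cong[OF \<Sigma>(2)] by blast
    qed
    ultimately show ?R by blast
  next
    assume ?R
    then obtain h where h0: "\<forall>(j, y)\<in>insert (i, x) R. h j = y" "satisfies h \<Sigma>" by blast
    then have h: "\<And>j y. (j, y) \<in> R \<Longrightarrow> h j = y" "h i = x" "satisfies h \<Sigma>" by auto
    define e' where "e' n = (if n \<in> F then h (inv_into (insert i (vars \<Sigma>)) num n)
      else (e(0 := x)) n)" for n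
    have "(e' \<circ> num) j = h j" if j: "j \<in> vars \<Sigma>" for j
    proof (cases "num j \<in> F")
      case True
      then show ?thesis using j num by (simp add: e'_def)
    next
      case False
      then have "j \<in> Domain R \<or> j = i" using j by (auto simp: F_def)
      then show ?thesis
      proof
        assume jR: "j \<in> Domain R"
        then obtain y where "(j, y) \<in> R" by blast
        moreover have "j \<noteq> i" using i jR by blast
        ultimately show ?thesis
          using False h(1) R num_pos[of j] e_num[OF j] by (simp add: e'_def)
      next
        assume "j = i"
        then show ?thesis using False h(2) num_i by (simp add: e'_def)
      qed
    qed
    then have "cond_holds S e' \<xi>" using h(3) \<xi>_holds satisfies_cong[OF \<Sigma>(2)] by blast
    moreover have "\<forall>n. n \<notin> F \<longrightarrow> e' n = (e(0 := x)) n" by (simp add: e'_def)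
    ultimately show "cond_holds S (e(0 := x)) \<psi>" using \<psi>(3) by blast
  qed
  show ?thesis
    by (intro exI[of _ \<psi>] exI[of _ e] conjI allI \<psi>(1) holds_e) (use fv_e in blast)
qed

text \<open>Each finite part of \<open>\<Sigma>\<close> yields one condition on the value at
  \<open>i\<close>. Finitely many of these conditions are solved together by \<open>h i\<close>,
  where \<open>h\<close> satisfies the union of the parts, so saturation provides a value that
  serves all parts.\<close>

lemma fin_sat_extend:
  assumes J: "small \<kappa> J" and \<Sigma>: "fst ` \<Sigma> \<subseteq> conds S" "vars \<Sigma> \<subseteq> J"
    and R: "fin_sat \<Sigma> R" "i \<notin> Domain R"
  shows "\<exists>x. fin_sat \<Sigma> (insert (i, x) R)"
proof -
  obtain r where r: "\<forall>(j, x)\<in>R. r j = x" using fin_sat_fun[OF R(1)] .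
  define Q where "Q x \<Sigma>' \<longleftrightarrow> (\<exists>h. (\<forall>(j, y)\<in>insert (i, x) R. h j = y) \<and> satisfies h \<Sigma>')"
    for x \<Sigma>'
  let ?fin = "{\<Sigma>'. \<Sigma>' \<subseteq> \<Sigma> \<and> finite \<Sigma>'}"
  have ex: "\<forall>\<Sigma>'\<in>?fin. \<exists>p. fst p \<in> conds S \<and> snd p ` (cond_fv S (fst p) - {0}) \<subseteq> R `` vars \<Sigma>' \<and>
      (\<forall>x. cond_holds S ((snd p)(0 := x)) (fst p) \<longleftrightarrow> Q x \<Sigma>')"
  proof
    fix \<Sigma>' assume "\<Sigma>' \<in> ?fin"
    then have \<Sigma>': "finite \<Sigma>'" "fst ` \<Sigma>' \<subseteq> conds S" using \<Sigma>(1) by blast+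
    obtain \<psi> e where "\<psi> \<in> conds S" "e ` (cond_fv S \<psi> - {0}) \<subseteq> R `` vars \<Sigma>'"
        "\<forall>x. cond_holds S (e(0 := x)) \<psi> \<longleftrightarrow> Q x \<Sigma>'"
      using fin_sat_cond[OF r R(2) \<Sigma>'] unfolding Q_def by (elim exE conjE)
    then show "\<exists>p. fst p \<in> conds S \<and> snd p ` (cond_fv S (fst p) - {0}) \<subseteq> R `` vars \<Sigma>' \<and>
      (\<forall>x. cond_holds S ((snd p)(0 := x)) (fst p) \<longleftrightarrow> Q x \<Sigma>')"
      by (intro exI[of _ "(\<psi>, e)"]) simp
  qed
  from bchoice[OF ex] obtain p where p0: "\<forall>\<Sigma>'\<in>?fin. fst (p \<Sigma>') \<in> conds S \<and>
      snd (p \<Sigma>') ` (cond_fv S (fst (p \<Sigma>')) - {0}) \<subseteq> R `` vars \<Sigma>' \<and>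
      (\<forall>x. cond_holds S ((snd (p \<Sigma>'))(0 := x)) (fst (p \<Sigma>')) \<longleftrightarrow> Q x \<Sigma>')" ..
  note p = p0[THEN bspec]
  have vars_mono: "vars \<Sigma>' \<subseteq> J" if "\<Sigma>' \<subseteq> \<Sigma>" for \<Sigma>' using that \<Sigma>(2) unfolding vars_def by blast
  \<comment> \<open>\<open>R\<close> itself may be large, but only its values at unknowns in
    \<open>J\<close> occur as parameters.\<close>
  have "R `` J \<subseteq> r ` J" using r by auto
  then have smallB: "small \<kappa> (R `` J)" by (rule small_subset[OF _ small_image[OF J]])
  have "\<exists>x. \<forall>(\<phi>, e)\<in>p ` ?fin. cond_holds S (e(0 := x)) \<phi>"
  proof (rule saturated_at[OF smallB])
    fix \<phi> e assume "(\<phi>, e) \<in> p ` ?fin"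
    then obtain \<Sigma>' where "\<Sigma>' \<in> ?fin" "p \<Sigma>' = (\<phi>, e)" by force
    then have "\<phi> \<in> conds S" "e ` (cond_fv S \<phi> - {0}) \<subseteq> R `` vars \<Sigma>'" "vars \<Sigma>' \<subseteq> J"
      using p[of \<Sigma>'] vars_mono[of \<Sigma>'] by auto
    then show "\<phi> \<in> conds S \<and> e ` (cond_fv S \<phi> - {0}) \<subseteq> R `` J"
      using Image_mono[OF subset_refl, of "vars \<Sigma>'" J R] by (intro conjI) (blast intro: subset_trans)+
  next
    fix \<pi>' assume "\<pi>' \<subseteq> p ` ?fin" "finite \<pi>'"
    then obtain \<F> where \<F>: "\<F> \<subseteq> ?fin" "finite \<F>" "\<pi>' = p ` \<F>"
      by (meson finite_subset_image)
    then have "\<Union>\<F> \<in> ?fin" by auto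
    then obtain h where h: "\<forall>(j, x)\<in>R. h j = x" "satisfies h (\<Union>\<F>)"
      using fin_satD[OF R(1)] by auto
    have "cond_holds S (e(0 := h i)) \<phi>" if mem: "(\<phi>, e) \<in> \<pi>'" for \<phi> e
    proof -
      obtain \<Sigma>' where \<Sigma>': "\<Sigma>' \<in> \<F>" "p \<Sigma>' = (\<phi>, e)" using mem \<F>(3) by auto
      then have "Q (h i) \<Sigma>'"
        using h(1) satisfies_mono[OF h(2), of \<Sigma>'] unfolding Q_def by (intro exI[of _ h]) auto
      moreover have "cond_holds S ((snd (p \<Sigma>'))(0 := h i)) (fst (p \<Sigma>')) \<longleftrightarrow> Q (h i) \<Sigma>'"
        using p[THEN conjunct2, THEN conjunct2, of \<Sigma>'] \<Sigma>'(1) \<F>(1) by (meson subsetD)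
      ultimately show ?thesis using \<Sigma>'(2) by simp
    qed
    then show "\<exists>x. \<forall>(\<phi>, e)\<in>\<pi>'. cond_holds S (e(0 := x)) \<phi>" by blast
  qed
  then obtain x where x: "\<forall>\<Sigma>'\<in>?fin. cond_holds S ((snd (p \<Sigma>'))(0 := x)) (fst (p \<Sigma>'))"
    by (auto simp: case_prod_unfold)
  have "Q x \<Sigma>'" if "\<Sigma>' \<in> ?fin" for \<Sigma>'
    using p[OF that, THEN conjunct2, THEN conjunct2, THEN spec, of x] bspec[OF x that] by simp
  then show ?thesis unfolding fin_sat_def Q_def by (intro exI[of _ x] allI impI) simp
qed

lemma fin_sat_Union:
  assumes \<Sigma>: "fst ` \<Sigma> \<subseteq> conds S" and C: "\<C> \<noteq> {}" "subset.chain {R. fin_sat \<Sigma> R} \<C>"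
  shows "fin_sat \<Sigma> (\<Union>\<C>)"
proof -
  have fs: "fin_sat \<Sigma> R" if "R \<in> \<C>" for R using C(2) that unfolding subset.chain_def by blast
  have ch: "R \<subseteq> R' \<or> R' \<subseteq> R" if "R \<in> \<C>" "R' \<in> \<C>" for R R'
    using C(2) that unfolding subset.chain_def by blast
  have sv: "x = y" if xy: "(j, x) \<in> \<Union>\<C>" "(j, y) \<in> \<Union>\<C>" for j x y
  proof -
    obtain R R' where "R \<in> \<C>" "(j, x) \<in> R" "R' \<in> \<C>" "(j, y) \<in> R'" using xy by blast
    then obtain R'' where R'': "R'' \<in> \<C>" "(j, x) \<in> R''" "(j, y) \<in> R''" using ch[of R R'] by blast
    obtain r where r: "\<forall>(j, x)\<in>R''. r j = x" using fin_sat_fun[OF fs[OF R''(1)]] .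
    show ?thesis using bspec[OF r R''(2)] bspec[OF r R''(3)] by simp
  qed
  obtain r where r: "\<And>j x. (j, x) \<in> \<Union>\<C> \<Longrightarrow> r j = x"
  proof
    show "(THE x. (j, x) \<in> \<Union>\<C>) = x" if "(j, x) \<in> \<Union>\<C>" for j x
      using that sv by (intro the_equality)
  qed
  have "\<exists>h. (\<forall>(j, x)\<in>\<Union>\<C>. h j = x) \<and> satisfies h \<Sigma>'" if \<Sigma>': "\<Sigma>' \<subseteq> \<Sigma>" "finite \<Sigma>'" for \<Sigma>'
  proof -
    have conds: "fst ` \<Sigma>' \<subseteq> conds S" using \<Sigma> \<Sigma>' by blast
    have "finite (vars \<Sigma>')" using finite_vars[OF \<Sigma>'(2) conds] .
    \<comment> \<open>Only finitely many unknowns occur in \<open>\<Sigma>'\<close>, so a single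
      member of the chain already contains all their values.\<close>
    then have "\<exists>R\<in>\<C>. \<forall>j\<in>vars \<Sigma>'. \<forall>x. (j, x) \<in> \<Union>\<C> \<longrightarrow> (j, x) \<in> R"
    proof (induction rule: finite_induct)
      case empty
      then show ?case using C(1) by blast
    next
      case (insert i V)
      then obtain R where R: "R \<in> \<C>" "\<forall>j\<in>V. \<forall>x. (j, x) \<in> \<Union>\<C> \<longrightarrow> (j, x) \<in> R" by blast
      show ?case
      proof (cases "i \<in> Domain (\<Union>\<C>)")
        case True
        then obtain R' y where "R' \<in> \<C>" "(i, y) \<in> R'" by blast
        moreover have "R \<union> R' \<in> \<C>" using ch[of R R'] R(1) \<open>R' \<in> \<C>\<close> by (auto simp: Un_absorb1 Un_absorb2)
        moreover have "(j, x) \<in> R \<union> R'" if "j \<in> insert i V" "(j, x) \<in> \<Union>\<C>" for j x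
        proof (cases "j = i")
          case True
          then have "x = y" using sv[of i x y] that(2) \<open>R' \<in> \<C>\<close> \<open>(i, y) \<in> R'\<close> by blast
          then show ?thesis using True \<open>(i, y) \<in> R'\<close> by blast
        next
          case False
          then show ?thesis using R(2) that by blast
        qed
        ultimately show ?thesis by blast
      next
        case False
        then have "\<forall>j\<in>insert i V. \<forall>x. (j, x) \<in> \<Union>\<C> \<longrightarrow> (j, x) \<in> R" using R(2) by blast
        then show ?thesis using R(1) by blast
      qed
    qed
    then obtain R where R: "R \<in> \<C>" "\<And>j x. j \<in> vars \<Sigma>' \<Longrightarrow> (j, x) \<in> \<Union>\<C> \<Longrightarrow> (j, x) \<in> R" by blast
    obtain h where h: "\<forall>(j, x)\<in>R. h j = x" "satisfies h \<Sigma>'"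
      by (rule fin_satD[OF fs[OF R(1)] \<Sigma>'])
    \<comment> \<open>The solution \<open>h\<close> respects \<open>R\<close> only. It is corrected
      on the domain of the whole union, which changes nothing at the unknowns of
      \<open>\<Sigma>'\<close>.\<close>
    define h' where "h' j = (if j \<in> Domain (\<Union>\<C>) then r j else h j)" for j
    have h'_eq: "h' j = x" if "(j, x) \<in> \<Union>\<C>" for j x
      using r[OF that] DomainI[OF that] by (simp add: h'_def)
    have "h j = h' j" if j: "j \<in> vars \<Sigma>'" for j
    proof (cases "j \<in> Domain (\<Union>\<C>)")
      case True
      then obtain x where x: "(j, x) \<in> \<Union>\<C>" by blast
      then show ?thesis using h'_eq[OF x] R(2)[OF j x] h(1) by auto
    next
      case False
      then show ?thesis by (simp add: h'_def)
    qed
    then have "satisfies h' \<Sigma>'" using h(2) satisfies_cong[OF conds] by blast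
    then show ?thesis using h'_eq by (intro exI[of _ h']) auto
  qed
  then show ?thesis unfolding fin_sat_def by blast
qed

text \<open>A maximal finitely satisfiable partial assignment is total, since it can be extended at
  any missing unknown; being total, it satisfies every single member of \<open>\<Sigma>\<close>. The
  set \<open>P\<close> of prescribed unknowns may be as large as the model: only \<open>J\<close>
  has to be small.\<close>

theorem compactness:
  assumes J: "small \<kappa> J" and \<Sigma>: "fst ` \<Sigma> \<subseteq> conds S" "vars \<Sigma> \<subseteq> J"
    and fs: "\<And>\<Sigma>'. \<Sigma>' \<subseteq> \<Sigma> \<Longrightarrow> finite \<Sigma>' \<Longrightarrow> \<exists>h. (\<forall>j\<in>P. h j = g j) \<and> satisfies h \<Sigma>'"
  shows "\<exists>h. (\<forall>j\<in>P. h j = g j) \<and> satisfies h \<Sigma>"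
proof -
  let ?R0 = "(\<lambda>j. (j, g j)) ` P"
  let ?A = "{R. fin_sat \<Sigma> R \<and> ?R0 \<subseteq> R}"
  have "?R0 \<in> ?A" using fs unfolding fin_sat_def by auto
  moreover have "\<Union>\<C> \<in> ?A" if "\<C> \<noteq> {}" "subset.chain ?A \<C>" for \<C>
  proof -
    have "subset.chain {R. fin_sat \<Sigma> R} \<C>" using that(2) unfolding subset.chain_def by blast
    moreover have "?R0 \<subseteq> \<Union>\<C>" using that unfolding subset.chain_def by blast
    ultimately show ?thesis using fin_sat_Union[OF \<Sigma>(1) that(1)] by blast
  qed
  ultimately obtain R where R: "R \<in> ?A" "\<And>R'. R' \<in> ?A \<Longrightarrow> R \<subseteq> R' \<Longrightarrow> R' = R"
    using subset_Zorn_nonempty[of ?A] by (metis (no_types, lifting) empty_iff)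
  have dom: "j \<in> Domain R" for j
  proof (rule ccontr)
    assume j: "j \<notin> Domain R"
    then obtain x where "fin_sat \<Sigma> (insert (j, x) R)"
      using fin_sat_extend[OF J \<Sigma>] R(1) by blast
    then have "insert (j, x) R = R" using R by (intro R(2)) auto
    then show False using j by blast
  qed
  have "fin_sat \<Sigma> R" using R(1) by blast
  then obtain h where h0: "\<forall>(j, x)\<in>R. h j = x" by (rule fin_sat_fun)
  have h: "h j = x" if "(j, x) \<in> R" for j x using h0 that by auto
  have "cond_holds S (h \<circ> s) \<phi>" if "(\<phi>, s) \<in> \<Sigma>" for \<phi> s
  proof -
    have "fin_sat \<Sigma> R" "{(\<phi>, s)} \<subseteq> \<Sigma>" "finite {(\<phi>, s)}" using R(1) that by auto
    then obtain h' where h': "\<forall>(j, x)\<in>R. h' j = x" "satisfies h' {(\<phi>, s)}" by (rule fin_satD)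
    have "h' = h"
    proof
      fix j
      obtain x where "(j, x) \<in> R" using dom[of j] by blast
      then show "h' j = h j" using h h'(1) by auto
    qed
    then show ?thesis using h'(2) by (simp add: satisfies_def)
  qed
  then have "satisfies h \<Sigma>" unfolding satisfies_def by blast
  moreover have "\<forall>j\<in>P. h j = g j" using R(1) h by blast
  ultimately show ?thesis by blast
qed

subsection \<open>Homogeneity\<close>

text \<open>Preservation in one direction is enough: if \<open>\<phi>\<close> failed at
  \<open>h\<close>, a condition refuting it would hold at \<open>h\<close> and hence at
  \<open>h'\<close>.\<close>

lemma homogeneity:
  assumes J: "small \<kappa> J"
    and holds: "\<And>\<phi> s. \<phi> \<in> conds S \<Longrightarrow> s ` cond_fv S \<phi> \<subseteq> J \<Longrightarrow>
      cond_holds S (h \<circ> s) \<phi> \<Longrightarrow> cond_holds S (h' \<circ> s) \<phi>"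
  shows "\<exists>\<sigma>\<in>auts S. \<forall>j\<in>J. \<sigma> (h j) = h' j"
proof -
  have iff: "cond_holds S (h \<circ> s) \<phi> \<longleftrightarrow> cond_holds S (h' \<circ> s) \<phi>"
    if \<phi>: "\<phi> \<in> conds S" and s: "s ` cond_fv S \<phi> \<subseteq> J" for \<phi> s
  proof (rule iffI)
    show "cond_holds S (h \<circ> s) \<phi> \<Longrightarrow> cond_holds S (h' \<circ> s) \<phi>" using holds[OF \<phi> s] .
    assume h': "cond_holds S (h' \<circ> s) \<phi>"
    show "cond_holds S (h \<circ> s) \<phi>"
    proof (rule ccontr)
      assume "\<not> cond_holds S (h \<circ> s) \<phi>"
      then obtain \<xi> where \<xi>: "\<xi> \<in> conds S" "cond_fv S \<xi> \<subseteq> cond_fv S \<phi>"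
          "cond_holds S (h \<circ> s) \<xi>" "\<forall>e'. cond_holds S e' \<xi> \<longrightarrow> \<not> cond_holds S e' \<phi>"
        using refuting_cond[OF \<phi>, of "h \<circ> s"] by blast
      have "s ` cond_fv S \<xi> \<subseteq> J" using s \<xi>(2) by blast
      then have "cond_holds S (h' \<circ> s) \<xi>" using holds[OF \<xi>(1) _ \<xi>(3)] by blast
      then show False using \<xi>(4) h' by blast
    qed
  qed
  obtain g :: "_ \<Rightarrow> 'i" where g: "inj_on g J" using small_inj[OF J] .
  \<comment> \<open>Strong homogeneity is stated for tuples indexed by \<open>'i\<close>, so
    \<open>J\<close> is copied there.\<close>
  define tup where "tup k i = (if i \<in> g ` J then Some (k (inv_into J g i)) else None)"
    for k :: "_ \<Rightarrow> 'a" and i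
  have dom: "dom (tup k) = g ` J" for k by (auto simp: tup_def dom_def)
  have "cond_holds S (the \<circ> tup h \<circ> s) \<phi> \<longleftrightarrow> cond_holds S (the \<circ> tup h' \<circ> s) \<phi>"
    if \<phi>: "\<phi> \<in> conds S" and s: "s ` cond_fv S \<phi> \<subseteq> dom (tup h)" for \<phi> s
  proof -
    define s' where "s' = inv_into J g \<circ> s"
    have sn: "s n \<in> g ` J" if "n \<in> cond_fv S \<phi>" for n using s that dom by blast
    then have s': "s' ` cond_fv S \<phi> \<subseteq> J" by (auto simp: s'_def intro: inv_into_into)
    have "cond_holds S (the \<circ> tup k \<circ> s) \<phi> \<longleftrightarrow> cond_holds S (k \<circ> s') \<phi>" for k
      by (rule holds_cong[OF \<phi>]) (simp add: tup_def s'_def sn)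
    then show ?thesis using iff[OF \<phi> s'] by simp
  qed
  then have "same_type S (tup h) (tup h')" unfolding same_type_def by (simp add: dom)
  moreover have "real_tuple \<kappa> (tup k)" for k
    unfolding real_tuple_def dom by (rule small_image[OF J])
  ultimately obtain \<sigma> where \<sigma>: "\<sigma> \<in> auts S" "act \<sigma> (tup h) = tup h'"
    using homogeneous unfolding strongly_homogeneous_def by blast
  have "\<sigma> (h j) = h' j" if j: "j \<in> J" for j
  proof -
    have "tup k (g j) = Some (k j)" for k using j g by (simp add: tup_def)
    then show ?thesis using fun_cong[OF \<sigma>(2), of "g j"] by (simp add: act_def)
  qed
  then show ?thesis using \<sigma>(1) by blast
qed

section \<open>Pointwise stabilisers and the number of types\<close>

definition fixing :: "'a set \<Rightarrow> ('a \<Rightarrow> 'a) set" where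
  "fixing B = {\<sigma> \<in> auts S. \<forall>x\<in>B. \<sigma> x = x}"

lemma fixing_aut: "\<sigma> \<in> fixing B \<Longrightarrow> \<sigma> \<in> auts S"
  and fixing_eq: "\<sigma> \<in> fixing B \<Longrightarrow> x \<in> B \<Longrightarrow> \<sigma> x = x"
  by (auto simp: fixing_def)

lemma fixingI: "\<sigma> \<in> auts S \<Longrightarrow> (\<And>x. x \<in> B \<Longrightarrow> \<sigma> x = x) \<Longrightarrow> \<sigma> \<in> fixing B"
  by (auto simp: fixing_def)

lemma fixing_mono: "B \<subseteq> C \<Longrightarrow> fixing C \<subseteq> fixing B"
  by (auto simp: fixing_def)

lemma fixing_comp: "\<sigma> \<in> fixing B \<Longrightarrow> \<tau> \<in> fixing B \<Longrightarrow> \<sigma> \<circ> \<tau> \<in> fixing B"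
  by (simp add: fixing_def comp_aut)

lemma fixing_inv:
  assumes "\<sigma> \<in> fixing B"
  shows "inv \<sigma> \<in> fixing B"
proof (rule fixingI)
  show "inv \<sigma> \<in> auts S" using assms inv_aut fixing_aut by blast
  fix x assume "x \<in> B"
  then show "inv \<sigma> x = x"
    using inv_aut_apply(1)[OF fixing_aut[OF assms], of x] fixing_eq[OF assms] by simp
qed

text \<open>Up to an automorphism fixing \<open>D\<close>, the restriction of \<open>f\<close> to
  \<open>N\<close> is determined by its type over \<open>D\<close>. There are few such types because
  \<open>\<kappa>\<close> is a strong limit, although there may be many automorphisms. With
  \<open>D = N\<close> this counts double cosets of the stabiliser of \<open>N\<close>.\<close>

lemma small_orbits:
  assumes "small \<kappa> D" "small \<kappa> N" "Y \<subseteq> auts S"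
  obtains R where "R \<subseteq> Y" "small \<kappa> R"
    "\<And>f. f \<in> Y \<Longrightarrow> \<exists>r\<in>R. \<exists>\<beta>\<in>fixing D. \<forall>x\<in>N. f x = \<beta> (r x)"
proof -
  define J :: "('a + 'a) set" where "J = Inl ` D \<union> Inr ` N"
  have J: "small \<kappa> J" unfolding J_def by (intro small_Un small_image assms)
  \<comment> \<open>Substitutions are normalised to the default \<open>Inl undefined\<close> outside
    the free variables of the condition; sequences in a small set then suffice to describe a
    type.\<close>
  define seqs where "seqs = {s :: nat \<Rightarrow> 'a + 'a. range s \<subseteq> insert (Inl undefined) J}"
  have seqs: "small \<kappa> seqs" unfolding seqs_def by (intro small_seqs small_insert J)
  define tp where "tp f = {p \<in> conds S \<times> seqs. cond_holds S (case_sum id f \<circ> snd p) (fst p)}" for f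
  have "tp ` Y \<subseteq> Pow (conds S \<times> seqs)" by (auto simp: tp_def)
  then have small_tp: "small \<kappa> (tp ` Y)"
    by (rule small_subset) (intro small_Pow small_Times conds_small seqs)
  show thesis
  proof
    show "inv_into Y tp ` (tp ` Y) \<subseteq> Y" by (auto intro: inv_into_into)
    show "small \<kappa> (inv_into Y tp ` (tp ` Y))" by (rule small_image[OF small_tp])
    fix f assume f: "f \<in> Y"
    define r where "r = inv_into Y tp (tp f)"
    have r: "r \<in> inv_into Y tp ` (tp ` Y)" "tp r = tp f"
      using f by (auto simp: r_def f_inv_into_f)
    have "\<exists>\<beta>\<in>auts S. \<forall>j\<in>J. \<beta> (case_sum id r j) = case_sum id f j"
    proof (rule homogeneity[OF J])
      fix \<phi> s assume \<phi>: "\<phi> \<in> conds S" and s: "s ` cond_fv S \<phi> \<subseteq> J"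
        and r_holds: "cond_holds S (case_sum id r \<circ> s) \<phi>"
      define s' where "s' n = (if n \<in> cond_fv S \<phi> then s n else Inl undefined)" for n
      have eq: "cond_holds S (k \<circ> s') \<phi> \<longleftrightarrow> cond_holds S (k \<circ> s) \<phi>" for k
        by (rule holds_cong[OF \<phi>]) (simp add: s'_def)
      have "s' \<in> seqs" using s by (auto simp: s'_def seqs_def)
      then have "(\<phi>, s') \<in> tp r" using r_holds \<phi> eq by (simp add: tp_def)
      then have "cond_holds S (case_sum id f \<circ> s') \<phi>" unfolding r(2) by (simp add: tp_def)
      then show "cond_holds S (case_sum id f \<circ> s) \<phi>" using eq by blast
    qed
    then obtain \<beta> where \<beta>: "\<beta> \<in> auts S" "\<And>j. j \<in> J \<Longrightarrow> \<beta> (case_sum id r j) = case_sum id f j"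
      by blast
    have "\<beta> \<in> fixing D"
    proof (rule fixingI[OF \<beta>(1)])
      show "\<beta> x = x" if "x \<in> D" for x using \<beta>(2)[of "Inl x"] that by (simp add: J_def)
    qed
    moreover have "\<forall>x\<in>N. f x = \<beta> (r x)" using \<beta>(2)[of "Inr _"] by (simp add: J_def)
    ultimately show "\<exists>r\<in>inv_into Y tp ` (tp ` Y). \<exists>\<beta>\<in>fixing D. \<forall>x\<in>N. f x = \<beta> (r x)"
      using r(1) by blast
  qed
qed

subsection \<open>Elementary subsets\<close>

text \<open>The Tarski-Vaught test with exact solutions: in continuous logic a solvable condition
  must have value 0 somewhere in \<open>N\<close>, not merely arbitrarily small values.\<close>

definition elementary :: "'a set \<Rightarrow> bool" where
  "elementary N \<longleftrightarrow> (\<forall>\<phi>\<in>conds S. \<forall>e x. e ` (cond_fv S \<phi> - {0}) \<subseteq> N \<longrightarrow>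
     cond_holds S (e(0 := x)) \<phi> \<longrightarrow> (\<exists>y\<in>N. cond_holds S (e(0 := y)) \<phi>))"

lemma elementary_hull:
  assumes "small \<kappa> B"
  obtains N where "small \<kappa> N" "B \<subseteq> N" "elementary N"
proof -
  \<comment> \<open>The first kind of operation is a Skolem function of a condition, reading the
    parameters from the list by position; the second kind are constants.\<close>
  define op where "op = case_sum (\<lambda>\<phi> xs. SOME x. cond_holds S ((\<lambda>n. xs ! n)(0 := x)) \<phi>)
    (\<lambda>b xs. b :: 'a)"
  \<comment> \<open>\<open>undefined\<close> is put into the hull because it pads the positions of
    the list that carry no parameter.\<close>
  define Ops where "Ops = conds S <+> insert undefined B"
  define N where "N = generated Ops op"
  have N: "b \<in> N" if "b \<in> insert undefined B" for b
    using generated_closed[of "Inr b" Ops "[]" op] that by (auto simp: N_def Ops_def op_def)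
  have "elementary N" unfolding elementary_def
  proof (intro ballI allI impI)
    fix \<phi> e x assume \<phi>: "\<phi> \<in> conds S" and e: "e ` (cond_fv S \<phi> - {0}) \<subseteq> N"
      and x: "cond_holds S (e(0 := x)) \<phi>"
    obtain m where m: "\<forall>n\<in>cond_fv S \<phi>. n < m"
      using finite_fv[OF \<phi>] unfolding finite_nat_set_iff_bounded ..
    define xs where "xs = map (\<lambda>n. if n \<in> cond_fv S \<phi> - {0} then e n else undefined) [0..<m]"
    have xs: "cond_holds S ((\<lambda>n. xs ! n)(0 := y)) \<phi> \<longleftrightarrow> cond_holds S (e(0 := y)) \<phi>" for y
      by (rule holds_cong[OF \<phi>]) (simp add: xs_def m)
    have "set xs \<subseteq> N" using e N[of undefined] by (auto simp: xs_def)
    then have "op (Inl \<phi>) xs \<in> N"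
      unfolding N_def using \<phi> by (intro generated_closed) (auto simp: Ops_def)
    moreover have "\<exists>y. cond_holds S ((\<lambda>n. xs ! n)(0 := y)) \<phi>" using x xs by blast
    then have "cond_holds S ((\<lambda>n. xs ! n)(0 := op (Inl \<phi>) xs)) \<phi>"
      unfolding op_def sum.case by (rule someI_ex)
    ultimately show "\<exists>y\<in>N. cond_holds S (e(0 := y)) \<phi>" using xs by blast
  qed
  moreover have "small \<kappa> N"
    unfolding N_def Ops_def by (intro small_generated small_Plus conds_small small_insert assms)
  moreover have "B \<subseteq> N" using N by blast
  ultimately show thesis using that by blast
qed

lemma elementary_var:
  assumes N: "elementary N" and \<phi>: "\<phi> \<in> conds S" and e: "e ` (cond_fv S \<phi> - {n}) \<subseteq> N"
    and x: "cond_holds S (e(n := x)) \<phi>"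
  shows "\<exists>y\<in>N. cond_holds S (e(n := y)) \<phi>"
proof -
  \<comment> \<open>The variable \<open>n\<close> becomes 0 and every other variable moves up by
    one, so that no two variables collide; \<open>e'\<close> undoes the shift.\<close>
  define s where "s k = (if k = n then 0 else Suc k)" for k
  obtain \<xi> where \<xi>: "\<xi> \<in> conds S" "cond_fv S \<xi> \<subseteq> s ` cond_fv S \<phi>"
      "\<And>e. cond_holds S e \<xi> \<longleftrightarrow> cond_holds S (e \<circ> s) \<phi>"
    using rename_cond[OF \<phi>, of s] by blast
  define e' where "e' k = e (k - 1)" for k
  have eq: "e'(0 := y) \<circ> s = e(n := y)" for y by (auto simp: e'_def s_def)
  have "e' ` (cond_fv S \<xi> - {0}) \<subseteq> N"
  proof
    fix z assume "z \<in> e' ` (cond_fv S \<xi> - {0})"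
    then obtain k where "k \<in> cond_fv S \<phi>" "s k \<noteq> 0" "z = e' (s k)" using \<xi>(2) by auto
    then show "z \<in> N" using e by (auto simp: e'_def s_def split: if_splits)
  qed
  moreover have "cond_holds S (e'(0 := x)) \<xi>" using x by (simp add: \<xi>(3) eq)
  ultimately obtain y where "y \<in> N" "cond_holds S (e'(0 := y)) \<xi>"
    using N \<xi>(1) unfolding elementary_def by meson
  then show ?thesis using eq \<xi>(3) by auto
qed

text \<open>One variable at a time: with the rest of \<open>F\<close> quantified out, a value in
  \<open>N\<close> for \<open>n\<close> exists, and it becomes a parameter from \<open>N\<close> for
  the remaining variables.\<close>

lemma elementary_finite:
  assumes N: "elementary N" and "finite F" and \<phi>: "\<phi> \<in> conds S"
    and "e ` (cond_fv S \<phi> - F) \<subseteq> N" "cond_holds S e \<phi>"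
  shows "\<exists>e'. (\<forall>n. n \<notin> F \<longrightarrow> e' n = e n) \<and> e' ` F \<subseteq> N \<and> cond_holds S e' \<phi>"
  using assms(2,4,5)
proof (induction F arbitrary: e rule: finite_induct)
  case empty
  then show ?case by (intro exI[of _ e]) simp
next
  case (insert n F)
  obtain \<xi> where \<xi>: "\<xi> \<in> conds S" "cond_fv S \<xi> \<subseteq> cond_fv S \<phi> - F"
    "\<And>e. cond_holds S e \<xi> \<longleftrightarrow> (\<exists>e'. (\<forall>n. n \<notin> F \<longrightarrow> e' n = e n) \<and> cond_holds S e' \<phi>)"
    using ex_finite_cond[OF insert.hyps(1) \<phi>] by blast
  have "e ` (cond_fv S \<xi> - {n}) \<subseteq> N" using \<xi>(2) insert.prems(1) by blast
  moreover have "cond_holds S (e(n := e n)) \<xi>" unfolding \<xi>(3) using insert.prems(2) by auto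
  ultimately obtain y where y: "y \<in> N" "cond_holds S (e(n := y)) \<xi>"
    using elementary_var[OF N \<xi>(1)] by blast
  then obtain e1 where e1: "\<And>k. k \<notin> F \<Longrightarrow> e1 k = (e(n := y)) k" "cond_holds S e1 \<phi>"
    using \<xi>(3) by blast
  have "e1 k \<in> N" if "k \<in> cond_fv S \<phi> - F" for k
  proof (cases "k = n")
    case True
    then show ?thesis using e1(1)[of k] that y(1) by simp
  next
    case False
    then show ?thesis using e1(1)[of k] that insert.prems(1) by auto
  qed
  then obtain e2 where e2: "\<And>k. k \<notin> F \<Longrightarrow> e2 k = e1 k" "e2 ` F \<subseteq> N" "cond_holds S e2 \<phi>"
    using insert.IH[of e1] e1(2) by blast
  have "e2 n \<in> N" using e1(1)[of n] e2(1)[of n] insert.hyps(2) y(1) by simp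
  moreover have "\<forall>k. k \<notin> insert n F \<longrightarrow> e2 k = e k" using e1(1) e2(1) by simp
  ultimately show ?case using e2(2,3) by (intro exI[of _ e2]) simp
qed

text \<open>A type over \<open>N\<close> is finitely satisfiable in \<open>N\<close>. This is what
  makes coheirs exist.\<close>

lemma elementary_satisfies:
  fixes k0 :: "'b \<Rightarrow> 'a"
  assumes N: "elementary N" and \<Sigma>: "finite \<Sigma>" "fst ` \<Sigma> \<subseteq> conds S" "vars \<Sigma> \<subseteq> Inl ` N \<union> range Inr"
    and sat: "satisfies (case_sum id k0) \<Sigma>"
  shows "\<exists>k. range k \<subseteq> N \<and> satisfies (case_sum id k) \<Sigma>"
proof -
  \<comment> \<open>The true condition forces \<open>N\<close> to be nonempty; \<open>n0\<close> is
    the value of the unknowns that do not occur in \<open>\<Sigma>\<close>.\<close>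
  have "\<exists>n0. n0 \<in> N"
    using true_cond N unfolding elementary_def by (metis Diff_empty empty_subsetI image_empty empty_Diff)
  then obtain n0 where n0: "n0 \<in> N" ..
  have finV: "finite (vars \<Sigma>)" using finite_vars[OF \<Sigma>(1,2)] .
  obtain num :: "_ \<Rightarrow> nat" where num: "inj_on num (vars \<Sigma>)"
    using finite_imp_inj_to_nat_seg[OF finV] by metis
  define \<Sigma>n where "\<Sigma>n = (\<lambda>(\<phi>, s). (\<phi>, num \<circ> s)) ` \<Sigma>"
  have "finite \<Sigma>n" "\<And>\<phi> s. (\<phi>, s) \<in> \<Sigma>n \<Longrightarrow> \<phi> \<in> conds S" using \<Sigma>(1,2) by (force simp: \<Sigma>n_def)+
  then obtain \<xi> where \<xi>: "\<xi> \<in> conds S" "cond_fv S \<xi> \<subseteq> (\<Union>(\<phi>, s)\<in>\<Sigma>n. s ` cond_fv S \<phi>)"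
      "\<And>e. cond_holds S e \<xi> \<longleftrightarrow> (\<forall>(\<phi>, s)\<in>\<Sigma>n. cond_holds S (e \<circ> s) \<phi>)"
    using conj_finite_cond[of \<Sigma>n] by blast
  have \<xi>_fv: "cond_fv S \<xi> \<subseteq> num ` vars \<Sigma>" using \<xi>(2) by (force simp: vars_def \<Sigma>n_def)
  have \<xi>_holds: "cond_holds S e \<xi> \<longleftrightarrow> satisfies (e \<circ> num) \<Sigma>" for e
    unfolding \<xi>(3) satisfies_def \<Sigma>n_def by (auto simp: comp_assoc split: prod.splits)
  define F where "F = num ` (vars \<Sigma> \<inter> range Inr)"
  define e where "e n = case_sum id k0 (inv_into (vars \<Sigma>) num n)" for n
  have e_num: "e (num j) = case_sum id k0 j" if "j \<in> vars \<Sigma>" for j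
    using that num by (simp add: e_def)
  have "finite F" using finV by (simp add: F_def)
  moreover have "e ` (cond_fv S \<xi> - F) \<subseteq> N"
  proof
    fix z assume "z \<in> e ` (cond_fv S \<xi> - F)"
    then obtain n where n: "n \<in> cond_fv S \<xi>" "n \<notin> F" "z = e n" by blast
    obtain j where j: "j \<in> vars \<Sigma>" "n = num j" using n(1) \<xi>_fv by blast
    have "j \<notin> range Inr" using n(2) j by (auto simp: F_def)
    then have "j \<in> Inl ` N" using j(1) \<Sigma>(3) by blast
    then show "z \<in> N" using n(3) j e_num[OF j(1)] by auto
  qed
  moreover have "cond_holds S e \<xi>"
  proof -
    have "(e \<circ> num) j = case_sum id k0 j" if "j \<in> vars \<Sigma>" for j using e_num[OF that] by simp
    then show ?thesis unfolding \<xi>_holds using sat satisfies_cong[OF \<Sigma>(2)] by blast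
  qed
  ultimately obtain e' where e': "\<forall>n. n \<notin> F \<longrightarrow> e' n = e n" "e' ` F \<subseteq> N" "cond_holds S e' \<xi>"
    using elementary_finite[OF N _ \<xi>(1)] by blast
  define k where "k x = (if Inr x \<in> vars \<Sigma> then e' (num (Inr x)) else n0)" for x
  have "(e' \<circ> num) j = case_sum id k j" if j: "j \<in> vars \<Sigma>" for j
  proof (cases j)
    case (Inl x)
    have "num j \<notin> F" using j num Inl by (auto simp: F_def inj_on_def)
    then show ?thesis using e'(1) e_num[OF j] Inl by simp
  next
    case (Inr x)
    then show ?thesis using j by (simp add: k_def)
  qed
  then have "satisfies (case_sum id k) \<Sigma>" using e'(3) \<xi>_holds satisfies_cong[OF \<Sigma>(2)] by blast
  moreover have "k x \<in> N" for x
    using e'(2) n0 by (auto simp: k_def F_def)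
  then have "range k \<subseteq> N" by blast
  ultimately show ?thesis by blast
qed

text \<open>In continuous logic the equivalence of two instances of a condition is not a condition. A
  pair \<open>(\<xi>, u)\<close> with the following property replaces it: it implies the equivalence, and it holds
  whenever the two instances are conjugate.\<close>

definition iff_for :: "'c \<times> (nat \<Rightarrow> 'j) \<Rightarrow> 'c \<Rightarrow> (nat \<Rightarrow> 'j) \<Rightarrow> (nat \<Rightarrow> 'j) \<Rightarrow> bool" where
  "iff_for p \<phi> s t \<longleftrightarrow> fst p \<in> conds S \<and>
     snd p ` cond_fv S (fst p) \<subseteq> s ` cond_fv S \<phi> \<union> t ` cond_fv S \<phi> \<and>
     (\<forall>h. cond_holds S (h \<circ> snd p) (fst p) \<longrightarrow>
       (cond_holds S (h \<circ> s) \<phi> \<longleftrightarrow> cond_holds S (h \<circ> t) \<phi>)) \<and>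
     (\<forall>h. \<forall>\<sigma>\<in>auts S. (\<forall>n\<in>cond_fv S \<phi>. h (t n) = \<sigma> (h (s n))) \<longrightarrow>
       cond_holds S (h \<circ> snd p) (fst p))"

definition iff_pair :: "'c \<Rightarrow> (nat \<Rightarrow> 'j) \<Rightarrow> (nat \<Rightarrow> 'j) \<Rightarrow> 'c \<times> (nat \<Rightarrow> 'j)" where
  "iff_pair \<phi> s t = (SOME p. iff_for p \<phi> s t)"

lemma iff_pair:
  fixes s t :: "nat \<Rightarrow> 'j"
  assumes \<phi>: "\<phi> \<in> conds S"
  shows "iff_for (iff_pair \<phi> s t) \<phi> s t"
proof -
  \<comment> \<open>\<open>iff_cond\<close> substitutes numbers for variables. Even and odd numbers
    keep the two instances apart, and \<open>u\<close> then sends each of them to its own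
    unknowns.\<close>
  define s0 :: "nat \<Rightarrow> nat" where "s0 n = 2 * n" for n
  define t0 :: "nat \<Rightarrow> nat" where "t0 n = 2 * n + 1" for n
  define u where "u k = (if even k then s (k div 2) else t (k div 2))" for k
  have us: "h \<circ> u \<circ> s0 = h \<circ> s" and ut: "h \<circ> u \<circ> t0 = h \<circ> t" for h :: "'j \<Rightarrow> 'a"
    by (auto simp: u_def s0_def t0_def fun_eq_iff)
  obtain \<xi> where \<xi>: "\<xi> \<in> conds S" "cond_fv S \<xi> \<subseteq> s0 ` cond_fv S \<phi> \<union> t0 ` cond_fv S \<phi>"
      "\<forall>e. cond_holds S e \<xi> \<longrightarrow> (cond_holds S (e \<circ> s0) \<phi> \<longleftrightarrow> cond_holds S (e \<circ> t0) \<phi>)"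
      "\<forall>e. \<forall>\<sigma>\<in>auts S. (\<forall>n\<in>cond_fv S \<phi>. e (t0 n) = \<sigma> (e (s0 n))) \<longrightarrow> cond_holds S e \<xi>"
    using iff_cond[OF \<phi>, of s0 t0] by (elim bexE conjE)
  have "iff_for (\<xi>, u) \<phi> s t"
    unfolding iff_for_def fst_conv snd_conv
  proof (intro conjI allI ballI impI)
    show "u ` cond_fv S \<xi> \<subseteq> s ` cond_fv S \<phi> \<union> t ` cond_fv S \<phi>"
    proof
      fix z assume "z \<in> u ` cond_fv S \<xi>"
      then obtain k where k: "k \<in> cond_fv S \<xi>" "z = u k" by blast
      then have "k \<in> s0 ` cond_fv S \<phi> \<union> t0 ` cond_fv S \<phi>" using \<xi>(2) by blast
      then show "z \<in> s ` cond_fv S \<phi> \<union> t ` cond_fv S \<phi>"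
        using k(2) by (auto simp: u_def s0_def t0_def)
    qed
    show "cond_holds S (h \<circ> s) \<phi> \<longleftrightarrow> cond_holds S (h \<circ> t) \<phi>" if "cond_holds S (h \<circ> u) \<xi>" for h
      using \<xi>(3)[THEN spec, of "h \<circ> u"] that unfolding us ut by blast
    show "cond_holds S (h \<circ> u) \<xi>"
      if "\<sigma> \<in> auts S" "\<forall>n\<in>cond_fv S \<phi>. h (t n) = \<sigma> (h (s n))" for h \<sigma>
    proof -
      have "\<forall>n\<in>cond_fv S \<phi>. (h \<circ> u) (t0 n) = \<sigma> ((h \<circ> u) (s0 n))"
        using that(2) by (simp add: u_def s0_def t0_def)
      then show ?thesis using \<xi>(4)[THEN spec, THEN bspec, OF that(1), of "h \<circ> u"] by blast
    qed
  qed (rule \<xi>(1))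
  then show ?thesis unfolding iff_pair_def by (rule someI)
qed

lemma iff_for_cond: "iff_for p \<phi> s t \<Longrightarrow> fst p \<in> conds S"
  and iff_for_vars: "iff_for p \<phi> s t \<Longrightarrow>
    snd p ` cond_fv S (fst p) \<subseteq> s ` cond_fv S \<phi> \<union> t ` cond_fv S \<phi>"
  and iff_forD: "iff_for p \<phi> s t \<Longrightarrow> cond_holds S (h \<circ> snd p) (fst p) \<Longrightarrow>
    cond_holds S (h \<circ> s) \<phi> \<longleftrightarrow> cond_holds S (h \<circ> t) \<phi>"
  and iff_forI: "iff_for p \<phi> s t \<Longrightarrow> \<sigma> \<in> auts S \<Longrightarrow>
    (\<And>n. n \<in> cond_fv S \<phi> \<Longrightarrow> h (t n) = \<sigma> (h (s n))) \<Longrightarrow> cond_holds S (h \<circ> snd p) (fst p)"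
  unfolding iff_for_def by simp_all blast

text \<open>The elements \<open>\<tau> d\<close> realise a coheir of the type of \<open>D\<close> over \<open>N\<close>: every finite part of the
  requirements on them can be met inside \<open>N\<close>, where the equivalences hold because the members
  of \<open>W\<close> fix \<open>N\<close>.\<close>

lemma coheir:
  assumes N: "elementary N" "small \<kappa> N" and D: "small \<kappa> D" and W: "small \<kappa> W" "W \<subseteq> fixing N"
  shows "\<exists>\<tau>\<in>fixing N. \<forall>w\<in>W. \<exists>\<rho>\<in>fixing (N \<union> \<tau> ` D). \<forall>x\<in>D. \<rho> x = w x"
proof -
  \<comment> \<open>\<open>Inl x\<close> is the element \<open>x\<close> itself and
    \<open>Inr d\<close> is the unknown that becomes \<open>\<tau> d\<close>. \<open>J1\<close>
    serves to state the type of \<open>D\<close> over \<open>N\<close>, and \<open>J2\<close> to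
    state types of \<open>D\<close> over \<open>N\<close> and the unknowns.\<close>
  define J1 :: "('a + 'a) set" where "J1 = Inl ` N \<union> Inr ` D"
  define J2 :: "('a + 'a) set" where "J2 = Inl ` (N \<union> D) \<union> Inr ` D"
  define J :: "('a + 'a) set" where "J = J2 \<union> Inl ` (\<lambda>(w, x). w x) ` (W \<times> D)"
  have smallJ: "small \<kappa> J1" "small \<kappa> J2" "small \<kappa> J"
    unfolding J_def J1_def J2_def by (intro small_Un small_image small_Times N D W)+
  define \<Sigma>1 where "\<Sigma>1 = {(\<phi>, s). \<phi> \<in> conds S \<and> s ` cond_fv S \<phi> \<subseteq> J1 \<and>
    cond_holds S (case_sum id id \<circ> s) \<phi>}"
  define idx where "idx = {(w, \<phi>, s). w \<in> W \<and> \<phi> \<in> conds S \<and> s ` cond_fv S \<phi> \<subseteq> J2}"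
  define mk where "mk = (\<lambda>(w, \<phi>, s). iff_pair \<phi> s (map_sum w id \<circ> s :: nat \<Rightarrow> 'a + 'a))"
  define \<Sigma> where "\<Sigma> = \<Sigma>1 \<union> mk ` idx"
  have mk: "iff_for (mk (w, \<phi>, s)) \<phi> s (map_sum w id \<circ> s)" if "(w, \<phi>, s) \<in> idx" for w \<phi> s
    using that by (auto simp: mk_def idx_def intro: iff_pair)
  have conds: "fst ` \<Sigma> \<subseteq> conds S"
    using iff_for_cond[OF mk] by (auto simp: \<Sigma>_def \<Sigma>1_def)
  have varsJ: "vars \<Sigma> \<subseteq> J"
  proof -
    have "snd p ` cond_fv S (fst p) \<subseteq> J" if p: "p \<in> \<Sigma>" for p
    proof (cases "p \<in> \<Sigma>1")
      case True
      then have "snd p ` cond_fv S (fst p) \<subseteq> J1" by (auto simp: \<Sigma>1_def)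
      moreover have "J1 \<subseteq> J" by (auto simp: J1_def J2_def J_def)
      ultimately show ?thesis by (rule subset_trans)
    next
      case False
      then obtain w \<phi> s where i: "(w, \<phi>, s) \<in> idx" "p = mk (w, \<phi>, s)"
        using p by (auto simp: \<Sigma>_def)
      have s: "s ` cond_fv S \<phi> \<subseteq> J2" and w: "w \<in> W" using i(1) by (auto simp: idx_def)
      have "map_sum w id j \<in> J" if "j \<in> J2" for j
        using that w subsetD[OF W(2) w]
        by (force simp: J2_def J_def image_iff dest: fixing_eq)
      then have "(map_sum w id \<circ> s) ` cond_fv S \<phi> \<subseteq> J" using s by (auto simp: image_comp)
      moreover have "s ` cond_fv S \<phi> \<subseteq> J" using s by (auto simp: J_def)
      ultimately show ?thesis using iff_for_vars[OF mk[OF i(1)]] i(2) by blast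
    qed
    then show ?thesis by (fastforce simp: vars_def)
  qed
  have "\<exists>h. (\<forall>j\<in>range Inl. h j = case_sum id id j) \<and> satisfies h \<Sigma>"
  proof (rule compactness[OF smallJ(3) conds varsJ])
    fix \<Sigma>' assume \<Sigma>': "\<Sigma>' \<subseteq> \<Sigma>" "finite \<Sigma>'"
    have "satisfies (case_sum id id) (\<Sigma>' \<inter> \<Sigma>1)" by (auto simp: satisfies_def \<Sigma>1_def)
    moreover have "vars (\<Sigma>' \<inter> \<Sigma>1) \<subseteq> Inl ` N \<union> range Inr"
      by (auto simp: vars_def \<Sigma>1_def J1_def)
    moreover have "finite (\<Sigma>' \<inter> \<Sigma>1)" "fst ` (\<Sigma>' \<inter> \<Sigma>1) \<subseteq> conds S"
      using \<Sigma>'(2) by (auto simp: \<Sigma>1_def)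
    ultimately obtain k where k: "range k \<subseteq> N" "satisfies (case_sum id k) (\<Sigma>' \<inter> \<Sigma>1)"
      using elementary_satisfies[OF N(1)] by blast
    have "cond_holds S (case_sum id k \<circ> snd p) (fst p)" if p: "p \<in> \<Sigma>'" for p
    proof (cases "p \<in> \<Sigma>1")
      case True
      then show ?thesis using k(2) p by (auto simp: satisfies_def)
    next
      case False
      then obtain w \<phi> s where i: "(w, \<phi>, s) \<in> idx" "p = mk (w, \<phi>, s)"
        using p \<Sigma>'(1) by (auto simp: \<Sigma>_def)
      have w: "w \<in> fixing N" using i(1) W(2) by (auto simp: idx_def)
      have "case_sum id k (map_sum w id j) = w (case_sum id k j)" for j
        using fixing_eq[OF w subsetD[OF k(1) rangeI]] by (cases j) simp_all
      then show ?thesis unfolding i(2) by (intro iff_forI[OF mk[OF i(1)] fixing_aut[OF w]]) simp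
    qed
    then have "satisfies (case_sum id k) \<Sigma>'" by (auto simp: satisfies_def)
    then show "\<exists>h. (\<forall>j\<in>range Inl. h j = case_sum id id j) \<and> satisfies h \<Sigma>'"
      by (intro exI[of _ "case_sum id k"]) auto
  qed
  then obtain h where h: "\<And>x. h (Inl x) = x" "satisfies h \<Sigma>" by auto
  have "\<exists>\<tau>\<in>auts S. \<forall>j\<in>J1. \<tau> (case_sum id id j) = h j"
  proof (rule homogeneity[OF smallJ(1)])
    fix \<phi> s assume "\<phi> \<in> conds S" "s ` cond_fv S \<phi> \<subseteq> J1" "cond_holds S (case_sum id id \<circ> s) \<phi>"
    then have "(\<phi>, s) \<in> \<Sigma>" by (simp add: \<Sigma>_def \<Sigma>1_def)
    then show "cond_holds S (h \<circ> s) \<phi>" using h(2) by (auto simp: satisfies_def)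
  qed
  then obtain \<tau> where \<tau>: "\<tau> \<in> auts S" "\<And>j. j \<in> J1 \<Longrightarrow> \<tau> (case_sum id id j) = h j" by blast
  have \<tau>N: "\<tau> \<in> fixing N"
  proof (rule fixingI[OF \<tau>(1)])
    show "\<tau> x = x" if "x \<in> N" for x using \<tau>(2)[of "Inl x"] that h(1) by (simp add: J1_def)
  qed
  have \<tau>D: "\<tau> x = h (Inr x)" if "x \<in> D" for x using \<tau>(2)[of "Inr x"] that by (simp add: J1_def)
  have "\<exists>\<rho>\<in>fixing (N \<union> \<tau> ` D). \<forall>x\<in>D. \<rho> x = w x" if w: "w \<in> W" for w
  proof -
    have "\<exists>\<rho>\<in>auts S. \<forall>j\<in>J2. \<rho> (h j) = (h \<circ> map_sum w id) j"
    proof (rule homogeneity[OF smallJ(2)])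
      fix \<phi> s assume \<phi>: "\<phi> \<in> conds S" "s ` cond_fv S \<phi> \<subseteq> J2" "cond_holds S (h \<circ> s) \<phi>"
      have i: "(w, \<phi>, s) \<in> idx" using w \<phi> by (simp add: idx_def)
      then have "mk (w, \<phi>, s) \<in> \<Sigma>" by (simp add: \<Sigma>_def)
      then have "cond_holds S (h \<circ> snd (mk (w, \<phi>, s))) (fst (mk (w, \<phi>, s)))"
        using h(2) by (auto simp: satisfies_def)
      then show "cond_holds S (h \<circ> map_sum w id \<circ> s) \<phi>"
        using iff_forD[OF mk[OF i]] \<phi>(3) by (simp add: comp_assoc)
    qed
    then obtain \<rho> where \<rho>: "\<rho> \<in> auts S" "\<And>j. j \<in> J2 \<Longrightarrow> \<rho> (h j) = h (map_sum w id j)" by auto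
    have wN: "w x = x" if "x \<in> N" for x using fixing_eq[OF subsetD[OF W(2) w] that] .
    have "\<rho> \<in> fixing (N \<union> \<tau> ` D)"
    proof (rule fixingI[OF \<rho>(1)])
      fix x assume "x \<in> N \<union> \<tau> ` D"
      then show "\<rho> x = x"
      proof
        assume "x \<in> N"
        then show ?thesis using \<rho>(2)[of "Inl x"] wN h(1) by (simp add: J2_def)
      next
        assume "x \<in> \<tau> ` D"
        then obtain d where "d \<in> D" "x = \<tau> d" by blast
        then show ?thesis using \<rho>(2)[of "Inr d"] \<tau>D by (simp add: J2_def)
      qed
    qed
    moreover have "\<forall>x\<in>D. \<rho> x = w x" using \<rho>(2)[of "Inl _"] h(1) by (simp add: J2_def)
    ultimately show ?thesis by blast
  qed
  then show ?thesis using \<tau>N by blast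
qed

subsection \<open>Bounded ultraimaginaries\<close>

lemma act_comp: "act (\<sigma> \<circ> \<tau>) a = act \<sigma> (act \<tau> a)"
  and act_id: "act id a = a" and dom_act: "dom (act \<sigma> a) = dom a"
  by (auto simp: act_def fun_eq_iff option.map_comp option.map_id dom_def)

lemma act_comp_image: "act (\<sigma> \<circ> \<tau>) ` X = act \<sigma> ` act \<tau> ` X"
  by (simp add: image_image act_comp)

lemma act_cong: "(\<And>x. x \<in> ran a \<Longrightarrow> \<sigma> x = \<tau> x) \<Longrightarrow> act \<sigma> a = act \<tau> a"
  by (auto simp: act_def fun_eq_iff ran_def intro!: option.map_cong)

lemma invariantD:
  assumes "invariant_equiv S I E" "dom a = I" "dom b = I" "\<sigma> \<in> auts S"
  shows "(act \<sigma> a, act \<sigma> b) \<in> E \<longleftrightarrow> (a, b) \<in> E"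
  using assms unfolding invariant_equiv_def by blast

lemma class_image:
  assumes E: "invariant_equiv S I E" and a: "dom a = I" and \<sigma>: "\<sigma> \<in> auts S"
  shows "act \<sigma> ` (E `` {a}) = E `` {act \<sigma> a}"
proof -
  have E_dom: "dom x = I \<and> dom y = I" if "(x, y) \<in> E" for x y
    using that E unfolding invariant_equiv_def equiv_def refl_on_def by blast
  show ?thesis
  proof
    show "act \<sigma> ` (E `` {a}) \<subseteq> E `` {act \<sigma> a}"
      using invariantD[OF E a _ \<sigma>] E_dom by blast
    show "E `` {act \<sigma> a} \<subseteq> act \<sigma> ` (E `` {a})"
    proof
      fix b assume "b \<in> E `` {act \<sigma> a}"
      then have b: "(act \<sigma> a, b) \<in> E" by blast
      have eq: "b = act \<sigma> (act (inv \<sigma>) b)" using \<sigma> by (simp flip: act_comp add: act_id)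
      have "dom (act (inv \<sigma>) b) = I" using E_dom[OF b] by (simp add: dom_act)
      then have "(a, act (inv \<sigma>) b) \<in> E" using invariantD[OF E a _ \<sigma>] b eq by metis
      then show "b \<in> act \<sigma> ` (E `` {a})" using eq by blast
    qed
  qed
qed

lemma class_fixed_iff:
  assumes E: "invariant_equiv S I E" and a: "dom a = I" and \<sigma>: "\<sigma> \<in> auts S"
  shows "act \<sigma> ` (E `` {a}) = E `` {a} \<longleftrightarrow> (a, act \<sigma> a) \<in> E"
proof -
  have eq: "equiv {a. dom a = I} E" using E by (simp add: invariant_equiv_def)
  have "E `` {a} = E `` {act \<sigma> a} \<longleftrightarrow> (a, act \<sigma> a) \<in> E"
    using eq_equiv_class_iff[OF eq, of a "act \<sigma> a"] a by (simp add: dom_act)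
  then show ?thesis unfolding class_image[OF assms] by (metis (no_types))
qed

text \<open>By boundedness few automorphisms \<open>w\<close> represent all conjugates of
  \<open>X\<close> under the stabiliser of \<open>N\<close>. A coheir copy
  \<open>act \<tau> d\<close> of the representative \<open>d\<close> cannot distinguish
  \<open>d\<close> from any \<open>act w d\<close>. It is equivalent to one of these, since
  \<open>\<tau>\<close> moves \<open>X\<close> to one of the conjugates; hence it is equivalent to
  \<open>d\<close> and to \<open>act \<sigma> d\<close>, and \<open>d\<close> is equivalent to
  \<open>act \<sigma> d\<close>.\<close>

lemma fixing_bddu:
  assumes N: "elementary N" "small \<kappa> N" "fixing N \<subseteq> auts_over S C"
    and X: "X \<in> bddu \<kappa> S C" and \<sigma>: "\<sigma> \<in> fixing N"
  shows "act \<sigma> ` X = X"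
proof -
  obtain I E d where I: "small \<kappa> I" and E: "invariant_equiv S I E" and d: "dom d = I"
      and X_eq: "X = E `` {d}"
    using X unfolding bddu_def ultraimaginary_def by blast
  have eq: "equiv {a. dom a = I} E" using E by (simp add: invariant_equiv_def)
  have D: "small \<kappa> (ran d)"
  proof -
    have "ran d \<subseteq> (the \<circ> d) ` I" using d by (force simp: ran_def image_iff)
    then show ?thesis by (rule small_subset) (intro small_image I)
  qed
  let ?orb = "(\<lambda>\<rho>. act \<rho> ` X)"
  have "small \<kappa> (?orb ` auts_over S C)" using X unfolding bddu_def by blast
  then have smallO: "small \<kappa> (?orb ` fixing N)" by (rule small_subset[OF image_mono[OF N(3)]])
  \<comment> \<open>One automorphism for each conjugate of \<open>X\<close>, because the coheir can
    be arranged only for a small set, together with the given \<open>\<sigma>\<close>.\<close>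
  define W where "W = insert \<sigma> (inv_into (fixing N) ?orb ` ?orb ` fixing N)"
  have W: "small \<kappa> W" "W \<subseteq> fixing N"
    using small_insert[OF small_image[OF smallO]] \<sigma> by (auto simp: W_def intro: inv_into_into)
  obtain \<tau> where \<tau>: "\<tau> \<in> fixing N" "\<And>w. w \<in> W \<Longrightarrow> \<exists>\<rho>\<in>fixing (N \<union> \<tau> ` ran d). \<forall>x\<in>ran d. \<rho> x = w x"
    using coheir[OF N(1,2) D W] by blast
  \<comment> \<open>Some automorphism takes \<open>d\<close> to \<open>act w d\<close> and fixes
    \<open>act \<tau> d\<close>.\<close>
  have transfer: "(act w d, act \<tau> d) \<in> E \<longleftrightarrow> (d, act \<tau> d) \<in> E" if w: "w \<in> W" for w
  proof -
    obtain \<rho> where \<rho>: "\<rho> \<in> fixing (N \<union> \<tau> ` ran d)" "\<forall>x\<in>ran d. \<rho> x = w x" using \<tau>(2)[OF w] by blast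
    have "act \<rho> d = act w d" using \<rho>(2) by (intro act_cong) simp
    moreover have "act \<rho> (act \<tau> d) = act \<tau> d"
      unfolding act_comp[symmetric] using fixing_eq[OF \<rho>(1)] by (intro act_cong) simp
    ultimately show ?thesis
      using invariantD[OF E d _ fixing_aut[OF \<rho>(1)], of "act \<tau> d"] d by (simp add: dom_act)
  qed
  define w where "w = inv_into (fixing N) ?orb (?orb \<tau>)"
  have wW: "w \<in> W" using \<tau>(1) by (auto simp: W_def w_def)
  have "act w ` X = act \<tau> ` X"
    unfolding w_def using f_inv_into_f[of "?orb \<tau>" ?orb "fixing N"] \<tau>(1) by blast
  then have "E `` {act w d} = E `` {act \<tau> d}"
    using class_image[OF E d] wW W(2) \<tau>(1) fixing_aut unfolding X_eq by (metis subsetD)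
  then have "(act w d, act \<tau> d) \<in> E"
    using eq_equiv_class_iff[OF eq, of "act w d" "act \<tau> d"] d by (simp add: dom_act)
  then have 1: "(d, act \<tau> d) \<in> E" using transfer[OF wW] by blast
  then have "(act \<sigma> d, act \<tau> d) \<in> E" using transfer[of \<sigma>] by (simp add: W_def)
  then have "(d, act \<sigma> d) \<in> E"
    using 1 eq unfolding equiv_def by (meson symD transD)
  then show ?thesis unfolding X_eq using class_fixed_iff[OF E d fixing_aut[OF \<sigma>]] by blast
qed

end

section \<open>Moving a small set by a type-definable group\<close>

definition subgrp :: "('a \<Rightarrow> 'a) set \<Rightarrow> bool" where
  "subgrp L \<longleftrightarrow> id \<in> L \<and> (\<forall>x\<in>L. \<forall>y\<in>L. x \<circ> y \<in> L) \<and> (\<forall>x\<in>L. inv x \<in> L)"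

lemma subgrpD:
  assumes "subgrp L"
  shows "id \<in> L" "x \<in> L \<Longrightarrow> y \<in> L \<Longrightarrow> x \<circ> y \<in> L" "x \<in> L \<Longrightarrow> inv x \<in> L"
  using assms unfolding subgrp_def by auto

lemma subgrp_hull: "subgrp (subgrp hull X)"
  by (rule hull_in) (auto simp: subgrp_def)

text \<open>\<open>\<Gamma>\<close> expresses membership of \<open>\<sigma>\<close> in
  \<open>G\<close> by conditions on the elements of \<open>P\<close>, tagged \<open>Inl\<close>, and
  on their images under \<open>\<sigma>\<close>, tagged \<open>Inr\<close>. It lets compactness
  demand that the automorphism to be found lie in \<open>G\<close>.\<close>

locale type_definable_group = monster_frame \<kappa> S for \<kappa> :: "'i rel" and S :: "('a, 'c) frame" +
  fixes G :: "('a \<Rightarrow> 'a) set" and P N :: "'a set" and \<Gamma> :: "('c \<times> (nat \<Rightarrow> 'a + 'a)) set"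
  assumes G_subgrp: "subgrp G" and P_N: "P \<subseteq> N" and N_small: "small \<kappa> N"
    and \<Gamma>_conds: "fst ` \<Gamma> \<subseteq> conds S" and \<Gamma>_vars: "vars \<Gamma> \<subseteq> P <+> P"
    and G_def: "G = {\<sigma> \<in> auts S. satisfies (case_sum id \<sigma>) \<Gamma>}"
begin

lemma P_small: "small \<kappa> P" using small_subset[OF P_N N_small] .

lemma G_aut: "\<sigma> \<in> G \<Longrightarrow> \<sigma> \<in> auts S" by (simp add: G_def)

lemma G_eqI:
  assumes "\<sigma> \<in> G" "\<tau> \<in> auts S" "\<And>x. x \<in> P \<Longrightarrow> \<tau> x = \<sigma> x"
  shows "\<tau> \<in> G"
proof -
  have "case_sum id \<tau> j = case_sum id \<sigma> j" if "j \<in> vars \<Gamma>" for j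
  proof (cases j)
    case (Inr x)
    then have "x \<in> P" using that \<Gamma>_vars by blast
    then show ?thesis using Inr assms(3) by simp
  qed simp
  then have "satisfies (case_sum id \<tau>) \<Gamma> \<longleftrightarrow> satisfies (case_sum id \<sigma>) \<Gamma>"
    by (rule satisfies_cong[OF \<Gamma>_conds])
  then show ?thesis using assms(1,2) by (simp add: G_def)
qed

lemma fixing_G: "P \<subseteq> B \<Longrightarrow> fixing B \<subseteq> G"
  using G_eqI[OF subgrpD(1)[OF G_subgrp]] by (auto simp: fixing_def)

text \<open>In other words, the double coset of each \<open>\<tau>\<close> modulo \<open>fixing N\<close> meets the conjugate
  \<open>inv f \<circ> fixing (P \<union> B) \<circ> f\<close>.\<close>

definition good :: "('a \<Rightarrow> 'a) set \<Rightarrow> 'a set \<Rightarrow> ('a \<Rightarrow> 'a) \<Rightarrow> bool" where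
  "good Q B f \<longleftrightarrow> f \<in> G \<and>
     (\<forall>\<tau>\<in>Q. \<exists>u\<in>fixing N. \<exists>\<beta>\<in>fixing (P \<union> B). \<forall>x\<in>N. f (u (\<tau> x)) = \<beta> (f x))"

lemma good_mono:
  assumes "good Q B f" "Q' \<subseteq> Q" "B' \<subseteq> B"
  shows "good Q' B' f"
  unfolding good_def
proof (intro conjI ballI)
  show "f \<in> G" using assms(1) by (simp add: good_def)
  fix \<tau> assume "\<tau> \<in> Q'"
  then obtain u \<beta> where u: "u \<in> fixing N" "\<beta> \<in> fixing (P \<union> B)" "\<forall>x\<in>N. f (u (\<tau> x)) = \<beta> (f x)"
    using assms(1,2) unfolding good_def by blast
  moreover have "\<beta> \<in> fixing (P \<union> B')"
    using u(2) assms(3) fixing_mono[of "P \<union> B'" "P \<union> B"] by blast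
  ultimately show "\<exists>u\<in>fixing N. \<exists>\<beta>\<in>fixing (P \<union> B'). \<forall>x\<in>N. f (u (\<tau> x)) = \<beta> (f x)" by blast
qed

text \<open>Goodness sees only the double coset of \<open>\<tau>\<close> modulo the stabiliser of
  \<open>N\<close>: a left factor is absorbed into \<open>u\<close>, and a right factor is invisible
  on \<open>N\<close>.\<close>

lemma good_representatives:
  assumes "good R B f" and "\<And>\<tau>. \<tau> \<in> Q \<Longrightarrow> \<exists>r\<in>R. \<exists>v\<in>fixing N. \<forall>x\<in>N. \<tau> x = v (r x)"
  shows "good Q B f"
  unfolding good_def
proof (intro conjI ballI)
  show "f \<in> G" using assms(1) by (simp add: good_def)
  fix \<tau> assume "\<tau> \<in> Q"
  then obtain r v where r: "r \<in> R" "v \<in> fixing N" "\<forall>x\<in>N. \<tau> x = v (r x)" using assms(2) by blast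
  obtain u \<beta> where u: "u \<in> fixing N" "\<beta> \<in> fixing (P \<union> B)" "\<forall>x\<in>N. f (u (r x)) = \<beta> (f x)"
    using assms(1) r(1) unfolding good_def by blast
  have "u \<circ> inv v \<in> fixing N" using u(1) r(2) fixing_comp fixing_inv by blast
  moreover have "\<forall>x\<in>N. f ((u \<circ> inv v) (\<tau> x)) = \<beta> (f x)"
    using r(3) u(3) fixing_aut[OF r(2)] by simp
  ultimately show "\<exists>u\<in>fixing N. \<exists>\<beta>\<in>fixing (P \<union> B). \<forall>x\<in>N. f (u (\<tau> x)) = \<beta> (f x)"
    using u(2) by blast
qed

text \<open>The unknowns are the images \<open>f x\<close> and \<open>f (u (\<tau> x))\<close> for
  \<open>x\<close> in \<open>N\<close>. That they come from automorphisms \<open>f\<close>,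
  \<open>u\<close> and \<open>\<beta>\<close> is a statement about types, and homogeneity recovers
  the automorphisms from a solution.\<close>

lemma good_compact_small:
  assumes Q: "Q \<subseteq> G" "small \<kappa> Q" and B: "small \<kappa> B"
    and fin: "\<And>Q' B'. Q' \<subseteq> Q \<Longrightarrow> finite Q' \<Longrightarrow> B' \<subseteq> B \<Longrightarrow> finite B' \<Longrightarrow> \<exists>f. good Q' B' f"
  shows "\<exists>f. good Q B f"
proof -
  \<comment> \<open>\<open>par x\<close> is the parameter \<open>x\<close> itself,
    \<open>ev x\<close> stands for \<open>f x\<close>, and \<open>ew \<tau> x\<close> stands for
    \<open>f (u (\<tau> x))\<close>.\<close>
  define par where "par = (Inl :: 'a \<Rightarrow> 'a + ('a + ('a \<Rightarrow> 'a) \<times> 'a))"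
  define ev where "ev x = (Inr (Inl x) :: 'a + ('a + ('a \<Rightarrow> 'a) \<times> 'a))" for x
  define ew where "ew \<tau> x = (Inr (Inr (\<tau>, x)) :: 'a + ('a + ('a \<Rightarrow> 'a) \<times> 'a))" for \<tau> x
  note defs = par_def ev_def ew_def
  define val where "val f k = case_sum id (case_sum f (\<lambda>p :: ('a \<Rightarrow> 'a) \<times> 'a. k (fst p) (snd p)))"
    for f :: "'a \<Rightarrow> 'a" and k :: "('a \<Rightarrow> 'a) \<Rightarrow> 'a \<Rightarrow> 'a"
  have val: "val f k (par x) = x" "val f k (ev x) = f x" "val f k (ew \<tau> x) = k \<tau> x" for f k x \<tau>
    by (simp_all add: val_def defs)
  define h0 where "h0 = val id (\<lambda>\<tau>. \<tau>)"
  \<comment> \<open>The effect of the wanted \<open>\<beta>\<close> on unknowns: \<open>f x\<close>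
    goes to \<open>f (u (\<tau> x))\<close> and parameters stay.\<close>
  define sw where "sw \<tau> = case_sum par (case_sum (ew \<tau>) (\<lambda>p :: ('a \<Rightarrow> 'a) \<times> 'a. ew (fst p) (snd p)))"
    for \<tau> :: "'a \<Rightarrow> 'a"
  have sw: "sw \<tau> (par x) = par x" "sw \<tau> (ev x) = ew \<tau> x" for \<tau> x
    by (simp_all add: sw_def defs)
  define J0 where "J0 = ev ` N"
  define J1 where "J1 \<tau> = ev ` N \<union> ew \<tau> ` N" for \<tau>
  define J2 where "J2 = par ` (P \<union> B) \<union> ev ` N"
  define J where "J = J2 \<union> (\<lambda>(\<tau>, x). ew \<tau> x) ` (Q \<times> N)"
  have smallJ: "small \<kappa> J0" "small \<kappa> (J1 \<tau>)" "small \<kappa> J2" "small \<kappa> J" for \<tau>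
    unfolding J_def J0_def J1_def J2_def
    by (intro small_Un small_image small_Times N_small P_small B Q(2))+
  \<comment> \<open>Four families of requirements: the \<open>ev x\<close> realise the type of
    \<open>N\<close> (\<open>\<Sigma>0\<close>); together with the \<open>ew \<tau> x\<close> they
    realise the type of \<open>N\<close> and its image under \<open>\<tau>\<close>
    (\<open>idx1\<close>); both have the same type over \<open>P \<union> B\<close>
    (\<open>idx2\<close>); and \<open>f\<close> lies in \<open>G\<close>
    (\<open>\<Sigma>3\<close>).\<close>
  define \<Sigma>0 where "\<Sigma>0 = {(\<phi>, s). \<phi> \<in> conds S \<and> s ` cond_fv S \<phi> \<subseteq> J0 \<and> cond_holds S (h0 \<circ> s) \<phi>}"
  define idx1 where "idx1 = {(\<tau>, \<phi>, s). \<tau> \<in> Q \<and> \<phi> \<in> conds S \<and> s ` cond_fv S \<phi> \<subseteq> J1 \<tau> \<and>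
    cond_holds S (h0 \<circ> s) \<phi>}"
  define idx2 where "idx2 = {(\<tau>, \<phi>, s). \<tau> \<in> Q \<and> \<phi> \<in> conds S \<and> s ` cond_fv S \<phi> \<subseteq> J2}"
  define mk where "mk = (\<lambda>(\<tau>, \<phi>, s). iff_pair \<phi> s (sw \<tau> \<circ> s))"
  have mk: "iff_for (mk (\<tau>, \<phi>, s)) \<phi> s (sw \<tau> \<circ> s)" if "(\<tau>, \<phi>, s) \<in> idx2" for \<tau> \<phi> s
    using that by (auto simp: mk_def idx2_def intro: iff_pair)
  define emb where "emb = case_sum par ev"
  define \<Sigma>3 where "\<Sigma>3 = (\<lambda>p. (fst p, emb \<circ> snd p)) ` \<Gamma>"
  define \<Sigma> where "\<Sigma> = (\<Sigma>0 \<union> \<Sigma>3) \<union> (snd ` idx1 \<union> mk ` idx2)"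
  have val_emb: "val f k (emb j) = case_sum id f j" for f k j
    by (cases j) (simp_all add: emb_def val)
  have conds: "fst ` \<Sigma> \<subseteq> conds S"
    using iff_for_cond[OF mk] \<Gamma>_conds by (auto simp: \<Sigma>_def \<Sigma>0_def \<Sigma>3_def idx1_def)
  have emb_J: "(emb \<circ> snd p) ` cond_fv S (fst p) \<subseteq> J2" if "p \<in> \<Gamma>" for p
  proof -
    have "snd p ` cond_fv S (fst p) \<subseteq> P <+> P"
      using that \<Gamma>_vars by (fastforce simp: vars_def)
    moreover have "emb j \<in> J2" if "j \<in> P <+> P" for j
      using that P_N by (auto simp: emb_def J2_def)
    ultimately show ?thesis by auto
  qed
  have J0_J: "J0 \<subseteq> J" and J2_J: "J2 \<subseteq> J" and J1_J: "\<And>\<tau>. \<tau> \<in> Q \<Longrightarrow> J1 \<tau> \<subseteq> J"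
    by (auto simp: J0_def J1_def J2_def J_def)
  have sw_J: "sw \<tau> j \<in> J" if \<tau>: "\<tau> \<in> Q" and j: "j \<in> J2" for \<tau> j
  proof (cases "j \<in> ev ` N")
    case True
    then obtain x where "x \<in> N" "j = ev x" by blast
    then show ?thesis using \<tau> by (auto simp: J_def sw)
  next
    case False
    then obtain x where "x \<in> P \<union> B" "j = par x" using j by (auto simp: J2_def)
    then show ?thesis by (auto simp: J_def J2_def sw)
  qed
  have "snd p ` cond_fv S (fst p) \<subseteq> J" if p: "p \<in> \<Sigma>" for p
  proof -
    consider "p \<in> \<Sigma>0" | "p \<in> \<Sigma>3" | "p \<in> snd ` idx1" | "p \<in> mk ` idx2"
      using p unfolding \<Sigma>_def by blast
    then show ?thesis
    proof cases
      case 1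
      then have "snd p ` cond_fv S (fst p) \<subseteq> J0" by (auto simp: \<Sigma>0_def)
      then show ?thesis using J0_J by (rule subset_trans)
    next
      case 2
      then obtain q where "q \<in> \<Gamma>" "p = (fst q, emb \<circ> snd q)" by (auto simp: \<Sigma>3_def)
      then have "snd p ` cond_fv S (fst p) \<subseteq> J2" using emb_J by simp
      then show ?thesis using J2_J by (rule subset_trans)
    next
      case 3
      then obtain \<tau> where "\<tau> \<in> Q" "snd p ` cond_fv S (fst p) \<subseteq> J1 \<tau>" by (auto simp: idx1_def)
      then show ?thesis using J1_J[of \<tau>] by blast
    next
      case 4
      then obtain \<tau> \<phi> s where i: "(\<tau>, \<phi>, s) \<in> idx2" "p = mk (\<tau>, \<phi>, s)" by auto
      then have s: "s ` cond_fv S \<phi> \<subseteq> J2" "\<tau> \<in> Q" by (auto simp: idx2_def)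
      have "(sw \<tau> \<circ> s) ` cond_fv S \<phi> \<subseteq> J" using s sw_J by auto
      moreover have "s ` cond_fv S \<phi> \<subseteq> J" using s(1) J2_J by (rule subset_trans)
      ultimately show ?thesis using iff_for_vars[OF mk[OF i(1)]] i(2) by blast
    qed
  qed
  then have varsJ: "vars \<Sigma> \<subseteq> J" by (fastforce simp: vars_def)
  have "\<exists>h. (\<forall>j\<in>range par. h j = val id (\<lambda>\<tau>. \<tau>) j) \<and> satisfies h \<Sigma>"
  proof (rule compactness[OF smallJ(4) conds varsJ])
    fix \<Sigma>' assume \<Sigma>': "\<Sigma>' \<subseteq> \<Sigma>" "finite \<Sigma>'"
    have "finite (\<Sigma>' \<inter> snd ` idx1)" "finite (\<Sigma>' \<inter> mk ` idx2)" using \<Sigma>'(2) by auto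
    then obtain T1 T2 where T1: "T1 \<subseteq> idx1" "finite T1" "\<Sigma>' \<inter> snd ` idx1 = snd ` T1"
      and T2: "T2 \<subseteq> idx2" "finite T2" "\<Sigma>' \<inter> mk ` idx2 = mk ` T2"
      using finite_subset_image[of "\<Sigma>' \<inter> snd ` idx1" snd idx1]
        finite_subset_image[of "\<Sigma>' \<inter> mk ` idx2" mk idx2] by auto
    define Q' where "Q' = fst ` T1 \<union> fst ` T2"
    \<comment> \<open>Only the parameters from \<open>B\<close> are cut down to the finitely many
      that occur; those from \<open>P\<close> are fixed by every admissible
      \<open>\<beta>\<close>.\<close>
    define B' where "B' = {x \<in> B. par x \<in> (\<Union>(\<tau>, \<phi>, s)\<in>T2. s ` cond_fv S \<phi>)}"
    have "Q' \<subseteq> Q" "finite Q'" using T1 T2 by (auto simp: Q'_def idx1_def idx2_def)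
    moreover have "finite (\<Union>(\<tau>, \<phi>, s)\<in>T2. s ` cond_fv S \<phi>)"
      using T2(1,2) finite_fv by (fastforce simp: idx2_def)
    then have "finite (par -` (\<Union>(\<tau>, \<phi>, s)\<in>T2. s ` cond_fv S \<phi>))"
      by (rule finite_vimageI) (simp add: par_def)
    then have "finite B'" by (rule rev_finite_subset) (auto simp: B'_def)
    moreover have "B' \<subseteq> B" by (auto simp: B'_def)
    ultimately obtain f where f: "good Q' B' f" using fin by blast
    then have fG: "f \<in> G" by (simp add: good_def)
    have "\<forall>\<tau>\<in>Q'. \<exists>u. \<exists>\<beta>. u \<in> fixing N \<and> \<beta> \<in> fixing (P \<union> B') \<and> (\<forall>x\<in>N. f (u (\<tau> x)) = \<beta> (f x))"
      using f unfolding good_def by blast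
    then obtain u \<beta> where u: "\<And>\<tau>. \<tau> \<in> Q' \<Longrightarrow> u \<tau> \<in> fixing N"
      and \<beta>: "\<And>\<tau>. \<tau> \<in> Q' \<Longrightarrow> \<beta> \<tau> \<in> fixing (P \<union> B')"
      and f_eq: "\<And>\<tau> x. \<tau> \<in> Q' \<Longrightarrow> x \<in> N \<Longrightarrow> f (u \<tau> (\<tau> x)) = \<beta> \<tau> (f x)"
      by metis
    define h where "h = val f (\<lambda>\<tau> x. f (u \<tau> (\<tau> x)))"
    have "cond_holds S (h \<circ> snd p) (fst p)" if p: "p \<in> \<Sigma>'" for p
    proof -
      consider "p \<in> \<Sigma>0" | "p \<in> \<Sigma>3" | "p \<in> snd ` idx1" | "p \<in> mk ` idx2"
        using p \<Sigma>'(1) unfolding \<Sigma>_def by blast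
      then show ?thesis
      proof cases
        case 1
        then have p0: "fst p \<in> conds S" "snd p ` cond_fv S (fst p) \<subseteq> J0"
            "cond_holds S (h0 \<circ> snd p) (fst p)"
          by (auto simp: \<Sigma>0_def)
        have "h j = f (h0 j)" if "j \<in> J0" for j using that by (auto simp: J0_def h_def h0_def val)
        then have "cond_holds S (h \<circ> snd p) (fst p) \<longleftrightarrow> cond_holds S (f \<circ> (h0 \<circ> snd p)) (fst p)"
          using p0(2) by (intro holds_cong[OF p0(1)]) auto
        then show ?thesis using p0 holds_aut[OF G_aut[OF fG]] by blast
      next
        case 2
        then obtain q where q: "q \<in> \<Gamma>" "p = (fst q, emb \<circ> snd q)" by (auto simp: \<Sigma>3_def)
        have "h \<circ> emb = case_sum id f" by (auto simp: h_def val_emb)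
        then have "h \<circ> snd p = case_sum id f \<circ> snd q" by (simp add: q(2) flip: comp_assoc)
        then show ?thesis using fG q by (auto simp: G_def satisfies_def)
      next
        case 3
        then obtain \<tau> where \<tau>: "(\<tau>, p) \<in> T1" using p T1(3) by (metis IntI imageE prod.collapse)
        then have "(\<tau>, p) \<in> idx1" using T1(1) by blast
        then have p0: "fst p \<in> conds S" "snd p ` cond_fv S (fst p) \<subseteq> J1 \<tau>"
            "cond_holds S (h0 \<circ> snd p) (fst p)"
          by (auto simp: idx1_def)
        have \<tau>Q: "\<tau> \<in> Q'" using \<tau> by (force simp: Q'_def)
        have "h j = (f \<circ> u \<tau>) (h0 j)" if "j \<in> J1 \<tau>" for j
          using that fixing_eq[OF u[OF \<tau>Q]] by (auto simp: J1_def h_def h0_def val)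
        then have "cond_holds S (h \<circ> snd p) (fst p) \<longleftrightarrow>
            cond_holds S ((f \<circ> u \<tau>) \<circ> (h0 \<circ> snd p)) (fst p)"
          using p0(2) by (intro holds_cong[OF p0(1)]) auto
        then show ?thesis
          using p0 holds_aut[OF comp_aut[OF G_aut[OF fG] fixing_aut[OF u[OF \<tau>Q]]]] by blast
      next
        case 4
        then obtain \<tau> \<phi> s where i: "(\<tau>, \<phi>, s) \<in> T2" "p = mk (\<tau>, \<phi>, s)" using p T2(3) by force
        have \<tau>Q: "\<tau> \<in> Q'" using i(1) by (force simp: Q'_def)
        have idx: "(\<tau>, \<phi>, s) \<in> idx2" using i(1) T2(1) by blast
        show ?thesis unfolding i(2)
        proof (rule iff_forI[OF mk[OF idx] fixing_aut[OF \<beta>[OF \<tau>Q]]])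
          fix n assume n: "n \<in> cond_fv S \<phi>"
          then have sn: "s n \<in> J2" using idx by (auto simp: idx2_def)
          show "h ((sw \<tau> \<circ> s) n) = \<beta> \<tau> (h (s n))"
          proof (cases "s n \<in> ev ` N")
            case True
            then obtain x where "x \<in> N" "s n = ev x" by blast
            then show ?thesis using f_eq[OF \<tau>Q] by (simp add: sw h_def val)
          next
            case False
            then obtain x where x: "x \<in> P \<union> B" "s n = par x" using sn by (auto simp: J2_def)
            have "par x \<in> (\<Union>(\<tau>, \<phi>, s)\<in>T2. s ` cond_fv S \<phi>)"
              unfolding x(2)[symmetric] by (intro UN_I[OF i(1)]) (use n in simp)
            then have "x \<in> P \<union> B'" using x(1) by (simp add: B'_def)
            then show ?thesis using x(2) fixing_eq[OF \<beta>[OF \<tau>Q]] by (simp add: sw h_def val)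
          qed
        qed
      qed
    qed
    then have "satisfies h \<Sigma>'" by (auto simp: satisfies_def)
    moreover have "\<forall>j\<in>range par. h j = val id (\<lambda>\<tau>. \<tau>) j" by (auto simp: h_def val)
    ultimately show "\<exists>h. (\<forall>j\<in>range par. h j = val id (\<lambda>\<tau>. \<tau>) j) \<and> satisfies h \<Sigma>'" by blast
  qed
  then obtain h where h: "\<And>x. h (par x) = x" "satisfies h \<Sigma>" by (auto simp: val)
  have sat: "cond_holds S (h \<circ> snd p) (fst p)" if "p \<in> \<Sigma>" for p
    using h(2) that by (auto simp: satisfies_def)
  have "\<exists>f\<in>auts S. \<forall>j\<in>J0. f (h0 j) = h j"
  proof (rule homogeneity[OF smallJ(1)])
    fix \<phi> s assume "\<phi> \<in> conds S" "s ` cond_fv S \<phi> \<subseteq> J0" "cond_holds S (h0 \<circ> s) \<phi>"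
    then have "(\<phi>, s) \<in> \<Sigma>" by (simp add: \<Sigma>_def \<Sigma>0_def)
    then show "cond_holds S (h \<circ> s) \<phi>" using sat[of "(\<phi>, s)"] by simp
  qed
  then obtain f where f: "f \<in> auts S" "\<And>x. x \<in> N \<Longrightarrow> f x = h (ev x)"
    by (auto simp: J0_def h0_def val)
  have fG: "f \<in> G"
  proof -
    have "satisfies (h \<circ> emb) \<Gamma>"
      unfolding satisfies_def using sat by (force simp: \<Sigma>_def \<Sigma>3_def comp_assoc)
    moreover have "(h \<circ> emb) j = case_sum id f j" if "j \<in> vars \<Gamma>" for j
      using subsetD[OF \<Gamma>_vars that] h(1) f(2) P_N by (auto simp: emb_def)
    ultimately have "satisfies (case_sum id f) \<Gamma>" using satisfies_cong[OF \<Gamma>_conds] by blast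
    then show ?thesis using f(1) by (simp add: G_def)
  qed
  have "\<exists>u\<in>fixing N. \<exists>\<beta>\<in>fixing (P \<union> B). \<forall>x\<in>N. f (u (\<tau> x)) = \<beta> (f x)" if \<tau>: "\<tau> \<in> Q" for \<tau>
  proof -
    have "\<exists>g\<in>auts S. \<forall>j\<in>J1 \<tau>. g (h0 j) = h j"
    proof (rule homogeneity[OF smallJ(2)])
      fix \<phi> s assume "\<phi> \<in> conds S" "s ` cond_fv S \<phi> \<subseteq> J1 \<tau>" "cond_holds S (h0 \<circ> s) \<phi>"
      then have "(\<tau>, \<phi>, s) \<in> idx1" using \<tau> by (simp add: idx1_def)
      then have "(\<phi>, s) \<in> \<Sigma>" by (force simp: \<Sigma>_def)
      then show "cond_holds S (h \<circ> s) \<phi>" using sat[of "(\<phi>, s)"] by simp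
    qed
    then obtain g where g1: "g \<in> auts S" "\<And>j. j \<in> J1 \<tau> \<Longrightarrow> g (h0 j) = h j" by blast
    have g: "g \<in> auts S" "\<And>x. x \<in> N \<Longrightarrow> g x = h (ev x)" "\<And>x. x \<in> N \<Longrightarrow> g (\<tau> x) = h (ew \<tau> x)"
      using g1(1) g1(2)[of "ev _"] g1(2)[of "ew \<tau> _"] by (simp_all add: J1_def h0_def val)
    have "\<exists>\<beta>\<in>auts S. \<forall>j\<in>J2. \<beta> (h j) = (h \<circ> sw \<tau>) j"
    proof (rule homogeneity[OF smallJ(3)])
      fix \<phi> s assume \<phi>: "\<phi> \<in> conds S" "s ` cond_fv S \<phi> \<subseteq> J2" "cond_holds S (h \<circ> s) \<phi>"
      then have i: "(\<tau>, \<phi>, s) \<in> idx2" using \<tau> by (simp add: idx2_def)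
      then have "mk (\<tau>, \<phi>, s) \<in> \<Sigma>" by (simp add: \<Sigma>_def)
      then show "cond_holds S (h \<circ> sw \<tau> \<circ> s) \<phi>"
        using iff_forD[OF mk[OF i] sat] \<phi>(3) by (simp add: comp_assoc)
    qed
    then obtain \<beta> where \<beta>: "\<beta> \<in> auts S" "\<And>j. j \<in> J2 \<Longrightarrow> \<beta> (h j) = h (sw \<tau> j)" by auto
    have "\<beta> \<in> fixing (P \<union> B)"
    proof (rule fixingI[OF \<beta>(1)])
      show "\<beta> x = x" if "x \<in> P \<union> B" for x
        using \<beta>(2)[of "par x"] that h(1) by (simp add: J2_def sw)
    qed
    \<comment> \<open>\<open>g\<close> and \<open>f\<close> send \<open>N\<close> to the same
      solution, so they differ by an element of the stabiliser of \<open>N\<close>, which is the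
      required \<open>u\<close>.\<close>
    moreover have "inv f \<circ> g \<in> fixing N"
    proof (rule fixingI)
      show "inv f \<circ> g \<in> auts S" using comp_aut[OF inv_aut[OF f(1)] g(1)] .
      fix x assume "x \<in> N"
      then have "g x = f x" using f(2) g(2) by simp
      then show "(inv f \<circ> g) x = x" using f(1) by simp
    qed
    moreover have "\<forall>x\<in>N. f ((inv f \<circ> g) (\<tau> x)) = \<beta> (f x)"
    proof
      fix x assume x: "x \<in> N"
      have "\<beta> (h (ev x)) = h (ew \<tau> x)" using \<beta>(2)[of "ev x"] x by (simp add: J2_def sw)
      then show "f ((inv f \<circ> g) (\<tau> x)) = \<beta> (f x)" using f g(3) x by simp
    qed
    ultimately show ?thesis by blast
  qed
  then have "good Q B f" using fG by (simp add: good_def)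
  then show ?thesis by blast
qed

text \<open>\<open>Q\<close> may be large, but its members fall into few double cosets, and goodness
  for representatives is enough.\<close>

lemma good_compact:
  assumes Q: "Q \<subseteq> G" and B: "small \<kappa> B"
    and fin: "\<And>Q' B'. Q' \<subseteq> Q \<Longrightarrow> finite Q' \<Longrightarrow> finite B' \<Longrightarrow> \<exists>f. good Q' B' f"
  shows "\<exists>f. good Q B f"
proof -
  have "Q \<subseteq> auts S" using Q G_aut by blast
  then obtain R where R: "R \<subseteq> Q" "small \<kappa> R"
      "\<And>\<tau>. \<tau> \<in> Q \<Longrightarrow> \<exists>r\<in>R. \<exists>v\<in>fixing N. \<forall>x\<in>N. \<tau> x = v (r x)"
    using small_orbits[OF N_small N_small] by blast
  have "\<exists>f. good R B f"
  proof (rule good_compact_small[OF subset_trans[OF R(1) Q] R(2) B])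
    fix Q' and B' :: "'a set" assume "Q' \<subseteq> R" "finite Q'" "finite B'"
    then show "\<exists>f. good Q' B' f" using fin[OF subset_trans[OF _ R(1)]] by blast
  qed
  then show ?thesis using good_representatives[OF _ R(3)] by blast
qed

text \<open>A set \<open>Q\<close> all of whose finite parts can be made good over every finite set is taken
  maximal. If the group \<open>L\<close> generated by \<open>Q\<close> and the stabiliser of \<open>N\<close> had large index, then
  some small \<open>Bs\<close> would confine every good \<open>f\<close> to the small set of cosets of \<open>L\<close> fixed by the
  stabiliser of \<open>Bs\<close>. An \<open>f\<close> that is good over \<open>Bs\<close> and over suitable translates of \<open>Bs\<close> then
  lies in no coset at all.\<close>

theorem small_index:
  obtains Q F where "Q \<subseteq> G" "\<forall>B. small \<kappa> B \<longrightarrow> (\<exists>f. good Q B f)" "F \<subseteq> G" "small \<kappa> F"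
    "\<forall>g\<in>G. \<exists>r\<in>F. \<exists>l\<in>subgrp hull (fixing N \<union> Q). g = r \<circ> l"
proof -
  \<comment> \<open>Finiteness is asked of \<open>B'\<close> as well as of \<open>Q'\<close>, so
    that the obstructions found below are finite and their union stays small for singular
    \<open>\<kappa>\<close>.\<close>
  define Good where "Good Q \<longleftrightarrow> Q \<subseteq> G \<and>
    (\<forall>Q' B'. Q' \<subseteq> Q \<longrightarrow> finite Q' \<longrightarrow> finite B' \<longrightarrow> (\<exists>f. good Q' B' f))" for Q
  note G = subgrpD[OF G_subgrp]
  have "good {} B id" for B using G(1) by (simp add: good_def)
  then have Good_empty: "{} \<in> {Q. Good Q}" by (auto simp: Good_def)
  have Good_Union: "\<Union>\<C> \<in> {Q. Good Q}" if \<C>: "\<C> \<noteq> {}" "subset.chain {Q. Good Q} \<C>" for \<C>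
  proof -
    have Good_mem: "Good Q" if "Q \<in> \<C>" for Q using \<C>(2) that unfolding subset.chain_def by blast
    have "\<exists>f. good Q' B' f" if Q': "Q' \<subseteq> \<Union>\<C>" "finite Q'" "finite B'" for Q' B'
    proof -
      obtain Q where "Q \<in> \<C>" "Q' \<subseteq> Q" using finite_subset_Union_chain[OF Q'(2,1) \<C>] by blast
      then show ?thesis using Good_mem[of Q] Q'(2,3) unfolding Good_def by blast
    qed
    moreover have "\<Union>\<C> \<subseteq> G" using Good_mem unfolding Good_def by blast
    ultimately show ?thesis unfolding Good_def by blast
  qed
  have "\<exists>Q\<in>{Q. Good Q}. \<forall>Q'\<in>{Q. Good Q}. Q \<subseteq> Q' \<longrightarrow> Q' = Q"
    using Good_empty Good_Union by (intro subset_Zorn_nonempty) auto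
  then obtain Q where Q: "Good Q" "\<And>Q'. Good Q' \<Longrightarrow> Q \<subseteq> Q' \<Longrightarrow> Q' = Q" by blast
  have QG: "Q \<subseteq> G" using Q(1) unfolding Good_def by blast
  have good_ex: "\<exists>f. good Q B f" if "small \<kappa> B" for B
  proof (rule good_compact[OF QG that])
    fix Q' and B' :: "'a set" assume "Q' \<subseteq> Q" "finite Q'" "finite B'"
    then show "\<exists>f. good Q' B' f" using Q(1) by (simp add: Good_def)
  qed
  define L where "L = subgrp hull (fixing N \<union> Q)"
  have gens: "fixing N \<subseteq> L" "Q \<subseteq> L" using hull_subset[of "fixing N \<union> Q" subgrp] by (auto simp: L_def)
  have LG: "L \<subseteq> G"
    unfolding L_def using fixing_G[OF P_N] QG G_subgrp by (intro hull_minimal) auto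
  have L_subgrp: "subgrp L" unfolding L_def by (rule subgrp_hull)
  note L = subgrpD[OF L_subgrp]
  have "\<exists>F. F \<subseteq> G \<and> small \<kappa> F \<and> (\<forall>g\<in>G. \<exists>r\<in>F. \<exists>l\<in>L. g = r \<circ> l)"
  proof (rule ccontr)
    assume contra: "\<nexists>F. F \<subseteq> G \<and> small \<kappa> F \<and> (\<forall>g\<in>G. \<exists>r\<in>F. \<exists>l\<in>L. g = r \<circ> l)"
    \<comment> \<open>By maximality no element outside \<open>L\<close> can be adjoined to
      \<open>Q\<close>, and the failure shows over a finite set.\<close>
    have "\<exists>B. finite B \<and> (\<forall>f. \<not> good (insert \<tau> Q) B f)" if \<tau>: "\<tau> \<in> G - L" for \<tau>
    proof (rule ccontr)
      assume none: "\<nexists>B. finite B \<and> (\<forall>f. \<not> good (insert \<tau> Q) B f)"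
      have "\<exists>f. good Q' B' f" if Q': "Q' \<subseteq> insert \<tau> Q" "finite B'" for Q' B'
      proof -
        obtain f where "good (insert \<tau> Q) B' f" using none Q'(2) by blast
        then have "good Q' B' f" using Q'(1) by (rule good_mono) simp
        then show ?thesis by blast
      qed
      then have "Good (insert \<tau> Q)" using \<tau> QG unfolding Good_def by simp
      then have "insert \<tau> Q = Q" using Q(2) by blast
      then show False using \<tau> gens(2) by blast
    qed
    then obtain Bf where Bf: "\<And>\<tau>. \<tau> \<in> G - L \<Longrightarrow> finite (Bf \<tau>)"
        "\<And>\<tau> f. \<tau> \<in> G - L \<Longrightarrow> \<not> good (insert \<tau> Q) (Bf \<tau>) f"
      by metis
    have "G - L \<subseteq> auts S" using G_aut by blast
    then obtain R where R: "R \<subseteq> G - L" "small \<kappa> R"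
        "\<And>\<tau>. \<tau> \<in> G - L \<Longrightarrow> \<exists>r\<in>R. \<exists>v\<in>fixing N. \<forall>x\<in>N. \<tau> x = v (r x)"
      using small_orbits[OF N_small N_small] by blast
    define Bs where "Bs = (\<Union>r\<in>R. Bf r)"
    have Bs: "small \<kappa> Bs" unfolding Bs_def using Bf(1) R(1) by (intro small_UN_finite[OF R(2)]) blast
    \<comment> \<open>The membership in \<open>L\<close> says that \<open>\<beta>\<close> fixes the
      left coset of \<open>L\<close> that contains \<open>f\<close>.\<close>
    define F0 where "F0 = {f \<in> G. \<forall>\<beta>\<in>fixing (P \<union> Bs). inv f \<circ> \<beta> \<circ> f \<in> L}"
    have good_F0: "f \<in> F0" if f: "good Q Bs f" for f
    proof -
      have fG: "f \<in> G" using f by (simp add: good_def)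
      have "inv f \<circ> \<beta> \<circ> f \<in> L" if \<beta>: "\<beta> \<in> fixing (P \<union> Bs)" for \<beta>
      proof (rule ccontr)
        assume notL: "inv f \<circ> \<beta> \<circ> f \<notin> L"
        have "\<beta> \<in> G" using \<beta> fixing_G[of "P \<union> Bs"] by blast
        then have "inv f \<circ> \<beta> \<circ> f \<in> G - L" using fG G notL by blast
        \<comment> \<open>The double coset of this element has a representative \<open>r\<close>
          outside \<open>L\<close>. The same \<open>f\<close> is then good for
          \<open>insert r Q\<close> over \<open>Bf r\<close>, which was excluded.\<close>
        then obtain r v where r: "r \<in> R" "v \<in> fixing N"
            "\<forall>x\<in>N. (inv f \<circ> \<beta> \<circ> f) x = v (r x)"
          using R(3) by blast
        have Bf_Bs: "Bf r \<subseteq> Bs" using r(1) by (auto simp: Bs_def)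
        have "\<forall>x\<in>N. f (v (r x)) = \<beta> (f x)"
        proof
          fix x assume "x \<in> N"
          then have "f (v (r x)) = f ((inv f \<circ> \<beta> \<circ> f) x)" using r(3) by simp
          then show "f (v (r x)) = \<beta> (f x)" using G_aut[OF fG] by simp
        qed
        moreover have "\<beta> \<in> fixing (P \<union> Bf r)"
          using \<beta> Bf_Bs fixing_mono[of "P \<union> Bf r" "P \<union> Bs"] by blast
        ultimately have "\<exists>u\<in>fixing N. \<exists>\<beta>\<in>fixing (P \<union> Bf r). \<forall>x\<in>N. f (u (r x)) = \<beta> (f x)"
          using r(2) by blast
        moreover have "good Q (Bf r) f" using good_mono[OF f subset_refl Bf_Bs] .
        ultimately have "good (insert r Q) (Bf r) f" unfolding good_def by blast
        then show False using Bf(2) r(1) R(1) by blast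
      qed
      then show ?thesis using fG by (simp add: F0_def)
    qed
    have "F0 \<subseteq> auts S" using G_aut by (auto simp: F0_def)
    then obtain R0 where R0: "R0 \<subseteq> F0" "small \<kappa> R0"
        "\<And>f. f \<in> F0 \<Longrightarrow> \<exists>r\<in>R0. \<exists>\<beta>\<in>fixing (P \<union> Bs). \<forall>x\<in>N. f x = \<beta> (r x)"
      using small_orbits[OF small_Un[OF P_small Bs] N_small] by blast
    have F0_R0: "\<exists>r\<in>R0. \<exists>l\<in>L. f = r \<circ> l" if f: "f \<in> F0" for f
    proof -
      obtain r \<beta> where r: "r \<in> R0" "\<beta> \<in> fixing (P \<union> Bs)" "\<forall>x\<in>N. f x = \<beta> (r x)"
        using R0(3)[OF f] by blast
      have auts: "f \<in> auts S" "r \<in> auts S" "\<beta> \<in> auts S"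
        using f r R0(1) G_aut fixing_aut by (auto simp: F0_def)
      \<comment> \<open>On \<open>N\<close> the map \<open>f\<close> agrees with
        \<open>\<beta> \<circ> r\<close>. So \<open>f\<close> is \<open>r\<close> times
        \<open>inv r \<circ> \<beta> \<circ> r\<close> times \<open>w\<close>; the middle factor is
        in \<open>L\<close> because \<open>r\<close> is in \<open>F0\<close>, the last because it
        fixes \<open>N\<close>.\<close>
      define w where "w = inv r \<circ> (inv \<beta> \<circ> f)"
      have "w \<in> fixing N"
      proof (rule fixingI)
        show "w \<in> auts S" unfolding w_def using auts by (intro comp_aut inv_aut)
        show "w x = x" if "x \<in> N" for x using r(3) that auts by (simp add: w_def)
      qed
      then have "w \<in> L" using gens(1) by blast
      moreover have "inv r \<circ> \<beta> \<circ> r \<in> L" using r R0(1) by (auto simp: F0_def)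
      ultimately have "(inv r \<circ> \<beta> \<circ> r) \<circ> w \<in> L" using L(2) by blast
      moreover have "f = r \<circ> ((inv r \<circ> \<beta> \<circ> r) \<circ> w)" using auts by (simp add: w_def fun_eq_iff)
      ultimately show ?thesis using r(1) by blast
    qed
    have R0G: "R0 \<subseteq> G" using R0(1) by (auto simp: F0_def)
    then have "\<not> (\<forall>g\<in>G. \<exists>r\<in>R0. \<exists>l\<in>L. g = r \<circ> l)" using contra R0(2) by simp
    then obtain g where g: "g \<in> G" "\<And>r l. r \<in> R0 \<Longrightarrow> l \<in> L \<Longrightarrow> g \<noteq> r \<circ> l" by blast
    \<comment> \<open>The coset of \<open>f\<close> among those of \<open>R0\<close> is known only
      after \<open>f\<close> has been chosen, so the translates for all \<open>r\<close> in
      \<open>R0\<close> are included beforehand.\<close>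
    define B where "B = Bs \<union> (\<Union>r\<in>R0. inv (g \<circ> inv r) ` (P \<union> Bs))"
    have "small \<kappa> B"
      unfolding B_def
      by (intro small_Un Bs small_UN[OF R0(2) small_Un[OF P_small Bs]] card_of_image)
    then obtain f where f: "good Q B f" using good_ex by blast
    have fG: "f \<in> G" using f by (simp add: good_def)
    have "good Q Bs f" using f by (rule good_mono) (auto simp: B_def)
    then obtain r l where r: "r \<in> R0" "l \<in> L" "f = r \<circ> l" using good_F0 F0_R0 by blast
    define \<sigma> where "\<sigma> = g \<circ> inv r"
    have \<sigma>G: "\<sigma> \<in> G" unfolding \<sigma>_def using g(1) r(1) R0G G by blast
    have \<sigma>: "\<sigma> \<in> auts S" using G_aut[OF \<sigma>G] .
    \<comment> \<open>Conjugating by \<open>\<sigma>\<close> turns an automorphism fixing the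
      translate of \<open>P \<union> Bs\<close> into one that fixes
      \<open>P \<union> Bs\<close>.\<close>
    have "good Q Bs (\<sigma> \<circ> f)" unfolding good_def
    proof (intro conjI ballI)
      show "\<sigma> \<circ> f \<in> G" using \<sigma>G fG G(2) by blast
      fix \<tau> assume "\<tau> \<in> Q"
      then obtain u \<beta> where u: "u \<in> fixing N" "\<beta> \<in> fixing (P \<union> B)" "\<forall>x\<in>N. f (u (\<tau> x)) = \<beta> (f x)"
        using f unfolding good_def by blast
      have "\<sigma> \<circ> (\<beta> \<circ> inv \<sigma>) \<in> fixing (P \<union> Bs)"
      proof (rule fixingI)
        show "\<sigma> \<circ> (\<beta> \<circ> inv \<sigma>) \<in> auts S" using \<sigma> fixing_aut[OF u(2)] by (intro comp_aut inv_aut)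
        fix x assume "x \<in> P \<union> Bs"
        then have "inv \<sigma> x \<in> P \<union> B" using r(1) by (auto simp: B_def \<sigma>_def)
        then show "(\<sigma> \<circ> (\<beta> \<circ> inv \<sigma>)) x = x" using fixing_eq[OF u(2)] \<sigma> by simp
      qed
      moreover have "\<forall>x\<in>N. (\<sigma> \<circ> f) (u (\<tau> x)) = (\<sigma> \<circ> (\<beta> \<circ> inv \<sigma>)) ((\<sigma> \<circ> f) x)"
        using u(3) \<sigma> by simp
      ultimately show "\<exists>u\<in>fixing N. \<exists>\<beta>\<in>fixing (P \<union> Bs). \<forall>x\<in>N. (\<sigma> \<circ> f) (u (\<tau> x)) = \<beta> ((\<sigma> \<circ> f) x)"
        using u(1) by blast
    qed
    then obtain r' l' where r': "r' \<in> R0" "l' \<in> L" "\<sigma> \<circ> f = r' \<circ> l'" using good_F0 F0_R0 by blast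
    have auts: "r \<in> auts S" "l \<in> auts S" using r(1,2) R0G LG G_aut by blast+
    \<comment> \<open>As \<open>f = r \<circ> l\<close>, the map \<open>\<sigma> \<circ> f\<close>
      equals \<open>g \<circ> l\<close>. It lies in a coset represented by \<open>R0\<close>,
      whereas \<open>g\<close> was chosen outside all of these.\<close>
    have "g = \<sigma> \<circ> f \<circ> inv l" using auts by (simp add: \<sigma>_def r(3) fun_eq_iff)
    then have "g = r' \<circ> (l' \<circ> inv l)" unfolding r'(3) by (simp add: comp_assoc)
    then show False using g(2)[OF r'(1)] L r(2) r'(2) by blast
  qed
  then obtain F where F: "F \<subseteq> G" "small \<kappa> F" "\<forall>g\<in>G. \<exists>r\<in>F. \<exists>l\<in>L. g = r \<circ> l" by blast
  have "\<forall>B. small \<kappa> B \<longrightarrow> (\<exists>f. good Q B f)" using good_ex by blast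
  then show thesis by (rule that[OF QG _ F(1,2) F(3)[unfolded L_def]])
qed

end

section \<open>Full existence in a frame\<close>

context monster_frame begin

lemma the_act: "i \<in> dom a \<Longrightarrow> the (act \<sigma> a i) = \<sigma> (the (a i))"
  by (auto simp: act_def)

lemma type_definable_invariant:
  assumes eq: "equiv {a. dom a = I} E" and td: "type_definable S I E"
  shows "invariant_equiv S I E"
proof -
  obtain \<pi> where \<pi>: "\<pi> \<subseteq> {(\<phi>, s). \<phi> \<in> conds S \<and> s ` cond_fv S \<phi> \<subseteq> I <+> I}"
    and E: "E = {(a, b). dom a = I \<and> dom b = I \<and>
      (\<forall>(\<phi>, s)\<in>\<pi>. cond_holds S (case_sum (the \<circ> a) (the \<circ> b) \<circ> s) \<phi>)}"
    using td unfolding type_definable_def by blast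
  have "(a, b) \<in> E \<longleftrightarrow> (act \<sigma> a, act \<sigma> b) \<in> E"
    if ab: "dom a = I" "dom b = I" and \<sigma>: "\<sigma> \<in> auts S" for a b \<sigma>
  proof -
    have "cond_holds S (case_sum (the \<circ> act \<sigma> a) (the \<circ> act \<sigma> b) \<circ> s) \<phi> \<longleftrightarrow>
        cond_holds S (case_sum (the \<circ> a) (the \<circ> b) \<circ> s) \<phi>" if "(\<phi>, s) \<in> \<pi>" for \<phi> s
    proof -
      have \<phi>: "\<phi> \<in> conds S" "s ` cond_fv S \<phi> \<subseteq> I <+> I" using \<pi> that by auto
      have "case_sum (the \<circ> act \<sigma> a) (the \<circ> act \<sigma> b) j = \<sigma> (case_sum (the \<circ> a) (the \<circ> b) j)"
        if "j \<in> I <+> I" for j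
        using that ab by (elim PlusE) (simp_all add: the_act)
      then have "cond_holds S (case_sum (the \<circ> act \<sigma> a) (the \<circ> act \<sigma> b) \<circ> s) \<phi> \<longleftrightarrow>
          cond_holds S (\<sigma> \<circ> (case_sum (the \<circ> a) (the \<circ> b) \<circ> s)) \<phi>"
        using \<phi>(2) by (intro holds_cong[OF \<phi>(1)]) auto
      then show ?thesis using holds_aut[OF \<sigma> \<phi>(1)] by simp
    qed
    then show ?thesis unfolding E using ab by (auto simp: dom_act)
  qed
  then show ?thesis using eq unfolding invariant_equiv_def by blast
qed

lemma subgrp_auts_over: "subgrp (auts_over S C)"
  unfolding subgrp_def
proof (intro conjI ballI)
  show "id \<in> auts_over S C" by (simp add: auts_over_def id_aut act_id)
  show "\<sigma> \<circ> \<tau> \<in> auts_over S C" if "\<sigma> \<in> auts_over S C" "\<tau> \<in> auts_over S C" for \<sigma> \<tau>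
    using that by (simp add: auts_over_def comp_aut act_comp_image)
  show "inv \<sigma> \<in> auts_over S C" if \<sigma>: "\<sigma> \<in> auts_over S C" for \<sigma>
  proof -
    have aut: "\<sigma> \<in> auts S" using \<sigma> by (simp add: auts_over_def)
    have "act (inv \<sigma>) ` X = X" if "X \<in> C" for X
    proof -
      have "act (inv \<sigma>) ` X = act (inv \<sigma>) ` act \<sigma> ` X" using \<sigma> that by (simp add: auts_over_def)
      then show ?thesis using aut by (simp flip: act_comp_image add: act_id)
    qed
    then show ?thesis using aut by (simp add: auts_over_def inv_aut)
  qed
qed

lemma auts_over_mono: "C \<subseteq> C' \<Longrightarrow> auts_over S C' \<subseteq> auts_over S C"
  by (auto simp: auts_over_def)

lemma bddu_mono:
  assumes "C \<subseteq> C'"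
  shows "bddu \<kappa> S C \<subseteq> bddu \<kappa> S C'"
  using small_subset[OF image_mono[OF auts_over_mono[OF assms]]] by (auto simp: bddu_def)

lemma elementary_image:
  assumes N: "elementary N" and f: "f \<in> auts S"
  shows "elementary (f ` N)"
  unfolding elementary_def
proof (intro ballI allI impI)
  fix \<phi> e x assume \<phi>: "\<phi> \<in> conds S" and e: "e ` (cond_fv S \<phi> - {0}) \<subseteq> f ` N"
    and x: "cond_holds S (e(0 := x)) \<phi>"
  have upd: "inv f \<circ> e(0 := z) = (inv f \<circ> e)(0 := inv f z)" for z by (auto simp: fun_eq_iff)
  have "(inv f \<circ> e) n \<in> N" if "n \<in> cond_fv S \<phi> - {0}" for n
  proof -
    have "e n \<in> f ` N" using e that by blast
    then show ?thesis using f by auto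
  qed
  then have "(inv f \<circ> e) ` (cond_fv S \<phi> - {0}) \<subseteq> N" by blast
  moreover have "cond_holds S ((inv f \<circ> e)(0 := inv f x)) \<phi>"
    using x holds_aut[OF inv_aut[OF f] \<phi>, of "e(0 := x)"] by (simp add: upd)
  ultimately obtain y where y: "y \<in> N" "cond_holds S ((inv f \<circ> e)(0 := y)) \<phi>"
    using N \<phi> unfolding elementary_def by meson
  have "f \<circ> (inv f \<circ> e)(0 := y) = e(0 := f y)" using f by (auto simp: fun_eq_iff)
  then have "cond_holds S (e(0 := f y)) \<phi>" using y(2) holds_aut[OF f \<phi>] by metis
  then show "\<exists>y\<in>f ` N. cond_holds S (e(0 := y)) \<phi>" using y(1) by blast
qed

text \<open>An automorphism fixes a class iff it moves a representative to an equivalent tuple,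
  which is a system of conditions on that tuple and its image. \<open>P\<close> collects the entries
  of chosen representatives; it is small because the disjoint union of the index sets is.\<close>

lemma hyperimaginary_set_group:
  assumes "hyperimaginary_set \<kappa> S A"
  obtains P \<Gamma> where "small \<kappa> P" "fst ` \<Gamma> \<subseteq> conds S" "vars \<Gamma> \<subseteq> P <+> P"
    "auts_over S A = {\<sigma> \<in> auts S. satisfies (case_sum id \<sigma>) \<Gamma>}"
proof -
  define rep where "rep X a \<pi> \<longleftrightarrow>
     a \<in> X \<and> \<pi> \<subseteq> {(\<phi>, s). \<phi> \<in> conds S \<and> s ` cond_fv S \<phi> \<subseteq> dom a <+> dom a} \<and>
     (\<forall>\<sigma>\<in>auts S. act \<sigma> ` X = X \<longleftrightarrow>
       (\<forall>(\<phi>, s)\<in>\<pi>. cond_holds S (case_sum (the \<circ> a) (the \<circ> act \<sigma> a) \<circ> s) \<phi>))"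
    for X :: "('i, 'a) tuple set" and a :: "('i, 'a) tuple" and \<pi>
  have "\<forall>X\<in>A. \<exists>a \<pi>. rep X a \<pi>"
  proof
    fix X assume "X \<in> A"
    then obtain I E a where E: "equiv {a. dom a = I} E" "type_definable S I E" "dom a = I"
        "X = E `` {a}"
      using assms unfolding hyperimaginary_set_def hyperimaginary_def by blast
    obtain \<pi> where \<pi>: "\<pi> \<subseteq> {(\<phi>, s). \<phi> \<in> conds S \<and> s ` cond_fv S \<phi> \<subseteq> I <+> I}"
      and E_eq: "E = {(a, b). dom a = I \<and> dom b = I \<and>
        (\<forall>(\<phi>, s)\<in>\<pi>. cond_holds S (case_sum (the \<circ> a) (the \<circ> b) \<circ> s) \<phi>)}"
      using E(2) unfolding type_definable_def by blast
    have "a \<in> X" using equiv_class_self[OF E(1), of a] E(3,4) by simp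
    moreover have "act \<sigma> ` X = X \<longleftrightarrow>
        (\<forall>(\<phi>, s)\<in>\<pi>. cond_holds S (case_sum (the \<circ> a) (the \<circ> act \<sigma> a) \<circ> s) \<phi>)" if "\<sigma> \<in> auts S" for \<sigma>
      unfolding E(4) class_fixed_iff[OF type_definable_invariant[OF E(1,2)] E(3) that]
      by (subst E_eq) (simp add: E(3) dom_act)
    ultimately have "rep X a \<pi>" unfolding rep_def using \<pi> E(3) by simp
    then show "\<exists>a \<pi>. rep X a \<pi>" by blast
  qed
  then obtain a \<pi> where rep: "\<And>X. X \<in> A \<Longrightarrow> rep X (a X) (\<pi> X)" by metis
  have a: "a X \<in> X"
    and \<pi>: "\<pi> X \<subseteq> {(\<phi>, s). \<phi> \<in> conds S \<and> s ` cond_fv S \<phi> \<subseteq> dom (a X) <+> dom (a X)}"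
    and fix_iff: "\<sigma> \<in> auts S \<Longrightarrow> act \<sigma> ` X = X \<longleftrightarrow>
      (\<forall>(\<phi>, s)\<in>\<pi> X. cond_holds S (case_sum (the \<circ> a X) (the \<circ> act \<sigma> (a X)) \<circ> s) \<phi>)"
    if "X \<in> A" for X \<sigma>
    using rep[OF that] unfolding rep_def by simp_all
  define P where "P = (\<Union>X\<in>A. ran (a X))"
  \<comment> \<open>Translates coordinates of the representative into the elements at these
    coordinates, the form in which \<open>\<Gamma>\<close> is stated.\<close>
  define m where "m X = (map_sum (the \<circ> a X) (the \<circ> a X) :: 'i + 'i \<Rightarrow> 'a + 'a)" for X
  define \<Gamma> where "\<Gamma> = (\<Union>X\<in>A. (\<lambda>p. (fst p, m X \<circ> snd p)) ` \<pi> X)"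
  have "P \<subseteq> (\<lambda>(X, i). the (a X i)) ` (SIGMA X:A. \<Union>a\<in>X. dom a)"
  proof
    fix x assume "x \<in> P"
    then obtain X i where X: "X \<in> A" "a X i = Some x" by (auto simp: P_def ran_def)
    then have "(X, i) \<in> (SIGMA X:A. \<Union>a\<in>X. dom a)" using a[OF X(1)] by blast
    moreover have "x = the (a X i)" using X(2) by simp
    ultimately show "x \<in> (\<lambda>(X, i). the (a X i)) ` (SIGMA X:A. \<Union>a\<in>X. dom a)"
      by (intro image_eqI[of _ _ "(X, i)"]) simp_all
  qed
  then have "small \<kappa> P"
    by (rule small_subset[OF _ small_image]) (use assms in \<open>simp add: hyperimaginary_set_def\<close>)
  moreover have "fst ` \<Gamma> \<subseteq> conds S"
  proof
    fix x assume "x \<in> fst ` \<Gamma>"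
    then obtain X p where "X \<in> A" "p \<in> \<pi> X" "x = fst p" by (auto simp: \<Gamma>_def)
    then show "x \<in> conds S" using \<pi>[of X] by auto
  qed
  moreover have "vars \<Gamma> \<subseteq> P <+> P"
  proof
    fix j assume "j \<in> vars \<Gamma>"
    then obtain X p n where X: "X \<in> A" and p: "p \<in> \<pi> X" and n: "n \<in> cond_fv S (fst p)"
        "j = m X (snd p n)"
      by (auto simp: vars_def \<Gamma>_def)
    have "snd p ` cond_fv S (fst p) \<subseteq> dom (a X) <+> dom (a X)"
      using subsetD[OF \<pi>[OF X] p] by (simp add: case_prod_unfold)
    then have "snd p n \<in> dom (a X) <+> dom (a X)" using n(1) by blast
    then show "j \<in> P <+> P"
      using X n(2) by (auto simp: m_def P_def intro!: ranI)
  qed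
  moreover have "auts_over S A = {\<sigma> \<in> auts S. satisfies (case_sum id \<sigma>) \<Gamma>}"
  proof -
    have "(\<forall>X\<in>A. act \<sigma> ` X = X) \<longleftrightarrow> satisfies (case_sum id \<sigma>) \<Gamma>" if \<sigma>: "\<sigma> \<in> auts S" for \<sigma>
    proof -
      have "cond_holds S (case_sum (the \<circ> a X) (the \<circ> act \<sigma> (a X)) \<circ> snd p) (fst p) \<longleftrightarrow>
          cond_holds S (case_sum id \<sigma> \<circ> (m X \<circ> snd p)) (fst p)" if X: "X \<in> A" and p: "p \<in> \<pi> X" for X p
      proof -
        have p': "fst p \<in> conds S" "snd p ` cond_fv S (fst p) \<subseteq> dom (a X) <+> dom (a X)"
          using subsetD[OF \<pi>[OF X] p] by (simp_all add: case_prod_unfold)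
        have "case_sum (the \<circ> a X) (the \<circ> act \<sigma> (a X)) j = case_sum id \<sigma> (m X j)"
          if "j \<in> dom (a X) <+> dom (a X)" for j
          using that by (elim PlusE) (simp_all add: m_def the_act)
        then show ?thesis using p'(2) by (intro holds_cong[OF p'(1)]) auto
      qed
      then show ?thesis
        using fix_iff[OF _ \<sigma>] by (simp add: satisfies_def \<Gamma>_def case_prod_unfold)
    qed
    then show ?thesis unfolding auts_over_def by blast
  qed
  ultimately show thesis by (rule that)
qed

theorem bu_existence:
  assumes A: "hyperimaginary_set \<kappa> S A" and b: "real_tuple \<kappa> b" and c: "real_tuple \<kappa> c"
  shows "\<exists>b'. real_tuple \<kappa> b' \<and> conjugate_over S A b b' \<and> bu_indep \<kappa> S A b' c"
proof -
  obtain P \<Gamma> where P: "small \<kappa> P" and \<Gamma>: "fst ` \<Gamma> \<subseteq> conds S" "vars \<Gamma> \<subseteq> P <+> P"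
    "auts_over S A = {\<sigma> \<in> auts S. satisfies (case_sum id \<sigma>) \<Gamma>}"
    by (rule hyperimaginary_set_group[OF A])
  have small_ran: "small \<kappa> (ran d)" if "real_tuple \<kappa> d" for d :: "('i, 'a) tuple"
  proof -
    have "ran d \<subseteq> (the \<circ> d) ` dom d" by (force simp: ran_def image_iff)
    then show ?thesis
      by (rule small_subset) (use that in \<open>intro small_image, simp add: real_tuple_def\<close>)
  qed
  obtain N where N: "small \<kappa> N" "P \<union> ran b \<subseteq> N" "elementary N"
    by (rule elementary_hull[OF small_Un[OF P small_ran[OF b]]])
  obtain C where C: "small \<kappa> C" "P \<union> ran c \<subseteq> C" "elementary C"
    by (rule elementary_hull[OF small_Un[OF P small_ran[OF c]]])
  interpret type_definable_group \<kappa> S "auts_over S A" P N \<Gamma>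
    by unfold_locales (rule subgrp_auts_over \<Gamma> N(1) | use N(2) in blast)+
  note G = subgrpD[OF G_subgrp]
  obtain Q F where Q: "Q \<subseteq> auts_over S A" "\<forall>B. small \<kappa> B \<longrightarrow> (\<exists>f. good Q B f)"
    and F: "F \<subseteq> auts_over S A" "small \<kappa> F"
      "\<forall>g\<in>auts_over S A. \<exists>r\<in>F. \<exists>l\<in>subgrp hull (fixing N \<union> Q). g = r \<circ> l"
    by (rule small_index)
  obtain f where f: "good Q C f" using Q(2) C(1) by blast
  have fG: "f \<in> auts_over S A" using f by (simp add: good_def)
  have fa: "f \<in> auts S" using G_aut[OF fG] .
  let ?b = "act f b"
  have fixC: "fixing C \<subseteq> auts_over S (insert {c} A)"
  proof
    fix \<sigma> assume \<sigma>: "\<sigma> \<in> fixing C"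
    have "act \<sigma> c = act id c" using fixing_eq[OF \<sigma>] C(2) by (intro act_cong) auto
    moreover have "\<sigma> \<in> auts_over S A" using \<sigma> fixing_G C(2) by blast
    ultimately show "\<sigma> \<in> auts_over S (insert {c} A)" by (simp add: auts_over_def act_id)
  qed
  have conj_fix: "inv f \<circ> \<sigma> \<circ> f \<in> fixing N" if "\<sigma> \<in> fixing (f ` N)" for \<sigma>
    using that fa by (intro fixingI comp_aut inv_aut) (auto simp: fixing_def)
  have fixN: "fixing (f ` N) \<subseteq> auts_over S (insert {?b} A)"
  proof
    fix \<sigma> assume \<sigma>: "\<sigma> \<in> fixing (f ` N)"
    have "act (\<sigma> \<circ> f) b = act f b"
      using fixing_eq[OF \<sigma>] N(2) by (intro act_cong) auto
    moreover have "inv f \<circ> \<sigma> \<circ> f \<in> auts_over S A" using conj_fix[OF \<sigma>] fixing_G[OF P_N] by blast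
    then have "f \<circ> (inv f \<circ> \<sigma> \<circ> f) \<circ> inv f \<in> auts_over S A" by (rule G(2)[OF G(2)[OF fG] G(3)[OF fG]])
    moreover have "f \<circ> (inv f \<circ> \<sigma> \<circ> f) \<circ> inv f = \<sigma>" using fa by (simp add: fun_eq_iff)
    ultimately show "\<sigma> \<in> auts_over S (insert {?b} A)"
      by (simp add: auts_over_def act_comp)
  qed
  have "X \<in> bddu \<kappa> S A"
    if Xb: "X \<in> bddu \<kappa> S (insert {?b} A)" and Xc: "X \<in> bddu \<kappa> S (insert {c} A)" for X
  proof -
    define Y where "Y = act (inv f) ` X"
    have XY: "act f ` Y = X" using fa by (simp add: Y_def act_id flip: act_comp_image)
    define St where "St = {l \<in> auts S. act l ` Y = Y}"
    have St_eq: "St = auts_over S {Y}" by (simp add: St_def auts_over_def)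
    have St_subgrp: "subgrp St" unfolding St_eq by (rule subgrp_auts_over)
    note St = subgrpD[OF St_subgrp]
    have conj: "inv f \<circ> \<sigma> \<circ> f \<in> St" if "act \<sigma> ` X = X" "\<sigma> \<in> auts S" for \<sigma>
      using that fa by (simp add: St_def act_comp_image XY comp_aut inv_aut) (simp add: Y_def)
    have NSt: "fixing N \<subseteq> St"
    proof
      fix l assume l: "l \<in> fixing N"
      have "f \<circ> l \<circ> inv f \<in> fixing (f ` N)"
        using l fa fixing_aut[OF l] by (intro fixingI comp_aut inv_aut) (auto dest: fixing_eq)
      then have "act (f \<circ> l \<circ> inv f) ` X = X" "f \<circ> l \<circ> inv f \<in> auts S"
        using fixing_bddu[OF elementary_image[OF N(3) fa] small_image[OF N(1)] fixN Xb]
          fixing_aut by blast+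
      then have "inv f \<circ> (f \<circ> l \<circ> inv f) \<circ> f \<in> St" by (rule conj)
      moreover have "inv f \<circ> (f \<circ> l \<circ> inv f) \<circ> f = l" using fa by (simp add: fun_eq_iff)
      ultimately show "l \<in> St" by simp
    qed
    have QSt: "Q \<subseteq> St"
    proof
      fix \<tau> assume \<tau>: "\<tau> \<in> Q"
      then obtain u \<beta> where u: "u \<in> fixing N" "\<beta> \<in> fixing (P \<union> C)" "\<forall>x\<in>N. f (u (\<tau> x)) = \<beta> (f x)"
        using f unfolding good_def by blast
      have "\<beta> \<in> fixing C" using u(2) fixing_mono[of C "P \<union> C"] by blast
      then have "act \<beta> ` X = X" "\<beta> \<in> auts S"
        using fixing_bddu[OF C(3,1) fixC Xc] fixing_aut by blast+
      then have "inv f \<circ> \<beta> \<circ> f \<in> St" by (rule conj)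
      moreover define k where "k = inv f \<circ> \<beta> \<circ> f"
      ultimately have k: "k \<in> St" "\<And>x. k x = inv f (\<beta> (f x))" by simp_all
      have auts: "\<tau> \<in> auts S" "u \<in> auts S" "k \<in> auts S"
        using \<tau> Q(1) G_aut u(1) fixing_aut k(1) by (auto simp: St_def)
      \<comment> \<open>Goodness says that \<open>u \<circ> \<tau>\<close> and \<open>k\<close>
        agree on \<open>N\<close>. So \<open>\<tau>\<close> is the product of \<open>inv u\<close>,
        \<open>k\<close> and \<open>w\<close>, each of which fixes \<open>Y\<close>.\<close>
      define w where "w = inv k \<circ> (u \<circ> \<tau>)"
      have "w \<in> fixing N"
      proof (rule fixingI)
        show "w \<in> auts S" unfolding w_def using auts by (intro comp_aut inv_aut)
        fix x assume "x \<in> N"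
        then have "inv f (f (u (\<tau> x))) = k x" using u(3) k(2) by simp
        then have "u (\<tau> x) = k x" using fa by simp
        then show "w x = x" using auts(3) by (simp add: w_def)
      qed
      then have "inv u \<circ> (k \<circ> w) \<in> St"
        by (intro St(2) St(3) k(1) subsetD[OF NSt] u(1))
      moreover have "inv u \<circ> (k \<circ> w) = \<tau>" using auts by (simp add: w_def fun_eq_iff)
      ultimately show "\<tau> \<in> St" by simp
    qed
    have "subgrp hull (fixing N \<union> Q) \<subseteq> St" using NSt QSt St_subgrp by (intro hull_minimal) auto
    \<comment> \<open>Writing \<open>g \<circ> f = r \<circ> l\<close> with \<open>l\<close> fixing
      \<open>Y\<close>, the image of \<open>X\<close> under \<open>g\<close> is the image of
      \<open>Y\<close> under \<open>r\<close>, which leaves only as many conjugates as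
      \<open>F\<close> has members.\<close>
    have "act g ` X \<in> (\<lambda>r. act r ` Y) ` F" if "g \<in> auts_over S A" for g
    proof -
      have "g \<circ> f \<in> auts_over S A" using G(2)[OF that fG] .
      then obtain r l where r: "r \<in> F" "l \<in> subgrp hull (fixing N \<union> Q)" "g \<circ> f = r \<circ> l"
        using F(3) by blast
      then have "act l ` Y = Y"
        using \<open>subgrp hull (fixing N \<union> Q) \<subseteq> St\<close> by (auto simp: St_def)
      then have "act g ` X = act r ` Y"
        unfolding XY[symmetric] act_comp_image[symmetric] r(3) by (simp add: act_comp_image)
      then show ?thesis using r(1) by blast
    qed
    then have "(\<lambda>\<sigma>. act \<sigma> ` X) ` auts_over S A \<subseteq> (\<lambda>r. act r ` Y) ` F" by blast
    then have "small \<kappa> ((\<lambda>\<sigma>. act \<sigma> ` X) ` auts_over S A)"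
      by (rule small_subset[OF _ small_image[OF F(2)]])
    then show ?thesis using Xb by (simp add: bddu_def)
  qed
  then have "bu_indep \<kappa> S A ?b c"
    unfolding bu_indep_def using bddu_mono[OF subset_insertI] by blast
  moreover have "real_tuple \<kappa> ?b" using b by (simp add: real_tuple_def dom_act)
  moreover have "conjugate_over S A b ?b" unfolding conjugate_over_def using fG by blast
  ultimately show ?thesis by blast
qed

end

section \<open>The two logics\<close>

primrec ren_tm :: "(nat \<Rightarrow> nat) \<Rightarrow> 'f tm \<Rightarrow> 'f tm" where
  "ren_tm s (Var n) = Var (s n)"
| "ren_tm s (App f ts) = App f (map (ren_tm s) ts)"

lemma fv_ren_tm: "fv_tm (ren_tm s t) = s ` fv_tm t"
  by (induction t) auto

lemma wf_ren_tm: "wf_tm L t \<Longrightarrow> wf_tm L (ren_tm s t)"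
  by (induction t) (auto simp: list_all_iff)

lemma val_ren_tm: "tm_val F e (ren_tm s t) = tm_val F (\<lambda>n. e (s n)) t"
proof (induction t)
  case (App f ts)
  then have "map (tm_val F e) (map (ren_tm s) ts) = map (tm_val F (\<lambda>n. e (s n))) ts" by simp
  then show ?case by (simp only: tm_val.simps ren_tm.simps)
qed simp

lemma finite_fv_tm: "finite (fv_tm t)"
  by (induction t) auto

lemma tm_val_cong: "(\<And>n. n \<in> fv_tm t \<Longrightarrow> e n = e' n) \<Longrightarrow> tm_val F e t = tm_val F e' t"
proof (induction t)
  case (App f ts)
  then have "map (tm_val F e) ts = map (tm_val F e') ts" by (intro map_cong) auto
  then show ?case by (simp only: tm_val.simps)
qed simp

lemma tm_val_aut:
  assumes "\<And>f xs. f \<in> fsyms L \<Longrightarrow> length xs = farity L f \<Longrightarrow> \<sigma> (F f xs) = F f (map \<sigma> xs)"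
  shows "wf_tm L t \<Longrightarrow> tm_val F (\<lambda>n. \<sigma> (e n)) t = \<sigma> (tm_val F e t)"
proof (induction t)
  case (App f ts)
  then have "map (tm_val F (\<lambda>n. \<sigma> (e n))) ts = map \<sigma> (map (tm_val F e) ts)" by (simp add: list_all_iff)
  then show ?case
    using App.prems assms[of f "map (tm_val F e) ts"] by (simp only: tm_val.simps wf_tm.simps length_map)
qed simp

lemma (in strong_limit) small_wf_tm:
  assumes "small \<kappa> (fsyms L)"
  shows "small \<kappa> {t. wf_tm L t}"
proof -
  let ?Ops = "(UNIV :: nat set) <+> fsyms L" and ?op = "case_sum (\<lambda>n xs. Var n) App"
  have "t \<in> generated ?Ops ?op" if "wf_tm L t" for t
    using that
  proof (induction t)
    case (Var n)
    then show ?case using generated_closed[of "Inl n" ?Ops "[]" ?op] by auto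
  next
    case (App f ts)
    then have "set ts \<subseteq> generated ?Ops ?op" by (auto simp: list_all_iff)
    then show ?case using App.prems generated_closed[of "Inr f" ?Ops ts ?op] by auto
  qed
  then have "{t. wf_tm L t} \<subseteq> generated ?Ops ?op" by blast
  then show ?thesis by (rule small_subset) (intro small_generated small_Plus small_nat assms)
qed

subsection \<open>Discrete logic\<close>

lemma finite_fv_fm: "finite (fv_fm \<phi>)"
  by (induction \<phi>) (auto simp: finite_fv_tm)

lemma sat_cong: "(\<And>n. n \<in> fv_fm \<phi> \<Longrightarrow> e n = e' n) \<Longrightarrow> sat M e \<phi> \<longleftrightarrow> sat M e' \<phi>"
proof (induction \<phi> arbitrary: e e')
  case (Eq t u)
  then show ?case using tm_val_cong[of t e e'] tm_val_cong[of u e e'] by auto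
next
  case (Rel p ts)
  then have "map (tm_val (fint M) e) ts = map (tm_val (fint M) e') ts"
    by (intro map_cong refl tm_val_cong) auto
  then show ?case by (simp only: sat.simps)
next
  case (Neg \<phi>)
  show ?case using Neg.IH[of e e'] Neg.prems by simp
next
  case (Conj \<phi> \<psi>)
  show ?case using Conj.IH(1)[of e e'] Conj.IH(2)[of e e'] Conj.prems by simp
next
  case (Exists n \<phi>)
  have "sat M (e(n := x)) \<phi> \<longleftrightarrow> sat M (e'(n := x)) \<phi>" for x
    using Exists.prems by (intro Exists.IH) auto
  then show ?case by simp
qed

text \<open>Stated as mere existence because bound variables have to be renamed along the way,
  depending on \<open>s\<close>.\<close>

lemma ren_fm:
  "\<exists>\<xi>. (wf_fm L \<phi> \<longrightarrow> wf_fm L \<xi>) \<and> fv_fm \<xi> \<subseteq> s ` fv_fm \<phi> \<and> (\<forall>e. sat M e \<xi> \<longleftrightarrow> sat M (\<lambda>k. e (s k)) \<phi>)"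
proof (induction \<phi> arbitrary: s)
  case (Eq t u)
  show ?case
    by (intro exI[of _ "Eq (ren_tm s t) (ren_tm s u)"])
      (auto simp: wf_ren_tm fv_ren_tm val_ren_tm)
next
  case (Rel p ts)
  have eq: "map (tm_val (fint M) e) (map (ren_tm s) ts) = map (tm_val (fint M) (\<lambda>k. e (s k))) ts" for e
    by (simp add: val_ren_tm)
  show ?case
  proof (intro exI[of _ "Rel p (map (ren_tm s) ts)"] conjI allI)
    show "wf_fm L (Rel p ts) \<longrightarrow> wf_fm L (Rel p (map (ren_tm s) ts))"
      by (auto simp: wf_ren_tm list_all_iff)
    show "fv_fm (Rel p (map (ren_tm s) ts)) \<subseteq> s ` fv_fm (Rel p ts)" by (auto simp: fv_ren_tm)
  qed (simp only: sat.simps eq)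
next
  case (Neg \<phi>)
  obtain \<xi> where "(wf_fm L \<phi> \<longrightarrow> wf_fm L \<xi>) \<and> fv_fm \<xi> \<subseteq> s ` fv_fm \<phi> \<and>
    (\<forall>e. sat M e \<xi> \<longleftrightarrow> sat M (\<lambda>k. e (s k)) \<phi>)" using Neg by blast
  then show ?case by (intro exI[of _ "Neg \<xi>"]) simp
next
  case (Conj \<phi> \<psi>)
  obtain \<xi> where \<xi>: "(wf_fm L \<phi> \<longrightarrow> wf_fm L \<xi>) \<and> fv_fm \<xi> \<subseteq> s ` fv_fm \<phi> \<and>
    (\<forall>e. sat M e \<xi> \<longleftrightarrow> sat M (\<lambda>k. e (s k)) \<phi>)" using Conj.IH(1) by blast
  obtain \<theta> where \<theta>: "(wf_fm L \<psi> \<longrightarrow> wf_fm L \<theta>) \<and> fv_fm \<theta> \<subseteq> s ` fv_fm \<psi> \<and>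
    (\<forall>e. sat M e \<theta> \<longleftrightarrow> sat M (\<lambda>k. e (s k)) \<psi>)" using Conj.IH(2) by blast
  show ?case using \<xi> \<theta> by (intro exI[of _ "Conj \<xi> \<theta>"]) auto
next
  case (Exists n \<phi>)
  \<comment> \<open>A bound variable outside the image of the free variables avoids capture.\<close>
  obtain m where m: "m \<notin> s ` fv_fm \<phi>"
    using ex_new_if_finite[OF infinite_UNIV_nat] finite_fv_fm[of \<phi>] by blast
  obtain \<xi> where \<xi>: "wf_fm L \<phi> \<longrightarrow> wf_fm L \<xi>" "fv_fm \<xi> \<subseteq> s(n := m) ` fv_fm \<phi>"
    "\<And>e. sat M e \<xi> \<longleftrightarrow> sat M (\<lambda>k. e ((s(n := m)) k)) \<phi>" using Exists[of "s(n := m)"] by blast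
  have "sat M (\<lambda>k. (e(m := x)) ((s(n := m)) k)) \<phi> \<longleftrightarrow> sat M ((\<lambda>k. e (s k))(n := x)) \<phi>" for e x
    using m by (intro sat_cong) auto
  moreover have "fv_fm \<xi> - {m} \<subseteq> s ` (fv_fm \<phi> - {n})" using \<xi>(2) by (auto split: if_splits)
  ultimately show ?case using \<xi>(1,3) by (intro exI[of _ "Exists m \<xi>"]) simp
qed

lemma automorphismsD:
  assumes "\<sigma> \<in> automorphisms L M"
  shows "bij \<sigma>"
    and "f \<in> fsyms L \<Longrightarrow> length xs = farity L f \<Longrightarrow> \<sigma> (fint M f xs) = fint M f (map \<sigma> xs)"
    and "p \<in> psyms L \<Longrightarrow> length ys = parity L p \<Longrightarrow> pint M p (map \<sigma> ys) = pint M p ys"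
  using assms unfolding automorphisms_def by auto

lemma automorphisms_id: "id \<in> automorphisms L M"
  by (simp add: automorphisms_def)

lemma automorphisms_comp:
  "\<sigma> \<in> automorphisms L M \<Longrightarrow> \<tau> \<in> automorphisms L M \<Longrightarrow> \<sigma> \<circ> \<tau> \<in> automorphisms L M"
  unfolding automorphisms_def by (auto simp: bij_comp simp flip: map_map)

lemma automorphisms_inv:
  assumes "\<sigma> \<in> automorphisms L M"
  shows "inv \<sigma> \<in> automorphisms L M"
proof -
  note \<sigma> = automorphismsD[OF assms]
  have inv: "map \<sigma> (map (inv \<sigma>) xs) = xs" "inv \<sigma> (\<sigma> x) = x" for xs x
    using \<sigma>(1) by (simp_all add: bij_def surj_iff)
  have "inv \<sigma> (fint M f xs) = fint M f (map (inv \<sigma>) xs)"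
    if "f \<in> fsyms L" "length xs = farity L f" for f xs
    using \<sigma>(2)[of f "map (inv \<sigma>) xs"] that inv by (metis length_map)
  moreover have "pint M p (map (inv \<sigma>) xs) = pint M p xs"
    if "p \<in> psyms L" "length xs = parity L p" for p xs
    using \<sigma>(3)[of p "map (inv \<sigma>) xs"] that inv by (metis length_map)
  ultimately show ?thesis using bij_imp_bij_inv[OF \<sigma>(1)] by (simp add: automorphisms_def)
qed

lemma sat_aut:
  assumes \<sigma>: "\<sigma> \<in> automorphisms L M"
  shows "wf_fm L \<phi> \<Longrightarrow> sat M (\<lambda>k. \<sigma> (e k)) \<phi> \<longleftrightarrow> sat M e \<phi>"
proof (induction \<phi> arbitrary: e)
  case (Eq t u)
  then show ?case
    using tm_val_aut[of L \<sigma> "fint M"] automorphismsD(1,2)[OF \<sigma>] by (auto simp: bij_def inj_eq)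
next
  case (Rel p ts)
  then have "map (tm_val (fint M) (\<lambda>k. \<sigma> (e k))) ts = map \<sigma> (map (tm_val (fint M) e) ts)"
    using tm_val_aut[of L \<sigma> "fint M"] automorphismsD(2)[OF \<sigma>] by (simp add: list_all_iff)
  then show ?case
    using automorphismsD(3)[OF \<sigma>, of p "map (tm_val (fint M) e) ts"] Rel.prems
    by (simp only: sat.simps wf_fm.simps length_map)
next
  case (Exists n \<phi>)
  have upd: "(\<lambda>k. \<sigma> (e k))(n := \<sigma> x) = (\<lambda>k. \<sigma> ((e(n := x)) k))" for x by auto
  have "(\<exists>x. sat M ((\<lambda>k. \<sigma> (e k))(n := x)) \<phi>) \<longleftrightarrow> (\<exists>x. sat M ((\<lambda>k. \<sigma> (e k))(n := \<sigma> x)) \<phi>)"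
    using bij_is_surj[OF automorphismsD(1)[OF \<sigma>]] by (metis surjD)
  then show ?case using Exists by (simp add: upd del: fun_upd_apply)
qed simp_all

text \<open>Every well-formed formula arises from the constructors; all data of a constructor except
  its subformulas become part of the name of an operation, and there are few names.\<close>

lemma (in strong_limit) small_wf_fm:
  fixes L :: "('f, 'p, 'z) lang_scheme"
  assumes "small \<kappa> (fsyms L)" "small \<kappa> (psyms L)"
  shows "small \<kappa> {\<phi>. wf_fm L \<phi>}"
proof -
  let ?T = "{t. wf_tm L t}"
  let ?Ops = "(?T \<times> ?T) <+> ((psyms L \<times> lists ?T) <+> ((UNIV :: bool set) <+> (UNIV :: nat set)))"
  define op where "op = case_sum (\<lambda>p xs. Eq (fst p) (snd p)) (case_sum (\<lambda>p xs. Rel (fst p) (snd p))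
    (case_sum (\<lambda>c xs. if c then Neg (xs ! 0) else Conj (xs ! 0) (xs ! 1))
      (\<lambda>n xs. Exists n (xs ! 0 :: ('f, 'p) fm))))"
  note cl = generated_closed[where Ops = ?Ops and op = op]
  have op: "op (Inl (t, u)) xs = Eq t u" "op (Inr (Inl (p, ts))) xs = Rel p ts"
    "op (Inr (Inr (Inl True))) xs = Neg (xs ! 0)"
    "op (Inr (Inr (Inl False))) xs = Conj (xs ! 0) (xs ! 1)"
    "op (Inr (Inr (Inr n))) xs = Exists n (xs ! 0)" for t u xs p ts n
    by (simp_all add: op_def)
  have "\<phi> \<in> generated ?Ops op" if "wf_fm L \<phi>" for \<phi>
    using that
  proof (induction \<phi>)
    case (Eq t u)
    then show ?case using cl[of "Inl (t, u)" "[]"] by (auto simp: op)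
  next
    case (Rel p ts)
    then show ?case using cl[of "Inr (Inl (p, ts))" "[]"] by (auto simp: op list_all_iff)
  next
    case (Neg \<phi>)
    then show ?case using cl[of "Inr (Inr (Inl True))" "[\<phi>]"] by (auto simp: op)
  next
    case (Conj \<phi> \<psi>)
    then show ?case using cl[of "Inr (Inr (Inl False))" "[\<phi>, \<psi>]"] by (auto simp: op)
  next
    case (Exists n \<phi>)
    then show ?case using cl[of "Inr (Inr (Inr n))" "[\<phi>]"] by (auto simp: op)
  qed
  then have "{\<phi>. wf_fm L \<phi>} \<subseteq> generated ?Ops op" by blast
  then show ?thesis
    by (rule small_subset)
      (intro small_generated small_Plus small_Times small_lists small_wf_tm small_nat
        small_finite[OF finite] assms)
qed

lemma discrete_monster_frame:
  assumes "discrete_monster_model \<kappa> L T M"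
  shows "monster_frame \<kappa> (discrete_frame L M)"
proof -
  let ?S = "discrete_frame L M"
  have mon: "uncountable_strong_limit \<kappa>" "small \<kappa> (fsyms L)" "small \<kappa> (psyms L)"
      "saturated \<kappa> ?S" "strongly_homogeneous \<kappa> ?S"
    using assms by (auto simp: discrete_monster_model_def monster_def)
  interpret strong_limit \<kappa> by unfold_locales (rule mon(1))
  have S: "auts ?S = automorphisms L M" "conds ?S = {\<phi>. wf_fm L \<phi>}" "cond_fv ?S = fv_fm"
      "cond_holds ?S = sat M"
    by (simp_all add: discrete_frame_def)
  show ?thesis
  proof (unfold_locales, unfold S comp_def)
    show "small \<kappa> {\<phi>. wf_fm L \<phi>}" by (rule small_wf_fm[OF mon(2,3)])
    show "finite (fv_fm \<phi>)" for \<phi> by (rule finite_fv_fm)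
    show "sat M e \<phi> = sat M e' \<phi>" if "\<And>n. n \<in> fv_fm \<phi> \<Longrightarrow> e n = e' n" for \<phi> e e'
      using that by (rule sat_cong)
    show "\<exists>\<xi>\<in>{\<phi>. wf_fm L \<phi>}. fv_fm \<xi> = {} \<and> (\<forall>e. sat M e \<xi>)"
      \<comment> \<open>The syntax has no constant for truth and the language may have no symbols,
        so a valid quantified sentence is used.\<close>
      by (intro bexI[of _ "Exists 0 (Eq (Var 0) (Var 0))"]) auto
    fix \<phi> \<psi> assume \<phi>: "\<phi> \<in> {\<phi>. wf_fm L \<phi>}"
    show "\<exists>\<xi>\<in>{\<phi>. wf_fm L \<phi>}. fv_fm \<xi> \<subseteq> fv_fm \<phi> \<union> fv_fm \<psi> \<and>
        (\<forall>e. sat M e \<xi> \<longleftrightarrow> sat M e \<phi> \<and> sat M e \<psi>)" if "\<psi> \<in> {\<phi>. wf_fm L \<phi>}"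
      using \<phi> that by (intro bexI[of _ "Conj \<phi> \<psi>"]) auto
    show "\<exists>\<xi>\<in>{\<phi>. wf_fm L \<phi>}. fv_fm \<xi> \<subseteq> fv_fm \<phi> - {n} \<and>
        (\<forall>e. sat M e \<xi> \<longleftrightarrow> (\<exists>x. sat M (e(n := x)) \<phi>))" for n
      using \<phi> by (intro bexI[of _ "Exists n \<phi>"]) auto
    show "\<exists>\<xi>\<in>{\<phi>. wf_fm L \<phi>}. fv_fm \<xi> \<subseteq> s ` fv_fm \<phi> \<and> (\<forall>e. sat M e \<xi> \<longleftrightarrow> sat M (\<lambda>k. e (s k)) \<phi>)" for s
      using ren_fm[of L \<phi> s M] \<phi> by blast
    show "\<exists>\<xi>\<in>{\<phi>. wf_fm L \<phi>}. fv_fm \<xi> \<subseteq> fv_fm \<phi> \<and> sat M e \<xi> \<and>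
        (\<forall>e'. sat M e' \<xi> \<longrightarrow> \<not> sat M e' \<phi>)" if "\<not> sat M e \<phi>" for e
      using \<phi> that by (intro bexI[of _ "Neg \<phi>"]) auto
    show "\<exists>\<xi>\<in>{\<phi>. wf_fm L \<phi>}. fv_fm \<xi> \<subseteq> s ` fv_fm \<phi> \<union> t ` fv_fm \<phi> \<and>
        (\<forall>e. sat M e \<xi> \<longrightarrow> (sat M (\<lambda>k. e (s k)) \<phi> \<longleftrightarrow> sat M (\<lambda>k. e (t k)) \<phi>)) \<and>
        (\<forall>e. \<forall>\<sigma>\<in>automorphisms L M. (\<forall>n\<in>fv_fm \<phi>. e (t n) = \<sigma> (e (s n))) \<longrightarrow> sat M e \<xi>)" for s t
    proof -
      obtain \<phi>1 where 1: "wf_fm L \<phi>1" "fv_fm \<phi>1 \<subseteq> s ` fv_fm \<phi>" "\<And>e. sat M e \<phi>1 \<longleftrightarrow> sat M (\<lambda>k. e (s k)) \<phi>"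
        using ren_fm[of L \<phi> s M] \<phi> by blast
      obtain \<phi>2 where 2: "wf_fm L \<phi>2" "fv_fm \<phi>2 \<subseteq> t ` fv_fm \<phi>" "\<And>e. sat M e \<phi>2 \<longleftrightarrow> sat M (\<lambda>k. e (t k)) \<phi>"
        using ren_fm[of L \<phi> t M] \<phi> by blast
      have "sat M (\<lambda>k. e (s k)) \<phi> \<longleftrightarrow> sat M (\<lambda>k. e (t k)) \<phi>"
        if \<sigma>: "\<sigma> \<in> automorphisms L M" "\<forall>n\<in>fv_fm \<phi>. e (t n) = \<sigma> (e (s n))" for e \<sigma>
      proof -
        have "sat M (\<lambda>k. e (t k)) \<phi> \<longleftrightarrow> sat M (\<lambda>k. \<sigma> (e (s k))) \<phi>" using \<sigma>(2) by (intro sat_cong) simp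
        then show ?thesis using sat_aut[OF \<sigma>(1), of \<phi> "\<lambda>k. e (s k)"] \<phi> by simp
      qed
      then show ?thesis
        using 1 2
        by (intro bexI[of _ "Conj (Neg (Conj \<phi>1 (Neg \<phi>2))) (Neg (Conj \<phi>2 (Neg \<phi>1)))"]) auto
    qed
    show "sat M (\<lambda>k. \<sigma> (e k)) \<phi> = sat M e \<phi>" if "\<sigma> \<in> automorphisms L M" for \<sigma> e
      using sat_aut[OF that] \<phi> by blast
  qed (use automorphisms_id automorphisms_comp automorphisms_inv automorphismsD(1) mon(4,5) in
      \<open>auto simp: comp_def\<close>)
qed

subsection \<open>Continuous logic\<close>

lemma finite_fv_cfm: "finite (fv_cfm \<phi>)"
  by (induction \<phi>) (auto simp: finite_fv_tm)

lemma cval_cong: "(\<And>n. n \<in> fv_cfm \<phi> \<Longrightarrow> e n = e' n) \<Longrightarrow> cval M e \<phi> = cval M e' \<phi>"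
proof (induction \<phi> arbitrary: e e')
  case (CDist t u)
  then show ?case using tm_val_cong[of t e e'] tm_val_cong[of u e e'] by auto
next
  case (CRel p ts)
  then have "map (tm_val (cfint M) e) ts = map (tm_val (cfint M) e') ts"
    by (intro map_cong refl tm_val_cong) auto
  then show ?case by (simp only: cval.simps)
next
  case (CHalf \<phi>)
  show ?case using CHalf.IH[of e e'] CHalf.prems by simp
next
  case (CMonus \<phi> \<psi>)
  show ?case using CMonus.IH(1)[of e e'] CMonus.IH(2)[of e e'] CMonus.prems by simp
next
  case (CSup n \<phi>)
  have "cval M (e(n := x)) \<phi> = cval M (e'(n := x)) \<phi>" for x
    using CSup.prems by (intro CSup.IH) auto
  then show ?case by simp
next
  case (CInf n \<phi>)
  have "cval M (e(n := x)) \<phi> = cval M (e'(n := x)) \<phi>" for x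
    using CInf.prems by (intro CInf.IH) auto
  then show ?case by simp
qed simp

lemma ren_cfm:
  "\<exists>\<xi>. (wf_cfm L \<phi> \<longrightarrow> wf_cfm L \<xi>) \<and> fv_cfm \<xi> \<subseteq> s ` fv_cfm \<phi> \<and>
     (\<forall>e. cval M e \<xi> = cval M (\<lambda>k. e (s k)) \<phi>)"
proof (induction \<phi> arbitrary: s)
  case (CDist t u)
  show ?case
    by (intro exI[of _ "CDist (ren_tm s t) (ren_tm s u)"])
      (auto simp: wf_ren_tm fv_ren_tm val_ren_tm)
next
  case (CRel p ts)
  have eq: "map (tm_val (cfint M) e) (map (ren_tm s) ts) = map (tm_val (cfint M) (\<lambda>k. e (s k))) ts" for e
    by (simp add: val_ren_tm)
  show ?case
  proof (intro exI[of _ "CRel p (map (ren_tm s) ts)"] conjI allI)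
    show "wf_cfm L (CRel p ts) \<longrightarrow> wf_cfm L (CRel p (map (ren_tm s) ts))"
      by (auto simp: wf_ren_tm list_all_iff)
    show "fv_cfm (CRel p (map (ren_tm s) ts)) \<subseteq> s ` fv_cfm (CRel p ts)" by (auto simp: fv_ren_tm)
  qed (simp only: cval.simps eq)
next
  case (CConst r)
  show ?case by (intro exI[of _ "CConst r"]) simp
next
  case (CHalf \<phi>)
  obtain \<xi> where "(wf_cfm L \<phi> \<longrightarrow> wf_cfm L \<xi>) \<and> fv_cfm \<xi> \<subseteq> s ` fv_cfm \<phi> \<and>
    (\<forall>e. cval M e \<xi> = cval M (\<lambda>k. e (s k)) \<phi>)" using CHalf by blast
  then show ?case by (intro exI[of _ "CHalf \<xi>"]) simp
next
  case (CMonus \<phi> \<psi>)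
  obtain \<xi> where \<xi>: "(wf_cfm L \<phi> \<longrightarrow> wf_cfm L \<xi>) \<and> fv_cfm \<xi> \<subseteq> s ` fv_cfm \<phi> \<and>
    (\<forall>e. cval M e \<xi> = cval M (\<lambda>k. e (s k)) \<phi>)" using CMonus.IH(1) by blast
  obtain \<theta> where \<theta>: "(wf_cfm L \<psi> \<longrightarrow> wf_cfm L \<theta>) \<and> fv_cfm \<theta> \<subseteq> s ` fv_cfm \<psi> \<and>
    (\<forall>e. cval M e \<theta> = cval M (\<lambda>k. e (s k)) \<psi>)" using CMonus.IH(2) by blast
  show ?case using \<xi> \<theta> by (intro exI[of _ "CMonus \<xi> \<theta>"]) auto
next
  case (CSup n \<phi>)
  obtain m where m: "m \<notin> s ` fv_cfm \<phi>"
    using ex_new_if_finite[OF infinite_UNIV_nat] finite_fv_cfm[of \<phi>] by blast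
  obtain \<xi> where \<xi>: "wf_cfm L \<phi> \<longrightarrow> wf_cfm L \<xi>" "fv_cfm \<xi> \<subseteq> s(n := m) ` fv_cfm \<phi>"
    "\<And>e. cval M e \<xi> = cval M (\<lambda>k. e ((s(n := m)) k)) \<phi>" using CSup[of "s(n := m)"] by blast
  have "cval M (\<lambda>k. (e(m := x)) ((s(n := m)) k)) \<phi> = cval M ((\<lambda>k. e (s k))(n := x)) \<phi>" for e x
    using m by (intro cval_cong) auto
  moreover have "fv_cfm \<xi> - {m} \<subseteq> s ` (fv_cfm \<phi> - {n})" using \<xi>(2) by (auto split: if_splits)
  ultimately show ?case using \<xi>(1,3) by (intro exI[of _ "CSup m \<xi>"]) simp
next
  case (CInf n \<phi>)
  obtain m where m: "m \<notin> s ` fv_cfm \<phi>"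
    using ex_new_if_finite[OF infinite_UNIV_nat] finite_fv_cfm[of \<phi>] by blast
  obtain \<xi> where \<xi>: "wf_cfm L \<phi> \<longrightarrow> wf_cfm L \<xi>" "fv_cfm \<xi> \<subseteq> s(n := m) ` fv_cfm \<phi>"
    "\<And>e. cval M e \<xi> = cval M (\<lambda>k. e ((s(n := m)) k)) \<phi>" using CInf[of "s(n := m)"] by blast
  have "cval M (\<lambda>k. (e(m := x)) ((s(n := m)) k)) \<phi> = cval M ((\<lambda>k. e (s k))(n := x)) \<phi>" for e x
    using m by (intro cval_cong) auto
  moreover have "fv_cfm \<xi> - {m} \<subseteq> s ` (fv_cfm \<phi> - {n})" using \<xi>(2) by (auto split: if_splits)
  ultimately show ?case using \<xi>(1,3) by (intro exI[of _ "CInf m \<xi>"]) simp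
qed

text \<open>Boundedness gives suprema and infima of values over the model their intended meaning,
  and it makes the value of a formula usable as a constant of the syntax.\<close>

lemma cval_bounds:
  assumes M: "metric_structure L M"
  shows "wf_cfm L \<phi> \<Longrightarrow> 0 \<le> cval M e \<phi> \<and> cval M e \<phi> \<le> 1"
proof (induction \<phi> arbitrary: e)
  case (CDist t u)
  have "Metric_space UNIV (cdist M)" "\<forall>x y. cdist M x y \<le> 1"
    using M unfolding metric_structure_def by auto
  then show ?case by (simp add: Metric_space.nonneg)
next
  case (CRel p ts)
  then show ?case using M unfolding metric_structure_def by (simp add: atLeastAtMost_iff)
next
  case (CHalf \<phi>)
  show ?case using CHalf.IH[of e] CHalf.prems by simp
next
  case (CMonus \<phi> \<psi>)
  show ?case using CMonus.IH(1)[of e] CMonus.IH(2)[of e] CMonus.prems by auto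
next
  case (CSup n \<phi>)
  have b: "0 \<le> cval M (e(n := x)) \<phi>" "cval M (e(n := x)) \<phi> \<le> 1" for x
    using CSup.IH[of "e(n := x)"] CSup.prems unfolding wf_cfm.simps by blast+
  then have "bdd_above (range (\<lambda>x. cval M (e(n := x)) \<phi>))" by (intro bdd_aboveI2)
  then have "0 \<le> (SUP x. cval M (e(n := x)) \<phi>)"
    by (rule cSUP_upper2[where x = undefined]) (rule UNIV_I b(1))+
  moreover have "(SUP x. cval M (e(n := x)) \<phi>) \<le> 1" using b(2) by (intro cSUP_least) auto
  ultimately show ?case by simp
next
  case (CInf n \<phi>)
  have b: "0 \<le> cval M (e(n := x)) \<phi>" "cval M (e(n := x)) \<phi> \<le> 1" for x
    using CInf.IH[of "e(n := x)"] CInf.prems unfolding wf_cfm.simps by blast+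
  then have "bdd_below (range (\<lambda>x. cval M (e(n := x)) \<phi>))" by (intro bdd_belowI2)
  then have "(INF x. cval M (e(n := x)) \<phi>) \<le> 1"
    by (rule cINF_lower2[where x = undefined]) (rule UNIV_I b(2))+
  moreover have "0 \<le> (INF x. cval M (e(n := x)) \<phi>)" using b(1) by (intro cINF_greatest) auto
  ultimately show ?case by simp
qed simp_all

lemma cautomorphismsD:
  assumes "\<sigma> \<in> cautomorphisms L M"
  shows "bij \<sigma>" "cdist M (\<sigma> x) (\<sigma> y) = cdist M x y"
    and "f \<in> fsyms L \<Longrightarrow> length xs = farity L f \<Longrightarrow> \<sigma> (cfint M f xs) = cfint M f (map \<sigma> xs)"
    and "p \<in> psyms L \<Longrightarrow> length ys = parity L p \<Longrightarrow> cpint M p (map \<sigma> ys) = cpint M p ys"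
  using assms unfolding cautomorphisms_def by auto

lemma cautomorphisms_id: "id \<in> cautomorphisms L M"
  by (simp add: cautomorphisms_def)

lemma cautomorphisms_comp:
  "\<sigma> \<in> cautomorphisms L M \<Longrightarrow> \<tau> \<in> cautomorphisms L M \<Longrightarrow> \<sigma> \<circ> \<tau> \<in> cautomorphisms L M"
  unfolding cautomorphisms_def by (auto simp: bij_comp simp flip: map_map)

lemma cautomorphisms_inv:
  assumes "\<sigma> \<in> cautomorphisms L M"
  shows "inv \<sigma> \<in> cautomorphisms L M"
proof -
  note \<sigma> = cautomorphismsD[OF assms]
  have inv: "map \<sigma> (map (inv \<sigma>) xs) = xs" "inv \<sigma> (\<sigma> x) = x" "\<sigma> (inv \<sigma> x) = x" for xs x
    using \<sigma>(1) by (simp_all add: bij_def surj_iff surj_f_inv_f)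
  have "cdist M (inv \<sigma> x) (inv \<sigma> y) = cdist M x y" for x y
    using \<sigma>(2)[of "inv \<sigma> x" "inv \<sigma> y"] inv(3) by simp
  moreover have "inv \<sigma> (cfint M f xs) = cfint M f (map (inv \<sigma>) xs)"
    if "f \<in> fsyms L" "length xs = farity L f" for f xs
    using \<sigma>(3)[of f "map (inv \<sigma>) xs"] that inv(1,2) by (metis length_map)
  moreover have "cpint M p (map (inv \<sigma>) xs) = cpint M p xs"
    if "p \<in> psyms L" "length xs = parity L p" for p xs
    using \<sigma>(4)[of p "map (inv \<sigma>) xs"] that inv(1,2) by (metis length_map)
  ultimately show ?thesis using bij_imp_bij_inv[OF \<sigma>(1)] by (simp add: cautomorphisms_def)
qed

lemma cval_aut:
  assumes \<sigma>: "\<sigma> \<in> cautomorphisms L M"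
  shows "wf_cfm L \<phi> \<Longrightarrow> cval M (\<lambda>k. \<sigma> (e k)) \<phi> = cval M e \<phi>"
proof (induction \<phi> arbitrary: e)
  case (CDist t u)
  then show ?case
    using tm_val_aut[of L \<sigma> "cfint M"] cautomorphismsD(3)[OF \<sigma>] cautomorphismsD(2)[OF \<sigma>] by simp
next
  case (CRel p ts)
  then have "map (tm_val (cfint M) (\<lambda>k. \<sigma> (e k))) ts = map \<sigma> (map (tm_val (cfint M) e) ts)"
    using tm_val_aut[of L \<sigma> "cfint M"] cautomorphismsD(3)[OF \<sigma>] by (simp add: list_all_iff)
  then show ?case
    using cautomorphismsD(4)[OF \<sigma>, of p "map (tm_val (cfint M) e) ts"] CRel.prems
    by (simp only: cval.simps wf_cfm.simps length_map)
next
  case (CSup n \<phi>)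
  have "cval M ((\<lambda>k. \<sigma> (e k))(n := \<sigma> x)) \<phi> = cval M (e(n := x)) \<phi>" for x
  proof -
    have upd: "(\<lambda>k. \<sigma> (e k))(n := \<sigma> x) = (\<lambda>k. \<sigma> ((e(n := x)) k))" by auto
    show ?thesis unfolding upd using CSup.IH[of "e(n := x)"] CSup.prems unfolding wf_cfm.simps by blast
  qed
  then have "range (\<lambda>x. cval M (e(n := x)) \<phi>) = (\<lambda>x. cval M ((\<lambda>k. \<sigma> (e k))(n := x)) \<phi>) ` range \<sigma>"
    by (simp add: image_image)
  then show ?case using bij_is_surj[OF cautomorphismsD(1)[OF \<sigma>]] by simp
next
  case (CInf n \<phi>)
  have "cval M ((\<lambda>k. \<sigma> (e k))(n := \<sigma> x)) \<phi> = cval M (e(n := x)) \<phi>" for x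
  proof -
    have upd: "(\<lambda>k. \<sigma> (e k))(n := \<sigma> x) = (\<lambda>k. \<sigma> ((e(n := x)) k))" by auto
    show ?thesis unfolding upd using CInf.IH[of "e(n := x)"] CInf.prems unfolding wf_cfm.simps by blast
  qed
  then have "range (\<lambda>x. cval M (e(n := x)) \<phi>) = (\<lambda>x. cval M ((\<lambda>k. \<sigma> (e k))(n := x)) \<phi>) ` range \<sigma>"
    by (simp add: image_image)
  then show ?case using bij_is_surj[OF cautomorphismsD(1)[OF \<sigma>]] by simp
qed simp_all

lemma (in strong_limit) small_wf_cfm:
  fixes L :: "('f, 'p, 'z) lang_scheme"
  assumes "small \<kappa> (fsyms L)" "small \<kappa> (psyms L)"
  shows "small \<kappa> {\<phi>. wf_cfm L \<phi>}"
proof -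
  let ?T = "{t. wf_tm L t}"
  let ?Ops = "(?T \<times> ?T) <+> ((psyms L \<times> lists ?T) <+> ((UNIV :: real set) <+>
    ((UNIV :: bool set) <+> ((UNIV :: bool set) \<times> (UNIV :: nat set)))))"
  define op where "op = case_sum (\<lambda>p xs. CDist (fst p) (snd p))
    (case_sum (\<lambda>p xs. CRel (fst p) (snd p)) (case_sum (\<lambda>r xs. CConst r)
      (case_sum (\<lambda>c xs. if c then CHalf (xs ! 0) else CMonus (xs ! 0) (xs ! 1))
        (\<lambda>q xs. if fst q then CSup (snd q) (xs ! 0) else CInf (snd q) (xs ! 0 :: ('f, 'p) cfm)))))"
  note cl = generated_closed[where Ops = ?Ops and op = op]
  have op: "op (Inl (t, u)) xs = CDist t u" "op (Inr (Inl (p, ts))) xs = CRel p ts"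
    "op (Inr (Inr (Inl r))) xs = CConst r"
    "op (Inr (Inr (Inr (Inl True)))) xs = CHalf (xs ! 0)"
    "op (Inr (Inr (Inr (Inl False)))) xs = CMonus (xs ! 0) (xs ! 1)"
    "op (Inr (Inr (Inr (Inr (True, n))))) xs = CSup n (xs ! 0)"
    "op (Inr (Inr (Inr (Inr (False, n))))) xs = CInf n (xs ! 0)" for t u xs p ts n r
    by (simp_all add: op_def)
  have "\<phi> \<in> generated ?Ops op" if "wf_cfm L \<phi>" for \<phi>
    using that
  proof (induction \<phi>)
    case (CDist t u)
    then show ?case using cl[of "Inl (t, u)" "[]"] by (auto simp: op)
  next
    case (CRel p ts)
    then show ?case using cl[of "Inr (Inl (p, ts))" "[]"] by (auto simp: op list_all_iff)
  next
    case (CConst r)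
    then show ?case using cl[of "Inr (Inr (Inl r))" "[]"] by (auto simp: op)
  next
    case (CHalf \<phi>)
    then show ?case using cl[of "Inr (Inr (Inr (Inl True)))" "[\<phi>]"] by (auto simp: op)
  next
    case (CMonus \<phi> \<psi>)
    then show ?case using cl[of "Inr (Inr (Inr (Inl False)))" "[\<phi>, \<psi>]"] by (auto simp: op)
  next
    case (CSup n \<phi>)
    then show ?case using cl[of "Inr (Inr (Inr (Inr (True, n))))" "[\<phi>]"] by (auto simp: op)
  next
    case (CInf n \<phi>)
    then show ?case using cl[of "Inr (Inr (Inr (Inr (False, n))))" "[\<phi>]"] by (auto simp: op)
  qed
  then have "{\<phi>. wf_cfm L \<phi>} \<subseteq> generated ?Ops op" by blast
  then show ?thesis
    by (rule small_subset)
      (intro small_generated small_Plus small_Times small_lists small_wf_tm small_nat small_real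
        small_finite[OF finite] assms)
qed

text \<open>Saturation turns approximate zeros into an exact one. Hence \<open>CInf\<close>
  expresses existence of a solution, and conditions admit existential quantification.\<close>

lemma (in strong_limit) CInf_attained:
  assumes M: "metric_structure L M" and sat: "saturated \<kappa> (continuous_frame L M)"
    and \<phi>: "wf_cfm L \<phi>"
  shows "cval M e (CInf n \<phi>) = 0 \<longleftrightarrow> (\<exists>x. cval M (e(n := x)) \<phi> = 0)"
proof -
  define g where "g x = cval M (e(n := x)) \<phi>" for x
  have g: "0 \<le> g x" for x using cval_bounds[OF M \<phi>] by (simp add: g_def)
  then have bdd: "bdd_below (range g)" by (intro bdd_belowI2)
  have inf: "cval M e (CInf n \<phi>) = (INF x. g x)" by (simp add: g_def)
  have "\<exists>x. g x = 0" if zero: "(INF x. g x) = 0"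
  proof -
    \<comment> \<open>Saturation solves for the variable 0, so \<open>n\<close> is moved there and
      the others shift up by one.\<close>
    define s where "s k = (if k = n then 0 else Suc k)" for k
    obtain \<xi> where \<xi>: "wf_cfm L \<xi>" "\<And>e. cval M e \<xi> = cval M (\<lambda>k. e (s k)) \<phi>"
      using ren_cfm[of L \<phi> s M] \<phi> by blast
    define e' where "e' k = e (k - 1)" for k
    have "(\<lambda>k. (e'(0 := x)) (s k)) = e(n := x)" for x by (auto simp: e'_def s_def)
    then have val: "cval M (e'(0 := x)) \<xi> = g x" for x by (simp add: \<xi>(2) g_def)
    \<comment> \<open>These conditions say that the value is at most 1/(m+1). Finitely many follow
      from the strictest one, which is solvable as the infimum is 0; a common solution has value
      0.\<close>
    define \<psi> where "\<psi> m = CMonus \<xi> (CConst (1 / real (Suc m)))" for m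
    have wf: "wf_cfm L (\<psi> m)" for m using \<xi>(1) by (simp add: \<psi>_def)
    have holds: "cval M (e'(0 := x)) (\<psi> m) = 0 \<longleftrightarrow> g x \<le> 1 / real (Suc m)" for x m
      unfolding \<psi>_def cval.simps val by auto
    let ?\<pi> = "range (\<lambda>m. (\<psi> m, e'))"
    have "\<exists>x. \<forall>(\<phi>, e)\<in>?\<pi>. cond_holds (continuous_frame L M) (e(0 := x)) \<phi>"
    proof (rule sat[unfolded saturated_def, rule_format, of "e' ` fv_cfm \<xi>"], intro conjI allI impI)
      show "small \<kappa> (e' ` fv_cfm \<xi>)" by (intro small_finite finite_imageI finite_fv_cfm)
      show "?\<pi> \<subseteq> {(\<phi>, ea). \<phi> \<in> conds (continuous_frame L M) \<and>
          ea ` (cond_fv (continuous_frame L M) \<phi> - {0}) \<subseteq> e' ` fv_cfm \<xi>}"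
        using wf by (auto simp: continuous_frame_def \<psi>_def)
      fix \<pi>' assume "\<pi>' \<subseteq> ?\<pi>" "finite \<pi>'"
      then obtain F where F: "finite F" "\<pi>' = (\<lambda>m. (\<psi> m, e')) ` F"
        by (meson finite_subset_image)
      obtain m where m: "\<forall>k\<in>F. k \<le> m" using F(1) finite_nat_set_iff_bounded_le by blast
      have "\<exists>x. g x < 1 / real (Suc m)"
        using cINF_less_iff[OF UNIV_not_empty bdd, of "1 / real (Suc m)"] zero by simp
      then obtain x where x: "g x < 1 / real (Suc m)" ..
      have "g x \<le> 1 / real (Suc k)" if "k \<in> F" for k
      proof -
        have "1 / real (Suc m) \<le> 1 / real (Suc k)" using m that by (intro divide_left_mono) auto
        then show ?thesis using x by linarith
      qed
      then have "\<forall>(\<phi>, e)\<in>\<pi>'. cond_holds (continuous_frame L M) (e(0 := x)) \<phi>"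
        using holds F(2) by (auto simp: continuous_frame_def)
      then show "\<exists>x. \<forall>(\<phi>, e)\<in>\<pi>'. cond_holds (continuous_frame L M) (e(0 := x)) \<phi>" by blast
    qed
    then obtain x where "\<forall>(\<phi>, e)\<in>?\<pi>. cond_holds (continuous_frame L M) (e(0 := x)) \<phi>" ..
    then have x: "g x \<le> 1 / real (Suc m)" for m using holds by (auto simp: continuous_frame_def)
    have "g x \<le> 0"
    proof (rule ccontr)
      assume "\<not> g x \<le> 0"
      then obtain m where "1 / real (Suc m) < g x" using nat_approx_posE[of "g x"] by auto
      then show False using x[of m] by linarith
    qed
    then show ?thesis using g[of x] by (intro exI[of _ x]) linarith
  qed
  moreover have "(INF x. g x) = 0" if "g x = 0" for x
  proof (rule antisym)
    show "(INF x. g x) \<le> 0" using cINF_lower[OF bdd, of x] that by simp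
    show "0 \<le> (INF x. g x)" using g by (intro cINF_greatest) auto
  qed
  ultimately show ?thesis unfolding inf g_def[symmetric] by blast
qed

lemma continuous_monster_frame:
  assumes "continuous_monster_model \<kappa> L T M"
  shows "monster_frame \<kappa> (continuous_frame L M)"
proof -
  let ?S = "continuous_frame L M"
  have mon: "uncountable_strong_limit \<kappa>" "small \<kappa> (fsyms L)" "small \<kappa> (psyms L)"
      "saturated \<kappa> ?S" "strongly_homogeneous \<kappa> ?S" and M: "metric_structure L M"
    using assms by (auto simp: continuous_monster_model_def monster_def)
  interpret strong_limit \<kappa> by unfold_locales (rule mon(1))
  have S: "auts ?S = cautomorphisms L M" "conds ?S = {\<phi>. wf_cfm L \<phi>}" "cond_fv ?S = fv_cfm"
      "cond_holds ?S = (\<lambda>e \<phi>. cval M e \<phi> = 0)"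
    by (simp_all add: continuous_frame_def)
  \<comment> \<open>The sum truncated at 1, written with truncated subtraction. Values are
    nonnegative, so it vanishes exactly where both summands do.\<close>
  let ?plus = "\<lambda>\<phi> \<psi>. CMonus (CConst 1) (CMonus (CMonus (CConst 1) \<phi>) \<psi>)"
  have plus: "cval M e (?plus \<phi> \<psi>) = 0 \<longleftrightarrow> cval M e \<phi> = 0 \<and> cval M e \<psi> = 0"
    if "wf_cfm L \<phi>" "wf_cfm L \<psi>" for e \<phi> \<psi>
    using cval_bounds[OF M that(1), of e] cval_bounds[OF M that(2), of e] by (auto simp: max_def)
  show ?thesis
  proof (unfold_locales, unfold S comp_def)
    show "small \<kappa> {\<phi>. wf_cfm L \<phi>}" by (rule small_wf_cfm[OF mon(2,3)])
    show "finite (fv_cfm \<phi>)" for \<phi> by (rule finite_fv_cfm)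
    show "(cval M e \<phi> = 0) = (cval M e' \<phi> = 0)" if "\<And>n. n \<in> fv_cfm \<phi> \<Longrightarrow> e n = e' n" for \<phi> e e'
    proof -
      have "cval M e \<phi> = cval M e' \<phi>" using that by (rule cval_cong)
      then show ?thesis by simp
    qed
    show "\<exists>\<xi>\<in>{\<phi>. wf_cfm L \<phi>}. fv_cfm \<xi> = {} \<and> (\<forall>e. cval M e \<xi> = 0)"
      by (intro bexI[of _ "CConst 0"]) auto
    fix \<phi> \<psi> assume \<phi>: "\<phi> \<in> {\<phi>. wf_cfm L \<phi>}"
    show "\<exists>\<xi>\<in>{\<phi>. wf_cfm L \<phi>}. fv_cfm \<xi> \<subseteq> fv_cfm \<phi> \<union> fv_cfm \<psi> \<and>
        (\<forall>e. cval M e \<xi> = 0 \<longleftrightarrow> cval M e \<phi> = 0 \<and> cval M e \<psi> = 0)" if "\<psi> \<in> {\<phi>. wf_cfm L \<phi>}"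
      using \<phi> that plus[of \<phi> \<psi>] by (intro bexI[of _ "?plus \<phi> \<psi>"]) (simp_all del: cval.simps)
    show "\<exists>\<xi>\<in>{\<phi>. wf_cfm L \<phi>}. fv_cfm \<xi> \<subseteq> fv_cfm \<phi> - {n} \<and>
        (\<forall>e. cval M e \<xi> = 0 \<longleftrightarrow> (\<exists>x. cval M (e(n := x)) \<phi> = 0))" for n
      using \<phi> CInf_attained[OF M mon(4), of \<phi>]
      by (intro bexI[of _ "CInf n \<phi>"]) (simp_all del: cval.simps)
    show "\<exists>\<xi>\<in>{\<phi>. wf_cfm L \<phi>}. fv_cfm \<xi> \<subseteq> s ` fv_cfm \<phi> \<and>
        (\<forall>e. cval M e \<xi> = 0 \<longleftrightarrow> cval M (\<lambda>k. e (s k)) \<phi> = 0)" for s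
    proof -
      obtain \<xi> where "wf_cfm L \<xi>" "fv_cfm \<xi> \<subseteq> s ` fv_cfm \<phi>"
          "\<And>e. cval M e \<xi> = cval M (\<lambda>k. e (s k)) \<phi>"
        using ren_cfm[of L \<phi> s M] \<phi> by blast
      then show ?thesis by (intro bexI[of _ \<xi>]) simp_all
    qed
    \<comment> \<open>With \<open>r\<close> the positive value of \<open>\<phi>\<close> at
      \<open>e\<close>, the condition that \<open>\<phi>\<close> is at least \<open>r\<close> is
      closed and excludes the value 0.\<close>
    show "\<exists>\<xi>\<in>{\<phi>. wf_cfm L \<phi>}. fv_cfm \<xi> \<subseteq> fv_cfm \<phi> \<and> cval M e \<xi> = 0 \<and>
        (\<forall>e'. cval M e' \<xi> = 0 \<longrightarrow> cval M e' \<phi> \<noteq> 0)" if "cval M e \<phi> \<noteq> 0" for e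
      using \<phi> that cval_bounds[OF M, of \<phi> e]
      by (intro bexI[of _ "CMonus (CConst (cval M e \<phi>)) \<phi>"]) auto
    show "\<exists>\<xi>\<in>{\<phi>. wf_cfm L \<phi>}. fv_cfm \<xi> \<subseteq> s ` fv_cfm \<phi> \<union> t ` fv_cfm \<phi> \<and>
        (\<forall>e. cval M e \<xi> = 0 \<longrightarrow> (cval M (\<lambda>k. e (s k)) \<phi> = 0 \<longleftrightarrow> cval M (\<lambda>k. e (t k)) \<phi> = 0)) \<and>
        (\<forall>e. \<forall>\<sigma>\<in>cautomorphisms L M. (\<forall>n\<in>fv_cfm \<phi>. e (t n) = \<sigma> (e (s n))) \<longrightarrow> cval M e \<xi> = 0)" for s t
    proof -
      obtain \<phi>1 where 1: "wf_cfm L \<phi>1" "fv_cfm \<phi>1 \<subseteq> s ` fv_cfm \<phi>"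
          "\<And>e. cval M e \<phi>1 = cval M (\<lambda>k. e (s k)) \<phi>"
        using ren_cfm[of L \<phi> s M] \<phi> by blast
      obtain \<phi>2 where 2: "wf_cfm L \<phi>2" "fv_cfm \<phi>2 \<subseteq> t ` fv_cfm \<phi>"
          "\<And>e. cval M e \<phi>2 = cval M (\<lambda>k. e (t k)) \<phi>"
        using ren_cfm[of L \<phi> t M] \<phi> by blast
      \<comment> \<open>Both truncated differences vanish iff the two values are equal. This is
        stronger than equivalence of the two conditions, yet it holds for conjugate
        instances.\<close>
      let ?\<xi> = "?plus (CMonus \<phi>1 \<phi>2) (CMonus \<phi>2 \<phi>1)"
      have \<xi>: "cval M e ?\<xi> = 0 \<longleftrightarrow> cval M (\<lambda>k. e (s k)) \<phi> = cval M (\<lambda>k. e (t k)) \<phi>" for e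
      proof -
        have "cval M e ?\<xi> = 0 \<longleftrightarrow> cval M e (CMonus \<phi>1 \<phi>2) = 0 \<and> cval M e (CMonus \<phi>2 \<phi>1) = 0"
          by (rule plus) (simp_all add: 1(1) 2(1))
        also have "\<dots> \<longleftrightarrow> cval M e \<phi>1 = cval M e \<phi>2" by auto
        finally show ?thesis by (simp only: 1(3) 2(3))
      qed
      have "cval M (\<lambda>k. e (s k)) \<phi> = cval M (\<lambda>k. e (t k)) \<phi>"
        if \<sigma>: "\<sigma> \<in> cautomorphisms L M" "\<forall>n\<in>fv_cfm \<phi>. e (t n) = \<sigma> (e (s n))" for e \<sigma>
      proof -
        have "cval M (\<lambda>k. e (t k)) \<phi> = cval M (\<lambda>k. \<sigma> (e (s k))) \<phi>" using \<sigma>(2) by (intro cval_cong) simp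
        then show ?thesis using cval_aut[OF \<sigma>(1), of \<phi> "\<lambda>k. e (s k)"] \<phi> by simp
      qed
      then have "\<forall>e. \<forall>\<sigma>\<in>cautomorphisms L M. (\<forall>n\<in>fv_cfm \<phi>. e (t n) = \<sigma> (e (s n))) \<longrightarrow> cval M e ?\<xi> = 0"
        unfolding \<xi> by blast
      moreover have "\<forall>e. cval M e ?\<xi> = 0 \<longrightarrow>
          (cval M (\<lambda>k. e (s k)) \<phi> = 0 \<longleftrightarrow> cval M (\<lambda>k. e (t k)) \<phi> = 0)"
        unfolding \<xi> by simp
      moreover have "?\<xi> \<in> {\<phi>. wf_cfm L \<phi>}" "fv_cfm ?\<xi> \<subseteq> s ` fv_cfm \<phi> \<union> t ` fv_cfm \<phi>"
        using 1 2 by auto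
      ultimately show ?thesis by blast
    qed
    show "(cval M (\<lambda>k. \<sigma> (e k)) \<phi> = 0) = (cval M e \<phi> = 0)" if "\<sigma> \<in> cautomorphisms L M" for \<sigma> e
      using cval_aut[OF that, of \<phi> e] \<phi> by simp
  qed (use cautomorphisms_id cautomorphisms_comp cautomorphisms_inv cautomorphismsD(1) mon(4,5) in
      \<open>auto simp: comp_def\<close>)
qed

section \<open>Full existence\<close>

theorem theorem3p5:
  fixes \<kappa> :: "'i rel"
    and L :: "('f, 'p) lang" and T :: "('f, 'p) fm set" and M :: "('f, 'p, 'a) struct"
    and L' :: "('g, 'q) clang" and T' :: "('g, 'q) cfm set" and M' :: "('g, 'q, 'm) cstruct"
  shows "(complete_theory L T \<and> discrete_monster_model \<kappa> L T M \<longrightarrow>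
           (\<forall>A b c. hyperimaginary_set \<kappa> (discrete_frame L M) A \<and> real_tuple \<kappa> b \<and> real_tuple \<kappa> c \<longrightarrow>
             (\<exists>b'. real_tuple \<kappa> b' \<and> conjugate_over (discrete_frame L M) A b b' \<and>
                   bu_indep \<kappa> (discrete_frame L M) A b' c)))
       \<and> (complete_ctheory L' T' \<and> continuous_monster_model \<kappa> L' T' M' \<longrightarrow>
           (\<forall>A b c. hyperimaginary_set \<kappa> (continuous_frame L' M') A \<and> real_tuple \<kappa> b \<and> real_tuple \<kappa> c \<longrightarrow>
             (\<exists>b'. real_tuple \<kappa> b' \<and> conjugate_over (continuous_frame L' M') A b b' \<and>
                   bu_indep \<kappa> (continuous_frame L' M') A b' c)))"
  using monster_frame.bu_existence[OF discrete_monster_frame]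
    monster_frame.bu_existence[OF continuous_monster_frame] by blast

end
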